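(* Let $\omega\in C^2(\mathbb S)$ and $\hat{\bm\alpha}\in\mathbb M_1(\mathbb S)$. Let $\mathfrak T^\omega_{\hat{\bm\alpha}}$ be the closure in $L^2(\mu_{\hat{\bm\alpha}})$ of the set $\mathfrak T^\omega_0$ of germs of closed forms with both components in $T^\omega$, let $\mathfrak E^\omega_{\hat{\bm\alpha}}$ be the closure in $L^2(\mu_{\hat{\bm\alpha}})$ of the set $\mathfrak E^\omega_0=\{\bm\nabla\Sigma_h:h\in\mathcal T_0^\omega\}$, and let $\mathfrak J^\omega$ be the span of the germs of current forms $\mathfrak j^{a,i},\mathfrak j^{p,i},\mathfrak j^{a,\omega,i},\mathfrak j^{p,\omega,i}$, $i=1,2$. Then $$\mathfrak T^\omega_{\hat{\bm\alpha}}=\mathfrak E^\omega_{\hat{\bm\alpha}}\oplus\mathfrak J^\omega .$$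
   Context: Configurations on $\mathbb Z^2$ ($\Sigma_\infty$ is the set of all of them): $\hat\eta_x=((\eta^a_x,\eta^p_x),\theta_x)$, $(\eta^a_x,\eta^p_x)\in\{(1,0),(0,1),(0,0)\}$, $\theta_x\in\mathbb S=[0,2\pi)$ (the circle), $\theta_x=0$ if empty; $\eta_x=\eta^a_x+\eta^p_x$; $\eta^{\sigma,\omega}_x=\omega(\theta_x)\eta^\sigma_x$ for $\sigma\in\{a,p\}$. Cylinder functions ($\mathcal C$) depend on finitely many sites and are $C^2$ in the angles. $\tau_x$ is translation by $x$; $\hat\eta^{x,y}$ swaps $\hat\eta_x,\hat\eta_y$; $\nabla_{x,y}f(\hat\eta)=\eta_x(1-\eta_y)(f(\hat\eta^{x,y})-f(\hat\eta))$. $\mathbb M_1(\mathbb S)$: pairs $\hat{\bm\alpha}=(\hat\alpha^a,\hat\alpha^p)$ of non-negative measures on $\mathbb S$ with total mass $\alpha=\hat\alpha^a(\mathbb S)+\hat\alpha^p(\mathbb S)\le1$. Under $\mu_{\hat{\bm\alpha}}$ sites are i.i.d.: a site holds a type-$\sigma$ particle with angle in $d\theta$ with probability $\hat\alpha^\sigma(d\theta)$ and is empty with probability $1-\alpha$. Pairs of functions are given the norm $\mathbb E_{\hat{\bm\alpha}}[\mathfrak u_1^2+\mathfrak u_2^2]^{1/2}$. Function classes: $T^\omega$ is the linear span of cylinder functions $\sum_x(a\eta^a_x+b\eta^p_x+c\eta^{a,\omega}_x+d\eta^{p,\omega}_x)F_x(\eta)$ with $a,b,c,d\in\mathbb R$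 and each $F_x$ depending only on $\eta=(\eta_y)_y$. With $B_l=\{-l,\dots,l\}^2$, a canonical state $\hat K$ on $B_l$ is the list of types and angles of at most $|B_l|$ particles, and $\mu_{l,\hat K}$ is the law of the configuration obtained by placing these particles at uniformly chosen distinct sites of $B_l$. $\mathcal C_0$ is the set of $\psi\in\mathcal C$ with mean zero under every canonical measure $\mu_{s_\psi,\hat K}$, $s_\psi$ being the smallest $s$ with $\operatorname{supp}\psi\subset B_s$; $\mathcal T^\omega_0=\mathcal C_0\cap T^\omega$. Differential forms: a differential form is a collection $(\mathfrak u_{x,x+z})_{x\in\mathbb Z^2,|z|=1}$ of $L^2(\mu_{\hat{\bm\alpha}})$ functions with $\mathfrak u_{x,x+z}=\eta_x(1-\eta_{x+z})\mathfrak u_{x,x+z}$. A path is a finite sequence of nearest-neighbour jumps $\gamma=(x_i,x_i+z_i)_{i=1}^{n}$; started from $\hat\eta$ it is licit if the jumps can be performed successively (each $x_i$ occupied and $x_i+z_i$ empty in the configuration $\hat\eta^{(i)}$ reached just before the $i$-th jump), and licit closed if moreover the configuration after the last jump is $\hat\eta$. The integral along a licit path is $\sum_{i=1}^n\mathfrak u_{x_i,x_i+z_i}(\hat\eta^{(i)})$. The form is closed if its integral along every licit closed path from every $\hat\eta\in\Sigma_\infty$ is $0$. A pair $(\mathfrak u_1,\mathfrak u_2)$ of $L^2(\mu_{\hat{\bm\alpha}})$ functions is a germ of a closed form if $\mathfrak u_{x,x+e_i}=\tau_x\mathfrak u_i$, $\mathfrak u_{x,x-e_i}(\hat\eta)=-\mathfrak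 u_{x-e_i,x}(\hat\eta^{x,x-e_i})$ ($i=1,2$) defines a closed form. $\bm\nabla\Sigma_h=(\nabla_{0,e_1}\Sigma_h,\nabla_{0,e_2}\Sigma_h)$ with $\Sigma_h=\sum_{x\in\mathbb Z^2}\tau_xh$ formally (the gradients are finite sums). Germs of current forms: $\mathfrak j^{\sigma,i}$ and $\mathfrak j^{\sigma,\omega,i}$ have components $\mathfrak j^{\sigma,i}_k=\delta_{i,k}\eta_0^\sigma(1-\eta_{e_i})$ and $\mathfrak j^{\sigma,\omega,i}_k=\delta_{i,k}\eta_0^{\sigma,\omega}(1-\eta_{e_i})$, $k=1,2$. *)

theory Defs
  imports "HOL-Probability.Probability" "HOL-Library.Function_Algebras"
    "HOL-Library.Set_Algebras" "HOL-Library.Real_Mod"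
begin

section \<open>Real-valued functions as a vector space\<close>

instantiation "fun" :: (type, real_vector) real_vector
begin

definition scaleR_fun :: "real \<Rightarrow> ('a \<Rightarrow> 'b) \<Rightarrow> 'a \<Rightarrow> 'b" where
  "scaleR_fun c f = (\<lambda>x. c *\<^sub>R f x)"

instance
  by standard (auto simp: scaleR_fun_def fun_eq_iff scaleR_add_right scaleR_add_left)

end

section \<open>Configurations\<close>

type_synonym site = "int \<times> int"
type_synonym site_state = "(nat \<times> nat) \<times> real"
type_synonym config = "site \<Rightarrow> site_state"

definition evec :: "nat \<Rightarrow> site" where
  "evec i = (if i = 1 then (1, 0) else (0, 1))"

definition unit_step :: "site \<Rightarrow> bool" where
  "unit_step z \<longleftrightarrow> \<bar>fst z\<bar> + \<bar>snd z\<bar> = 1"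

text \<open>The circle is represented by \<open>[0, 2\<pi>)\<close>. Its Borel sets are those of the circle topology,
  but continuity and differentiability on the circle are expressed below by pulling functions back
  to the real line along \<open>t \<mapsto> t rmod (2 * pi)\<close>.\<close>

definition circle :: "real set" where
  "circle = {0..<2 * pi}"

definition empty_site :: site_state where
  "empty_site = ((0, 0), 0)"

definition site_states :: "site_state set" where
  "site_states = {(n, t). n \<in> {(1, 0), (0, 1), (0, 0)} \<and> t \<in> circle \<and> (n = (0, 0) \<longrightarrow> t = 0)}"

definition Sigma_inf :: "config set" where
  "Sigma_inf = {\<eta>. \<forall>x. \<eta> x \<in> site_states}"

definition num_a :: "config \<Rightarrow> site \<Rightarrow> real" where
  "num_a \<eta> x = real (fst (fst (\<eta> x)))"

definition num_p :: "config \<Rightarrow> site \<Rightarrow> real" where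
  "num_p \<eta> x = real (snd (fst (\<eta> x)))"

definition occ :: "config \<Rightarrow> site \<Rightarrow> real" where
  "occ \<eta> x = num_a \<eta> x + num_p \<eta> x"

definition num_a_ang :: "(real \<Rightarrow> real) \<Rightarrow> config \<Rightarrow> site \<Rightarrow> real" where
  "num_a_ang \<omega> \<eta> x = \<omega> (snd (\<eta> x)) * num_a \<eta> x"

definition num_p_ang :: "(real \<Rightarrow> real) \<Rightarrow> config \<Rightarrow> site \<Rightarrow> real" where
  "num_p_ang \<omega> \<eta> x = \<omega> (snd (\<eta> x)) * num_p \<eta> x"

definition translate :: "site \<Rightarrow> (config \<Rightarrow> real) \<Rightarrow> config \<Rightarrow> real" where
  "translate x f \<eta> = f (\<lambda>y. \<eta> (x + y))"

definition exch :: "site \<Rightarrow> site \<Rightarrow> config \<Rightarrow> config" where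
  "exch x y \<eta> = \<eta>(x := \<eta> y, y := \<eta> x)"

definition nabla :: "site \<Rightarrow> site \<Rightarrow> (config \<Rightarrow> real) \<Rightarrow> config \<Rightarrow> real" where
  "nabla x y f \<eta> = occ \<eta> x * (1 - occ \<eta> y) * (f (exch x y \<eta>) - f \<eta>)"

section \<open>Cylinder functions\<close>

text \<open>Functions are total on the type \<^typ>\<open>config\<close>, but only their values on \<^const>\<open>Sigma_inf\<close>
  are ever constrained.\<close>

definition depends_on :: "(config \<Rightarrow> real) \<Rightarrow> site set \<Rightarrow> bool" where
  "depends_on f A \<longleftrightarrow>
     (\<forall>\<eta>\<in>Sigma_inf. \<forall>\<xi>\<in>Sigma_inf. (\<forall>x\<in>A. \<eta> x = \<xi> x) \<longrightarrow> f \<eta> = f \<xi>)"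

definition C2_circle :: "(real \<Rightarrow> real) \<Rightarrow> bool" where
  "C2_circle \<omega> \<longleftrightarrow> (\<exists>\<omega>' \<omega>''.
     (\<forall>t. ((\<lambda>s. \<omega> (s rmod (2 * pi))) has_real_derivative \<omega>' t) (at t)) \<and>
     (\<forall>t. (\<omega>' has_real_derivative \<omega>'' t) (at t)) \<and>
     continuous_on UNIV \<omega>'')"

text \<open>All partial derivatives up to order two exist and are jointly continuous. Continuity is with
  respect to the product topology; for a function of finitely many coordinates this is the usual
  joint continuity.\<close>

definition C2_multi :: "((site \<Rightarrow> real) \<Rightarrow> real) \<Rightarrow> bool" where
  "C2_multi g \<longleftrightarrow> (\<exists>g1 g2. continuous_on UNIV g \<and>
     (\<forall>x. continuous_on UNIV (g1 x) \<and>
        (\<forall>\<theta>. ((\<lambda>t. g (\<theta>(x := t))) has_real_derivative g1 x \<theta>) (at (\<theta> x)))) \<and>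
     (\<forall>x y. continuous_on UNIV (g2 x y) \<and>
        (\<forall>\<theta>. ((\<lambda>t. g1 x (\<theta>(y := t))) has_real_derivative g2 x y \<theta>) (at (\<theta> y)))))"

text \<open>Keeps the types of the particles of \<open>\<eta>\<close> and replaces their angles by \<open>\<theta>\<close> modulo \<open>2\<pi>\<close>.\<close>

definition with_angles :: "config \<Rightarrow> (site \<Rightarrow> real) \<Rightarrow> config" where
  "with_angles \<eta> \<theta> x =
     (if \<eta> x = empty_site then empty_site else (fst (\<eta> x), \<theta> x rmod (2 * pi)))"

definition cylinder :: "(config \<Rightarrow> real) \<Rightarrow> bool" where
  "cylinder f \<longleftrightarrow> (\<exists>A. finite A \<and> depends_on f A) \<and>
     (\<forall>\<eta>\<in>Sigma_inf. C2_multi (\<lambda>\<theta>. f (with_angles \<eta> \<theta>)))"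

definition T_omega :: "(real \<Rightarrow> real) \<Rightarrow> (config \<Rightarrow> real) set" where
  "T_omega \<omega> = span {f. cylinder f \<and> (\<exists>a b c d F A. finite A \<and>
     (\<forall>\<eta>\<in>Sigma_inf. f \<eta> = (\<Sum>x\<in>A.
        (a * num_a \<eta> x + b * num_p \<eta> x + c * num_a_ang \<omega> \<eta> x + d * num_p_ang \<omega> \<eta> x)
          * F x (occ \<eta>))))}"

section \<open>Canonical measures\<close>

definition site_box :: "nat \<Rightarrow> site set" where
  "site_box l = {- int l..int l} \<times> {- int l..int l}"

definition canonical_states :: "nat \<Rightarrow> site_state list set" where
  "canonical_states l = {K. set K \<subseteq> site_states - {empty_site} \<and> length K \<le> card (site_box l)}"

definition place :: "site_state list \<Rightarrow> site list \<Rightarrow> config" where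
  "place K xs y = (case map_of (zip xs K) y of None \<Rightarrow> empty_site | Some s \<Rightarrow> s)"

text \<open>Configurations on the box are extended by empty sites outside of it; the canonical measure is
  only applied to functions depending on the box.\<close>

definition canonical_measure :: "nat \<Rightarrow> site_state list \<Rightarrow> config pmf" where
  "canonical_measure l K = map_pmf (place K)
     (pmf_of_set {xs. length xs = length K \<and> distinct xs \<and> set xs \<subseteq> site_box l})"

definition supp_radius :: "(config \<Rightarrow> real) \<Rightarrow> nat" where
  "supp_radius \<psi> = (LEAST s. depends_on \<psi> (site_box s))"

definition C_zero :: "(config \<Rightarrow> real) set" where
  "C_zero = {\<psi>. cylinder \<psi> \<and> (\<forall>K\<in>canonical_states (supp_radius \<psi>).
     measure_pmf.expectation (canonical_measure (supp_radius \<psi>) K) \<psi> = 0)}"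

definition T_omega_zero :: "(real \<Rightarrow> real) \<Rightarrow> (config \<Rightarrow> real) set" where
  "T_omega_zero \<omega> = C_zero \<inter> T_omega \<omega>"

section \<open>Grand-canonical measures\<close>

type_synonym param = "real measure \<times> real measure"

definition M1_circle :: "param set" where
  "M1_circle = {(\<alpha>a, \<alpha>p).
     sets \<alpha>a = sets (restrict_space borel circle) \<and>
     sets \<alpha>p = sets (restrict_space borel circle) \<and>
     emeasure \<alpha>a circle + emeasure \<alpha>p circle \<le> 1}"

definition site_mass :: "param \<Rightarrow> site_state set \<Rightarrow> ennreal" where
  "site_mass \<alpha> A =
     emeasure (fst \<alpha>) {\<theta>\<in>circle. ((1, 0), \<theta>) \<in> A}
     + emeasure (snd \<alpha>) {\<theta>\<in>circle. ((0, 1), \<theta>) \<in> A}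
     + (1 - (emeasure (fst \<alpha>) circle + emeasure (snd \<alpha>) circle)) * indicator A empty_site"

definition site_law :: "param \<Rightarrow> site_state measure" where
  "site_law \<alpha> = measure_of site_states (sets (restrict_space borel site_states)) (site_mass \<alpha>)"

definition mu :: "param \<Rightarrow> config measure" where
  "mu \<alpha> = PiM UNIV (\<lambda>_. site_law \<alpha>)"

section \<open>Square-integrable functions and closures\<close>

type_synonym germ = "(config \<Rightarrow> real) \<times> (config \<Rightarrow> real)"

definition L2 :: "param \<Rightarrow> (config \<Rightarrow> real) set" where
  "L2 \<alpha> = {f \<in> borel_measurable (mu \<alpha>). integrable (mu \<alpha>) (\<lambda>\<eta>. (f \<eta>)\<^sup>2)}"

definition germ_norm :: "param \<Rightarrow> germ \<Rightarrow> real" where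
  "germ_norm \<alpha> u = sqrt (\<integral>\<eta>. (fst u \<eta>)\<^sup>2 + (snd u \<eta>)\<^sup>2 \<partial>mu \<alpha>)"

text \<open>Elements of \<open>L\<^sup>2\<close> are represented by functions, not by equivalence classes; hence an
  \<open>L\<^sup>2\<close>-closure is a set of functions saturated under almost sure equality.\<close>

definition L2_closure :: "param \<Rightarrow> germ set \<Rightarrow> germ set" where
  "L2_closure \<alpha> S = {u \<in> L2 \<alpha> \<times> L2 \<alpha>.
     \<forall>\<epsilon>>0. \<exists>v \<in> S \<inter> (L2 \<alpha> \<times> L2 \<alpha>). germ_norm \<alpha> (u - v) < \<epsilon>}"

section \<open>Differential forms\<close>

type_synonym form = "site \<Rightarrow> site \<Rightarrow> config \<Rightarrow> real"

text \<open>A path is a list of jumps; the entry \<open>(x, z)\<close> stands for the jump from \<open>x\<close> to \<open>x + z\<close>.\<close>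

type_synonym jump_path = "(site \<times> site) list"

fun licit :: "config \<Rightarrow> jump_path \<Rightarrow> bool" where
  "licit \<eta> [] = True"
| "licit \<eta> ((x, z) # \<gamma>) \<longleftrightarrow>
     unit_step z \<and> occ \<eta> x = 1 \<and> occ \<eta> (x + z) = 0 \<and> licit (exch x (x + z) \<eta>) \<gamma>"

fun path_end :: "config \<Rightarrow> jump_path \<Rightarrow> config" where
  "path_end \<eta> [] = \<eta>"
| "path_end \<eta> ((x, z) # \<gamma>) = path_end (exch x (x + z) \<eta>) \<gamma>"

fun path_integral :: "form \<Rightarrow> config \<Rightarrow> jump_path \<Rightarrow> real" where
  "path_integral u \<eta> [] = 0"
| "path_integral u \<eta> ((x, z) # \<gamma>) = u x (x + z) \<eta> + path_integral u (exch x (x + z) \<eta>) \<gamma>"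

definition differential_form :: "param \<Rightarrow> form \<Rightarrow> bool" where
  "differential_form \<alpha> u \<longleftrightarrow> (\<forall>x z. unit_step z \<longrightarrow> u x (x + z) \<in> L2 \<alpha> \<and>
     (\<forall>\<eta>\<in>Sigma_inf. u x (x + z) \<eta> = occ \<eta> x * (1 - occ \<eta> (x + z)) * u x (x + z) \<eta>))"

definition closed_form :: "param \<Rightarrow> form \<Rightarrow> bool" where
  "closed_form \<alpha> u \<longleftrightarrow> differential_form \<alpha> u \<and>
     (\<forall>\<eta>\<in>Sigma_inf. \<forall>\<gamma>. licit \<eta> \<gamma> \<and> path_end \<eta> \<gamma> = \<eta> \<longrightarrow> path_integral u \<eta> \<gamma> = 0)"

definition form_of_germ :: "germ \<Rightarrow> form" where
  "form_of_germ u x y \<eta> =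
     (if y = x + evec 1 then translate x (fst u) \<eta>
      else if y = x + evec 2 then translate x (snd u) \<eta>
      else if y = x - evec 1 then - translate (x - evec 1) (fst u) (exch x (x - evec 1) \<eta>)
      else if y = x - evec 2 then - translate (x - evec 2) (snd u) (exch x (x - evec 2) \<eta>)
      else 0)"

definition closed_germ :: "param \<Rightarrow> germ \<Rightarrow> bool" where
  "closed_germ \<alpha> u \<longleftrightarrow> u \<in> L2 \<alpha> \<times> L2 \<alpha> \<and> closed_form \<alpha> (form_of_germ u)"

text \<open>For a cylinder function \<open>h\<close>, only finitely many terms of the sum are nonzero.\<close>

definition nabla_Sigma_comp :: "nat \<Rightarrow> (config \<Rightarrow> real) \<Rightarrow> config \<Rightarrow> real" where
  "nabla_Sigma_comp i h \<eta> = (\<Sum>\<^sub>\<infinity>x. nabla 0 (evec i) (translate x h) \<eta>)"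

definition nabla_Sigma :: "(config \<Rightarrow> real) \<Rightarrow> germ" where
  "nabla_Sigma h = (nabla_Sigma_comp 1 h, nabla_Sigma_comp 2 h)"

definition current_comp :: "(config \<Rightarrow> site \<Rightarrow> real) \<Rightarrow> nat \<Rightarrow> nat \<Rightarrow> config \<Rightarrow> real" where
  "current_comp n i k \<eta> = of_bool (i = k) * (n \<eta> 0 * (1 - occ \<eta> (evec i)))"

definition current_germ :: "(config \<Rightarrow> site \<Rightarrow> real) \<Rightarrow> nat \<Rightarrow> germ" where
  "current_germ n i = (current_comp n i 1, current_comp n i 2)"

section \<open>The three spaces of germs\<close>

definition germs_T_zero :: "(real \<Rightarrow> real) \<Rightarrow> param \<Rightarrow> germ set" where
  "germs_T_zero \<omega> \<alpha> = {u. closed_germ \<alpha> u \<and> fst u \<in> T_omega \<omega> \<and> snd u \<in> T_omega \<omega>}"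

definition germs_T :: "(real \<Rightarrow> real) \<Rightarrow> param \<Rightarrow> germ set" where
  "germs_T \<omega> \<alpha> = L2_closure \<alpha> (germs_T_zero \<omega> \<alpha>)"

definition germs_E_zero :: "(real \<Rightarrow> real) \<Rightarrow> germ set" where
  "germs_E_zero \<omega> = nabla_Sigma ` T_omega_zero \<omega>"

definition germs_E :: "(real \<Rightarrow> real) \<Rightarrow> param \<Rightarrow> germ set" where
  "germs_E \<omega> \<alpha> = L2_closure \<alpha> (germs_E_zero \<omega>)"

definition germs_J :: "(real \<Rightarrow> real) \<Rightarrow> germ set" where
  "germs_J \<omega> = span (\<Union>i\<in>{1, 2}. {current_germ num_a i, current_germ num_p i,
     current_germ (num_a_ang \<omega>) i, current_germ (num_p_ang \<omega>) i})"

section \<open>The measures are well defined\<close>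

lemma circle_borel [measurable]: "circle \<in> sets borel"
  by (simp add: circle_def)

lemma site_mass_measure_space:
  assumes "\<alpha> \<in> M1_circle"
  shows "measure_space site_states (sets (restrict_space borel site_states)) (site_mass \<alpha>)"
proof -
  obtain \<alpha>a \<alpha>p where \<alpha>: "\<alpha> = (\<alpha>a, \<alpha>p)" by (cases \<alpha>)
  let ?N = "restrict_space borel site_states"
  have sp: "space ?N = site_states" by (simp add: space_restrict_space)
  have sa: "sets \<alpha>a = sets (restrict_space borel circle)"
    and spp: "sets \<alpha>p = sets (restrict_space borel circle)"
    using assms by (auto simp: M1_circle_def \<alpha>)
  have spa: "space \<alpha>a = circle" "space \<alpha>p = circle"
    using sets_eq_imp_space_eq[OF sa] sets_eq_imp_space_eq[OF spp]
    by (simp_all add: space_restrict_space)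
  have cont: "(\<lambda>t. (n, t)) \<in> borel_measurable borel" for n :: "nat \<times> nat"
    by (intro borel_measurable_continuous_onI continuous_intros)
  have mr: "(\<lambda>t. (n, t)) \<in> measurable (restrict_space borel circle) ?N"
    if "n = (1,0) \<or> n = (0,1)" for n :: "nat \<times> nat"
    by (rule measurable_restrict_space3[OF cont]) (use that in \<open>auto simp: site_states_def\<close>)
  have ma: "(\<lambda>t. ((1, 0), t)) \<in> measurable \<alpha>a ?N"
    using mr[of "(1,0)"] by (simp cong: measurable_cong_sets add: sa)
  have mp: "(\<lambda>t. ((0, 1), t)) \<in> measurable \<alpha>p ?N"
    using mr[of "(0,1)"] by (simp cong: measurable_cong_sets add: spp)
  have m0: "(\<lambda>t::unit. empty_site) \<in> measurable (count_space UNIV) ?N"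
    by (rule measurable_const) (simp only: sp, simp add: site_states_def empty_site_def circle_def)
  let ?c = "1 - (emeasure \<alpha>a circle + emeasure \<alpha>p circle)"
  let ?A = "distr \<alpha>a ?N (\<lambda>t. ((1, 0), t))"
  let ?P = "distr \<alpha>p ?N (\<lambda>t. ((0, 1), t))"
  let ?R = "scale_measure ?c (distr (count_space UNIV) ?N (\<lambda>t::unit. empty_site))"
  have eq: "site_mass \<alpha> X = emeasure ?A X + emeasure ?P X + emeasure ?R X"
    if X: "X \<in> sets ?N" for X
  proof -
    have "(\<lambda>t::unit. empty_site) -` X = (if empty_site \<in> X then UNIV else {})" by auto
    then have "emeasure ?R X = ?c * indicator X empty_site"
      using X m0 by (simp add: emeasure_distr)
    moreover have "emeasure ?A X = emeasure \<alpha>a {\<theta>\<in>circle. ((1, 0), \<theta>) \<in> X}"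
      unfolding emeasure_distr[OF ma X] by (intro arg_cong[where f = "emeasure \<alpha>a"]) (auto simp: spa)
    moreover have "emeasure ?P X = emeasure \<alpha>p {\<theta>\<in>circle. ((0, 1), \<theta>) \<in> X}"
      unfolding emeasure_distr[OF mp X] by (intro arg_cong[where f = "emeasure \<alpha>p"]) (auto simp: spa)
    ultimately show ?thesis by (simp add: site_mass_def \<alpha>)
  qed
  have "sigma_algebra site_states (sets ?N)"
    using sets.sigma_algebra_axioms[of ?N] by (simp add: sp)
  moreover have "positive (sets ?N) (site_mass \<alpha>)"
    by (simp add: positive_def site_mass_def)
  moreover have "countably_additive (sets ?N) (site_mass \<alpha>)"
  proof (rule countably_additiveI)
    fix B :: "nat \<Rightarrow> site_state set"
    assume B: "range B \<subseteq> sets ?N" "disjoint_family B" "(\<Union>i. B i) \<in> sets ?N"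
    have BN: "B i \<in> sets ?N" for i using B(1) by auto
    have s: "(\<Sum>i. emeasure M (B i)) = emeasure M (\<Union>i. B i)" if "sets M = sets ?N" for M
      using B that by (intro suminf_emeasure) auto
    have "(\<Sum>i. site_mass \<alpha> (B i)) = (\<Sum>i. emeasure ?A (B i) + emeasure ?P (B i) + emeasure ?R (B i))"
      using BN by (intro suminf_cong eq)
    also have "\<dots> = (\<Sum>i. emeasure ?A (B i)) + (\<Sum>i. emeasure ?P (B i)) + (\<Sum>i. emeasure ?R (B i))"
      by (simp only: suminf_add[symmetric] summableI)
    also have "\<dots> = emeasure ?A (\<Union>i. B i) + emeasure ?P (\<Union>i. B i) + emeasure ?R (\<Union>i. B i)"
      by (simp only: s sets_distr sets_scale_measure)
    also have "\<dots> = site_mass \<alpha> (\<Union>i. B i)" using eq[OF B(3)] by simp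
    finally show "(\<Sum>i. site_mass \<alpha> (B i)) = site_mass \<alpha> (\<Union>i. B i)" .
  qed
  ultimately show ?thesis by (simp add: measure_space_def)
qed

lemma space_site_law [simp]: "space (site_law \<alpha>) = site_states"
  unfolding site_law_def
  by (rule space_measure_of)
     (use sets.space_closed[of "restrict_space borel site_states"] in \<open>simp add: space_restrict_space\<close>)

lemma sets_site_law [simp]: "sets (site_law \<alpha>) = sets (restrict_space borel site_states)"
  unfolding site_law_def
  using sets.sets_measure_of_eq[of "restrict_space borel site_states"]
  by (simp add: space_restrict_space)

lemma emeasure_site_law:
  assumes "\<alpha> \<in> M1_circle" "A \<in> sets (restrict_space borel site_states)"
  shows "emeasure (site_law \<alpha>) A = site_mass \<alpha> A"
proof -
  note ms = site_mass_measure_space[OF assms(1), unfolded measure_space_def]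
  show ?thesis
    unfolding site_law_def
    by (rule emeasure_measure_of_sigma) (use ms assms(2) in auto)
qed

lemma prob_space_site_law:
  assumes "\<alpha> \<in> M1_circle"
  shows "prob_space (site_law \<alpha>)"
proof (rule prob_spaceI)
  have top: "site_states \<in> sets (restrict_space borel site_states)"
    using sets.top[of "restrict_space borel site_states"] by (simp add: space_restrict_space)
  have "{\<theta>\<in>circle. ((1, 0), \<theta>) \<in> site_states} = circle"
    "{\<theta>\<in>circle. ((0, 1), \<theta>) \<in> site_states} = circle" "empty_site \<in> site_states"
    by (auto simp: site_states_def empty_site_def circle_def)
  then have "site_mass \<alpha> site_states = 1"
    using assms by (auto simp: site_mass_def M1_circle_def add_diff_inverse_ennreal)
  then show "emeasure (site_law \<alpha>) (space (site_law \<alpha>)) = 1"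
    by (simp add: emeasure_site_law[OF assms top])
qed

lemma prob_space_mu:
  assumes "\<alpha> \<in> M1_circle"
  shows "prob_space (mu \<alpha>)"
  unfolding mu_def by (intro prob_space_PiM prob_space_site_law assms)

lemma space_mu: "space (mu \<alpha>) = Sigma_inf"
  by (auto simp: mu_def space_PiM Sigma_inf_def PiE_def Pi_def)

end

theory Submission
  imports Defs "HOL-Combinatorics.Permutations" "HOL-Real_Asymp.Real_Asymp"
begin

text \<open>
  The decomposition is purely algebraic up to the centring of the functions \<open>h\<close>: a closed germ with
  components in \<open>T\<^sup>\<omega>\<close> is the sum of the gradient of \<open>\<Sum>\<^sub>x \<tau>\<^sub>x h\<close> for some \<open>h\<close> in \<open>T\<^sup>\<omega>\<close>, which need not be centred,
  and of a current. Closures only enter to centre \<open>h\<close>.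

  Exactness. On the jumps of an isolated particle a closed germ is a function of its type and angle,
  so it agrees there with a current. After subtraction of this current isolated particles move
  freely, and the work of carrying a particle to infinity makes sense. Carry the particles of a finite
  configuration away one after the other, upwards, in decreasing lexicographic order. Minus the work
  is a potential. Removing a particle involves only the nearby particles that precede it, so the
  potential is \<open>\<Sum>\<^sub>x \<tau>\<^sub>x h\<close> with \<open>h\<close> local, and \<open>h\<close> is as linear in types and angles as the germ.
  Closedness allows to interchange removals (\<open>lift_commute\<close>, \<open>potential_remove\<close>) and to interchange a jump
  with the removal of another particle; by induction on the number of particles the gradient of the
  potential is the germ (\<open>bond_eq_potential_difference\<close>). The plane is used here: there is room to pass
  around other particles. Both sides being local, the identity extends to infinite configurations
  (\<open>closed_germ_decomposition\<close>).

  Centring. Let \<open>h\<^sub>l\<close> be the average of \<open>h\<close> over the permutations of the sites of \<open>B\<^sub>l\<close>, that is, its canonical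
  expectation. Then \<open>h - h\<^sub>l\<close> is centred. Moving a particle inside a translate of \<open>B\<^sub>l\<close> does not change the
  translate of \<open>h\<^sub>l\<close>; moving it across the boundary changes it by \<open>O(l\<^sup>-\<^sup>2)\<close>, and a given jump crosses the boundary of
  \<open>O(l)\<close> translates. So the gradient of \<open>\<Sum>\<^sub>x \<tau>\<^sub>x h\<^sub>l\<close> is \<open>O(1/l)\<close> (\<open>nabla_Sigma_box_average\<close>), and gradients with and
  without centring have the same closure.

  The sum of a closed subspace and the finite-dimensional space of currents is closed
  (\<open>L2_closure_add_span\<close>), which gives the equality of the theorem.

  Directness. If a path of jumps moves a pattern observed by \<open>f\<close> by a vector \<open>e\<close>, then integrating a germ
  along this path and pairing the result with \<open>f\<close> is a mean-square continuous functional. It vanishes on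
  gradients, because the measure is invariant under relabelling of the sites and the resulting sum over
  translates telescopes (\<open>test_functional_nabla_Sigma\<close>). Two patterns suffice to show that a current in the
  closure of the gradients vanishes almost surely (\<open>current_in_closure_of_exact\<close>): a hole, and a particle
  with a hole in front of it, where the hole walks around the particle.
\<close>

section \<open>Configurations\<close>

lemma empty_site_in [simp]: "empty_site \<in> site_states"
  by (simp add: empty_site_def site_states_def circle_def)

lemma Sigma_inf_site: "\<eta> \<in> Sigma_inf \<Longrightarrow> \<eta> x \<in> site_states"
  unfolding Sigma_inf_def by blast

lemma fst_empty_site [simp]: "fst empty_site = (0, 0)"
  by (simp add: empty_site_def)

lemma site_states_empty_iff: "s \<in> site_states \<Longrightarrow> s = empty_site \<longleftrightarrow> fst s = (0, 0)"
  by (auto simp: site_states_def empty_site_def)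

lemma occ_alt: "occ \<eta> x = real (fst (fst (\<eta> x))) + real (snd (fst (\<eta> x)))"
  by (simp add: occ_def num_a_def num_p_def)

lemma occ_cong: "\<eta> x = \<xi> y \<Longrightarrow> occ \<eta> x = occ \<xi> y"
  by (simp add: occ_alt)

lemma occ_Sigma: "\<eta> \<in> Sigma_inf \<Longrightarrow> occ \<eta> x = of_bool (\<eta> x \<noteq> empty_site)"
  using site_states_empty_iff[of "\<eta> x"] Sigma_inf_site[of \<eta> x]
  by (auto simp: occ_alt site_states_def)

lemma occ_eq_0_iff: "\<eta> \<in> Sigma_inf \<Longrightarrow> occ \<eta> x = 0 \<longleftrightarrow> \<eta> x = empty_site"
  and occ_eq_1_iff: "\<eta> \<in> Sigma_inf \<Longrightarrow> occ \<eta> x = 1 \<longleftrightarrow> \<eta> x \<noteq> empty_site"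
  by (simp_all add: occ_Sigma)

lemma Sigma_infI: "(\<And>x. \<eta> x \<in> site_states) \<Longrightarrow> \<eta> \<in> Sigma_inf"
  unfolding Sigma_inf_def by blast

lemma Sigma_inf_upd [simp]: "\<eta> \<in> Sigma_inf \<Longrightarrow> s \<in> site_states \<Longrightarrow> \<eta>(x := s) \<in> Sigma_inf"
  unfolding Sigma_inf_def mem_Collect_eq fun_upd_apply by (rule allI) (drule spec, rule if_split[THEN iffD2], blast)

lemma Sigma_inf_exch [simp]: "\<eta> \<in> Sigma_inf \<Longrightarrow> exch x y \<eta> \<in> Sigma_inf"
  unfolding exch_def by (rule Sigma_inf_upd, rule Sigma_inf_upd, assumption) (erule Sigma_inf_site)+

lemma Sigma_inf_comp: "\<eta> \<in> Sigma_inf \<Longrightarrow> (\<lambda>x. \<eta> (\<pi> x)) \<in> Sigma_inf"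
  by (rule Sigma_infI) (erule Sigma_inf_site)

lemma Sigma_inf_with_angles: "\<eta> \<in> Sigma_inf \<Longrightarrow> with_angles \<eta> \<theta> \<in> Sigma_inf"
proof -
  have 1: "t rmod (2 * pi) \<in> circle" for t
    unfolding circle_def using rmod_nonneg[of "2*pi" t] rmod_less[of "2*pi" t] by simp
  assume *: "\<eta> \<in> Sigma_inf"
  have "with_angles \<eta> \<theta> x \<in> site_states" for x
  proof (cases "\<eta> x = empty_site")
    case False
    obtain n t where nt: "\<eta> x = (n, t)" by (cases "\<eta> x")
    have "(n, t) \<in> site_states" using Sigma_inf_site[OF *, of x] nt by simp
    moreover have "n \<noteq> (0, 0)" using False site_states_empty_iff[OF calculation] nt by simp
    ultimately have "(n, \<theta> x rmod (2 * pi)) \<in> site_states"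
      using 1[of "\<theta> x"] by (simp add: site_states_def)
    then show ?thesis using False nt by (simp add: with_angles_def)
  qed (simp add: with_angles_def)
  then show ?thesis by (rule Sigma_infI)
qed

text \<open>The configuration read off from \<open>\<eta>\<close> along a partial map \<open>\<rho>\<close> of sites: translations,
  exchanges and truncations are all of this form.\<close>

definition pull :: "(site \<Rightarrow> site option) \<Rightarrow> config \<Rightarrow> config" where
  "pull \<rho> \<eta> y = (case \<rho> y of None \<Rightarrow> empty_site | Some z \<Rightarrow> \<eta> z)"

lemma Sigma_inf_pull [simp]:
  assumes "\<eta> \<in> Sigma_inf" shows "pull \<rho> \<eta> \<in> Sigma_inf"
proof (rule Sigma_infI)
  show "pull \<rho> \<eta> x \<in> site_states" for x
    using Sigma_inf_site[OF assms] by (cases "\<rho> x") (simp_all add: pull_def)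
qed

lemma occ_pull: "occ (pull \<rho> \<eta>) = (\<lambda>y. case \<rho> y of None \<Rightarrow> 0 | Some z \<Rightarrow> occ \<eta> z)"
  by (auto simp: pull_def occ_alt fun_eq_iff split: option.split)

abbreviation trunc :: "site set \<Rightarrow> config \<Rightarrow> config" where
  "trunc B \<equiv> pull (\<lambda>y. if y \<in> B then Some y else None)"

lemma trunc_apply: "trunc B \<eta> y = (if y \<in> B then \<eta> y else empty_site)"
  by (simp add: pull_def)

lemma depends_on_trunc:
  assumes "depends_on f A" "A \<subseteq> B" "\<eta> \<in> Sigma_inf"
  shows "f (trunc B \<eta>) = f \<eta>"
proof -
  have "\<forall>x\<in>A. trunc B \<eta> x = \<eta> x" using assms(2) by (auto simp: trunc_apply)
  then show ?thesis
    using assms(1) Sigma_inf_pull[OF assms(3)] assms(3) unfolding depends_on_def by blast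
qed

lemma depends_on_mono: "depends_on f A \<Longrightarrow> A \<subseteq> B \<Longrightarrow> depends_on f B"
  unfolding depends_on_def by blast

lemma depends_onD:
  "depends_on f A \<Longrightarrow> \<eta> \<in> Sigma_inf \<Longrightarrow> \<xi> \<in> Sigma_inf \<Longrightarrow> (\<And>x. x \<in> A \<Longrightarrow> \<eta> x = \<xi> x) \<Longrightarrow> f \<eta> = f \<xi>"
  unfolding depends_on_def by blast

section \<open>Functions linear in the types and in one weight of the angles\<close>

definition charges :: "(real \<Rightarrow> real) \<Rightarrow> (site_state \<Rightarrow> real) set" where
  "charges \<omega> = {v. \<exists>a b c d. v = (\<lambda>s. (a + c * \<omega> (snd s)) * real (fst (fst s))
      + (b + d * \<omega> (snd s)) * real (snd (fst s)))}"

lemma charges_empty [simp]: "v \<in> charges \<omega> \<Longrightarrow> v empty_site = 0"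
  by (auto simp: charges_def)

lemma charges_add: assumes "v \<in> charges \<omega>" "w \<in> charges \<omega>" shows "(\<lambda>s. v s + w s) \<in> charges \<omega>"
proof -
  from assms obtain a b c d a' b' c' d' where
    "v = (\<lambda>s. (a + c * \<omega> (snd s)) * real (fst (fst s)) + (b + d * \<omega> (snd s)) * real (snd (fst s)))"
    "w = (\<lambda>s. (a' + c' * \<omega> (snd s)) * real (fst (fst s)) + (b' + d' * \<omega> (snd s)) * real (snd (fst s)))"
    unfolding charges_def by blast
  then show ?thesis
    unfolding charges_def
    by (intro CollectI exI[of _ "a+a'"] exI[of _ "b+b'"] exI[of _ "c+c'"] exI[of _ "d+d'"])
       (simp add: fun_eq_iff algebra_simps)
qed

lemma charges_scale: assumes "v \<in> charges \<omega>" shows "(\<lambda>s. r * v s) \<in> charges \<omega>"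
proof -
  from assms obtain a b c d where
    "v = (\<lambda>s. (a + c * \<omega> (snd s)) * real (fst (fst s)) + (b + d * \<omega> (snd s)) * real (snd (fst s)))"
    unfolding charges_def by blast
  then show ?thesis
    unfolding charges_def
    by (intro CollectI exI[of _ "r*a"] exI[of _ "r*b"] exI[of _ "r*c"] exI[of _ "r*d"])
       (simp add: fun_eq_iff algebra_simps)
qed

lemma charges_0: "(\<lambda>s. 0) \<in> charges \<omega>"
  unfolding charges_def
  by (intro CollectI exI[of _ "0::real"]) simp

definition occ_local :: "((site \<Rightarrow> real) \<Rightarrow> real) \<Rightarrow> bool" where
  "occ_local F \<longleftrightarrow> (\<exists>B. finite B \<and> (\<forall>m m'. (\<forall>y\<in>B. m y = m' y) \<longrightarrow> F m = F m'))"

lemma occ_local_const [intro]: "occ_local (\<lambda>m. c)"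
  unfolding occ_local_def by (intro exI[of _ "{}"]) simp

lemma occ_local_site: "occ_local (\<lambda>m. F (m x))"
  unfolding occ_local_def by (intro exI[of _ "{x}"]) simp

lemma occ_local_comb:
  assumes "occ_local F" "occ_local G" shows "occ_local (\<lambda>m. H (F m) (G m))"
proof -
  from assms obtain A B where "finite A" "\<forall>m m'. (\<forall>y\<in>A. m y = m' y) \<longrightarrow> F m = F m'"
    "finite B" "\<forall>m m'. (\<forall>y\<in>B. m y = m' y) \<longrightarrow> G m = G m'" unfolding occ_local_def by blast
  then show ?thesis unfolding occ_local_def
    by (intro exI[of _ "A \<union> B"]) (metis UnI1 UnI2 finite_UnI)
qed

lemma occ_local_pull:
  assumes "occ_local F"
  shows "occ_local (\<lambda>m. F (\<lambda>y. case \<rho> y of None \<Rightarrow> 0 | Some z \<Rightarrow> m z))"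
proof -
  from assms obtain A where A: "finite A" "\<And>m m'. (\<forall>y\<in>A. m y = m' y) \<Longrightarrow> F m = F m'"
    unfolding occ_local_def by blast
  show ?thesis unfolding occ_local_def
  proof (intro exI[of _ "(\<lambda>y. the (\<rho> y)) ` A"] conjI allI impI)
    fix m m' :: "site \<Rightarrow> real"
    assume *: "\<forall>y\<in>(\<lambda>y. the (\<rho> y)) ` A. m y = m' y"
    show "F (\<lambda>y. case \<rho> y of None \<Rightarrow> 0 | Some z \<Rightarrow> m z) = F (\<lambda>y. case \<rho> y of None \<Rightarrow> 0 | Some z \<Rightarrow> m' z)"
      by (rule A(2)) (use * in \<open>force split: option.split\<close>)
  qed (use A in simp)
qed

definition charge_terms :: "(real \<Rightarrow> real) \<Rightarrow> (config \<Rightarrow> real) set" where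
  "charge_terms \<omega> = {f. \<exists>v\<in>charges \<omega>. \<exists>x F. occ_local F \<and>
     (\<forall>\<eta>\<in>Sigma_inf. f \<eta> = v (\<eta> x) * F (occ \<eta>))}"

lemma sum_fun_apply: "(\<Sum>i\<in>I. f i) x = (\<Sum>i\<in>I. f i x)" for f :: "'a \<Rightarrow> 'b \<Rightarrow> real"
  by (induction I rule: infinite_finite_induct) simp_all

lemma charge_termsI:
  assumes "v \<in> charges \<omega>" "occ_local F"
    and "\<And>\<eta>. \<eta> \<in> Sigma_inf \<Longrightarrow> f \<eta> = v (\<eta> x) * F (occ \<eta>)"
  shows "f \<in> charge_terms \<omega>"
  unfolding charge_terms_def mem_Collect_eq
  by (rule bexI[OF _ assms(1)], rule exI[of _ x], rule exI[of _ F]) (use assms in blast)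

lemma charge_terms_null:
  assumes "\<And>\<eta>. \<eta> \<in> Sigma_inf \<Longrightarrow> f \<eta> = 0" shows "f \<in> charge_terms \<omega>"
  by (rule charge_termsI[where x = "(0, 0)", OF charges_0 occ_local_const[of 0]]) (simp add: assms)

lemma C2_multi_add:
  assumes "C2_multi f" "C2_multi g" shows "C2_multi (\<lambda>\<theta>. f \<theta> + g \<theta>)"
proof -
  from assms(1) obtain f1 f2 where f: "continuous_on UNIV f"
     "\<And>x. continuous_on UNIV (f1 x)" "\<And>x \<theta>. ((\<lambda>t. f (\<theta>(x := t))) has_real_derivative f1 x \<theta>) (at (\<theta> x))"
     "\<And>x y. continuous_on UNIV (f2 x y)" "\<And>x y \<theta>. ((\<lambda>t. f1 x (\<theta>(y := t))) has_real_derivative f2 x y \<theta>) (at (\<theta> y))"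
    unfolding C2_multi_def by blast
  from assms(2) obtain g1 g2 where g: "continuous_on UNIV g"
     "\<And>x. continuous_on UNIV (g1 x)" "\<And>x \<theta>. ((\<lambda>t. g (\<theta>(x := t))) has_real_derivative g1 x \<theta>) (at (\<theta> x))"
     "\<And>x y. continuous_on UNIV (g2 x y)" "\<And>x y \<theta>. ((\<lambda>t. g1 x (\<theta>(y := t))) has_real_derivative g2 x y \<theta>) (at (\<theta> y))"
    unfolding C2_multi_def by blast
  show ?thesis unfolding C2_multi_def
    by (rule exI[of _ "\<lambda>x \<theta>. f1 x \<theta> + g1 x \<theta>"], rule exI[of _ "\<lambda>x y \<theta>. f2 x y \<theta> + g2 x y \<theta>"])
       (intro conjI allI continuous_on_add DERIV_add f g)
qed

lemma C2_multi_scale: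
  assumes "C2_multi f" shows "C2_multi (\<lambda>\<theta>. c * f \<theta>)"
proof -
  from assms(1) obtain f1 f2 where f: "continuous_on UNIV f"
     "\<And>x. continuous_on UNIV (f1 x)" "\<And>x \<theta>. ((\<lambda>t. f (\<theta>(x := t))) has_real_derivative f1 x \<theta>) (at (\<theta> x))"
     "\<And>x y. continuous_on UNIV (f2 x y)" "\<And>x y \<theta>. ((\<lambda>t. f1 x (\<theta>(y := t))) has_real_derivative f2 x y \<theta>) (at (\<theta> y))"
    unfolding C2_multi_def by blast
  show ?thesis unfolding C2_multi_def
    by (rule exI[of _ "\<lambda>x \<theta>. c * f1 x \<theta>"], rule exI[of _ "\<lambda>x y \<theta>. c * f2 x y \<theta>"])
       (intro conjI allI continuous_on_mult_left DERIV_cmult f)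
qed

lemma C2_multi_const: "C2_multi (\<lambda>\<theta>. c)"
  unfolding C2_multi_def
  by (rule exI[of _ "\<lambda>x \<theta>. 0"], rule exI[of _ "\<lambda>x y \<theta>. 0"]) auto

text \<open>The weight is a function on the circle, so its pullback along \<open>t \<mapsto> t rmod 2\<pi>\<close> is smooth across
  the multiples of \<open>2\<pi>\<close>; only the derivatives in the angle at \<open>x\<close> survive.\<close>

lemma C2_multi_weight:
  assumes "C2_circle \<omega>" shows "C2_multi (\<lambda>\<theta>. \<omega> (\<theta> x rmod (2 * pi)))"
proof -
  from assms obtain \<omega>1 \<omega>2 where w: "\<And>t. ((\<lambda>s. \<omega> (s rmod (2 * pi))) has_real_derivative \<omega>1 t) (at t)"
     "\<And>t. (\<omega>1 has_real_derivative \<omega>2 t) (at t)" "continuous_on UNIV \<omega>2"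
    unfolding C2_circle_def by blast
  have c0: "continuous_on UNIV (\<lambda>s. \<omega> (s rmod (2 * pi)))"
    by (rule DERIV_continuous_on) (use w(1) in simp)
  have c1: "continuous_on UNIV \<omega>1"
    by (rule DERIV_continuous_on) (use w(2) in simp)
  have pr: "continuous_on UNIV (\<lambda>\<theta>. g (\<theta> x))" if "continuous_on UNIV g" for g :: "real \<Rightarrow> real"
    by (rule continuous_on_compose2[OF that]) (auto intro: continuous_on_product_coordinates)
  show ?thesis unfolding C2_multi_def
  proof (rule exI[of _ "\<lambda>z \<theta>. if z = x then \<omega>1 (\<theta> x) else 0"],
      rule exI[of _ "\<lambda>z y \<theta>. if z = x \<and> y = x then \<omega>2 (\<theta> x) else 0"], intro conjI allI)
    show "continuous_on UNIV (\<lambda>\<theta>. \<omega> (\<theta> x rmod (2 * pi)))" by (rule pr[OF c0])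
    fix z
    show "continuous_on UNIV (\<lambda>\<theta>. if z = x then \<omega>1 (\<theta> x) else 0)"
      using pr[OF c1] by (cases "z = x") auto
    fix y
    show "continuous_on UNIV (\<lambda>\<theta>. if z = x \<and> y = x then \<omega>2 (\<theta> x) else 0)"
      using pr[OF w(3)] by (cases "z = x \<and> y = x") auto
  next
    fix z and \<theta> :: "site \<Rightarrow> real"
    show "((\<lambda>t. \<omega> ((\<theta>(z := t)) x rmod (2 * pi))) has_real_derivative (if z = x then \<omega>1 (\<theta> x) else 0)) (at (\<theta> z))"
      using w(1) by (cases "z = x") auto
  next
    fix z y and \<theta> :: "site \<Rightarrow> real"
    show "((\<lambda>t. if z = x then \<omega>1 ((\<theta>(y := t)) x) else 0) has_real_derivative
        (if z = x \<and> y = x then \<omega>2 (\<theta> x) else 0)) (at (\<theta> y))"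
      using w(2) by (cases "z = x"; cases "y = x") auto
  qed
qed

lemma cylinder_charge_term:
  assumes w: "C2_circle \<omega>" and f: "f \<in> charge_terms \<omega>"
  shows "cylinder f"
proof -
  from f obtain v x F where v: "v \<in> charges \<omega>" and F: "occ_local F"
    and f: "\<And>\<eta>. \<eta> \<in> Sigma_inf \<Longrightarrow> f \<eta> = v (\<eta> x) * F (occ \<eta>)"
    unfolding charge_terms_def by blast
  from F obtain B where B: "finite B" "\<And>m m'. (\<forall>y\<in>B. m y = m' y) \<Longrightarrow> F m = F m'"
    unfolding occ_local_def by blast
  have "depends_on f (insert x B)"
    unfolding depends_on_def
  proof (intro ballI impI)
    fix \<eta> \<xi> assume *: "\<eta> \<in> Sigma_inf" "\<xi> \<in> Sigma_inf" "\<forall>y\<in>insert x B. \<eta> y = \<xi> y"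
    then have "F (occ \<eta>) = F (occ \<xi>)" by (intro B(2)) (simp add: occ_alt)
    then show "f \<eta> = f \<xi>" using * by (simp add: f)
  qed
  moreover have "C2_multi (\<lambda>\<theta>. f (with_angles \<eta> \<theta>))" if \<eta>: "\<eta> \<in> Sigma_inf" for \<eta>
  proof -
    have occ: "occ (with_angles \<eta> \<theta>) = occ \<eta>" for \<theta>
      by (auto simp: with_angles_def occ_alt fun_eq_iff)
    from v obtain a b c d where v': "v = (\<lambda>s. (a + c * \<omega> (snd s)) * real (fst (fst s))
        + (b + d * \<omega> (snd s)) * real (snd (fst s)))" unfolding charges_def by blast
    define na np where "na = real (fst (fst (\<eta> x)))" and "np = real (snd (fst (\<eta> x)))"
    have "f (with_angles \<eta> \<theta>) = (a * na + b * np) * F (occ \<eta>)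
        + ((c * na + d * np) * F (occ \<eta>)) * \<omega> (\<theta> x rmod (2 * pi))" for \<theta>
      using Sigma_inf_with_angles[OF \<eta>, of \<theta>]
      by (simp add: f occ v' with_angles_def na_def np_def algebra_simps)
    then have "(\<lambda>\<theta>. f (with_angles \<eta> \<theta>)) = (\<lambda>\<theta>. (a * na + b * np) * F (occ \<eta>)
        + ((c * na + d * np) * F (occ \<eta>)) * \<omega> (\<theta> x rmod (2 * pi)))" by (rule ext)
    then show ?thesis
      using C2_multi_add[OF C2_multi_const C2_multi_scale[OF C2_multi_weight[OF w]]] by simp
  qed
  moreover have "finite (insert x B)" using B(1) by simp
  ultimately show ?thesis unfolding cylinder_def by blast
qed

lemma subspace_cylinder: "subspace {f. cylinder f}"
proof (rule subspaceI)
  show "0 \<in> {f. cylinder f}"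
    using C2_multi_const[of 0] unfolding cylinder_def depends_on_def zero_fun_def by blast
next
  fix f g assume "f \<in> {f. cylinder f}" "g \<in> {f. cylinder f}"
  then obtain A B where AB: "finite A" "depends_on f A" "finite B" "depends_on g B"
    and C: "\<And>\<eta>. \<eta> \<in> Sigma_inf \<Longrightarrow> C2_multi (\<lambda>\<theta>. f (with_angles \<eta> \<theta>))"
           "\<And>\<eta>. \<eta> \<in> Sigma_inf \<Longrightarrow> C2_multi (\<lambda>\<theta>. g (with_angles \<eta> \<theta>))"
    unfolding cylinder_def mem_Collect_eq by blast
  have "depends_on (f + g) (A \<union> B)"
    unfolding depends_on_def plus_fun_apply
    by (intro ballI impI arg_cong2[where f = "(+)"] depends_onD[OF AB(2)] depends_onD[OF AB(4)]) simp_all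
  then show "f + g \<in> {f. cylinder f}"
    using C2_multi_add[OF C] finite_UnI[OF AB(1,3)] unfolding cylinder_def mem_Collect_eq plus_fun_apply by blast
next
  fix c and f :: "config \<Rightarrow> real" assume "f \<in> {f. cylinder f}"
  then obtain A where AB: "finite A" "depends_on f A"
    and C: "\<And>\<eta>. \<eta> \<in> Sigma_inf \<Longrightarrow> C2_multi (\<lambda>\<theta>. f (with_angles \<eta> \<theta>))"
    unfolding cylinder_def mem_Collect_eq by blast
  have "depends_on (c *\<^sub>R f) A"
    unfolding depends_on_def scaleR_fun_def
    by (intro ballI impI arg_cong[where f = "\<lambda>r. c *\<^sub>R r"] depends_onD[OF AB(2)]) simp_all
  then show "c *\<^sub>R f \<in> {f. cylinder f}"
    using C2_multi_scale[OF C] AB(1) unfolding cylinder_def mem_Collect_eq scaleR_fun_def real_scaleR_def by blast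
qed

lemma T_omega_cylinder: "f \<in> T_omega \<omega> \<Longrightarrow> cylinder f"
proof -
  have "T_omega \<omega> \<subseteq> {f. cylinder f}"
    unfolding T_omega_def by (rule span_minimal[OF _ subspace_cylinder]) auto
  then show "f \<in> T_omega \<omega> \<Longrightarrow> cylinder f" by auto
qed

lemma subspace_T_omega: "subspace (T_omega \<omega>)"
  unfolding T_omega_def by (rule subspace_span)

text \<open>The occupation factors \<open>F x\<close> of a generator may depend on infinitely many sites; only their
  sum is local. Emptying the configuration outside of a finite set on which the sum depends makes
  each of them local.\<close>

lemma T_omega_eq_span_charge_terms:
  assumes w: "C2_circle \<omega>" shows "T_omega \<omega> = span (charge_terms \<omega>)"
proof
  show "T_omega \<omega> \<subseteq> span (charge_terms \<omega>)"
    unfolding T_omega_def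
  proof (rule span_minimal[OF _ subspace_span], clarify)
    fix f a b c d and F :: "site \<Rightarrow> (site \<Rightarrow> real) \<Rightarrow> real" and A
    assume cyl: "cylinder f" and A: "finite A"
      and f: "\<forall>\<eta>\<in>Sigma_inf. f \<eta> = (\<Sum>x\<in>A. (a * num_a \<eta> x + b * num_p \<eta> x
        + c * num_a_ang \<omega> \<eta> x + d * num_p_ang \<omega> \<eta> x) * F x (occ \<eta>))"
    define v where "v = (\<lambda>s::site_state. (a + c * \<omega> (snd s)) * real (fst (fst s))
        + (b + d * \<omega> (snd s)) * real (snd (fst s)))"
    have v: "v \<in> charges \<omega>" unfolding charges_def v_def by blast
    from cyl obtain A0 where A0: "finite A0" "depends_on f A0" unfolding cylinder_def by blast
    define B where "B = A0 \<union> A"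
    define G where "G x m = F x (\<lambda>y. if y \<in> B then m y else 0)" for x and m :: "site \<Rightarrow> real"
    have G: "occ_local (G x)" for x
      unfolding occ_local_def
    proof (intro exI[of _ B] conjI allI impI)
      show "finite B" using A A0 by (simp add: B_def)
      fix m m' :: "site \<Rightarrow> real" assume "\<forall>y\<in>B. m y = m' y"
      then have "(\<lambda>y. if y \<in> B then m y else 0) = (\<lambda>y. if y \<in> B then m' y else 0)" by auto
      then show "G x m = G x m'" by (simp add: G_def)
    qed
    define t where "t x \<eta> = v (\<eta> x) * G x (occ \<eta>)" for x \<eta>
    have t: "t x \<in> span (charge_terms \<omega>)" for x
      by (rule span_base, rule charge_termsI[where x = x and F = "G x", OF v G]) (simp add: t_def)
    have eq: "f \<eta> = (\<Sum>x\<in>A. t x \<eta>)" if \<eta>: "\<eta> \<in> Sigma_inf" for \<eta>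
    proof -
      have "f \<eta> = f (trunc B \<eta>)"
        using depends_on_trunc[OF A0(2) _ \<eta>, of B] by (simp add: B_def)
      also have "\<dots> = (\<Sum>x\<in>A. v (trunc B \<eta> x) * F x (occ (trunc B \<eta>)))"
        using \<eta> by (simp add: f v_def num_a_def num_p_def num_a_ang_def num_p_ang_def algebra_simps)
      also have "\<dots> = (\<Sum>x\<in>A. t x \<eta>)"
      proof (rule sum.cong[OF refl])
        have "(\<lambda>y. case if y \<in> B then Some y else None of None \<Rightarrow> 0 | Some z \<Rightarrow> occ \<eta> z)
          = (\<lambda>y. if y \<in> B then occ \<eta> y else 0)" by auto
        then show "v (trunc B \<eta> x) * F x (occ (trunc B \<eta>)) = t x \<eta>" if "x \<in> A" for x
          using that by (auto simp: t_def G_def trunc_apply occ_pull B_def pull_def)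
      qed
      finally show ?thesis .
    qed
    have "f - (\<Sum>x\<in>A. t x) \<in> charge_terms \<omega>"
      by (rule charge_terms_null) (simp add: eq fun_diff_def sum_fun_apply)
    then have "(f - (\<Sum>x\<in>A. t x)) + (\<Sum>x\<in>A. t x) \<in> span (charge_terms \<omega>)"
      by (intro span_add span_sum t span_base)
    then show "f \<in> span (charge_terms \<omega>)" by simp
  qed
next
  show "span (charge_terms \<omega>) \<subseteq> T_omega \<omega>"
    unfolding T_omega_def
  proof (rule span_mono, clarify)
    fix f assume f: "f \<in> charge_terms \<omega>"
    then obtain v x F where v: "v \<in> charges \<omega>" and F: "occ_local F"
      and f': "\<And>\<eta>. \<eta> \<in> Sigma_inf \<Longrightarrow> f \<eta> = v (\<eta> x) * F (occ \<eta>)"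
      unfolding charge_terms_def by blast
    from v obtain a b c d where v': "v = (\<lambda>s. (a + c * \<omega> (snd s)) * real (fst (fst s))
        + (b + d * \<omega> (snd s)) * real (snd (fst s)))" unfolding charges_def by blast
    show "cylinder f \<and> (\<exists>a b c d F A. finite A \<and>
     (\<forall>\<eta>\<in>Sigma_inf. f \<eta> = (\<Sum>x\<in>A.
        (a * num_a \<eta> x + b * num_p \<eta> x + c * num_a_ang \<omega> \<eta> x + d * num_p_ang \<omega> \<eta> x)
          * F x (occ \<eta>))))"
    proof (intro conjI cylinder_charge_term[OF w f])
      show "\<exists>a b c d F A. finite A \<and>
     (\<forall>\<eta>\<in>Sigma_inf. f \<eta> = (\<Sum>x\<in>A.
        (a * num_a \<eta> x + b * num_p \<eta> x + c * num_a_ang \<omega> \<eta> x + d * num_p_ang \<omega> \<eta> x)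
          * F x (occ \<eta>)))"
        by (rule exI[of _ a], rule exI[of _ b], rule exI[of _ c], rule exI[of _ d],
            rule exI[of _ "\<lambda>_. F"], rule exI[of _ "{x}"])
           (simp add: f' v' num_a_def num_p_def num_a_ang_def num_p_ang_def algebra_simps)
    qed
  qed
qed

lemma T_omega_charge_term:
  assumes "C2_circle \<omega>" "v \<in> charges \<omega>" "occ_local F"
  shows "(\<lambda>\<eta>. v (\<eta> x) * F (occ \<eta>)) \<in> T_omega \<omega>"
  unfolding T_omega_eq_span_charge_terms[OF assms(1)]
  by (rule span_base, rule charge_termsI[where x = x, OF assms(2,3)]) simp

lemma T_omega_cong:
  assumes w: "C2_circle \<omega>" and g: "g \<in> T_omega \<omega>" and "\<And>\<eta>. \<eta> \<in> Sigma_inf \<Longrightarrow> f \<eta> = g \<eta>"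
  shows "f \<in> T_omega \<omega>"
proof -
  have "f - g \<in> charge_terms \<omega>"
    by (rule charge_terms_null) (simp add: assms(3) fun_diff_def)
  then have "(f - g) + g \<in> T_omega \<omega>"
    by (intro subspace_add[OF subspace_T_omega] g)
       (simp add: T_omega_eq_span_charge_terms[OF w] span_base)
  then show ?thesis by simp
qed

lemma T_omega_induct [consumes 2, case_names add cong zero charge]:
  assumes w: "C2_circle \<omega>" and f: "f \<in> T_omega \<omega>"
    and add: "\<And>f g. P f \<Longrightarrow> P g \<Longrightarrow> P (\<lambda>\<eta>. f \<eta> + g \<eta>)"
    and cong: "\<And>f g. P g \<Longrightarrow> (\<And>\<eta>. \<eta> \<in> Sigma_inf \<Longrightarrow> f \<eta> = g \<eta>) \<Longrightarrow> P f"
    and zero: "P (\<lambda>\<eta>. 0)"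
    and t: "\<And>v x F. v \<in> charges \<omega> \<Longrightarrow> occ_local F \<Longrightarrow> P (\<lambda>\<eta>. v (\<eta> x) * F (occ \<eta>))"
  shows "P f"
  using f unfolding T_omega_eq_span_charge_terms[OF w]
proof (induction rule: span_induct_alt)
  case base
  then show ?case using zero by (simp add: zero_fun_def)
next
  case (step c f g)
  from step(1) obtain v x F where v: "v \<in> charges \<omega>" and F: "occ_local F"
    and f': "\<And>\<eta>. \<eta> \<in> Sigma_inf \<Longrightarrow> f \<eta> = v (\<eta> x) * F (occ \<eta>)"
    unfolding charge_terms_def by blast
  have "P (\<lambda>\<eta>. (c * v (\<eta> x)) * F (occ \<eta>))"
    by (rule t[OF charges_scale[OF v] F])
  from add[OF this step(2)] show ?case
    by (rule cong) (simp add: f' scaleR_fun_def)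
qed

lemma T_omega_add: "f \<in> T_omega \<omega> \<Longrightarrow> g \<in> T_omega \<omega> \<Longrightarrow> (\<lambda>\<eta>. f \<eta> + g \<eta>) \<in> T_omega \<omega>"
  using subspace_add[OF subspace_T_omega] by (auto simp: plus_fun_def)

lemma T_omega_0: "(\<lambda>\<eta>. 0) \<in> T_omega \<omega>"
  using subspace_0[OF subspace_T_omega] by (auto simp: zero_fun_def)

lemma T_omega_scale: "f \<in> T_omega \<omega> \<Longrightarrow> (\<lambda>\<eta>. c * f \<eta>) \<in> T_omega \<omega>"
  using subspace_scale[OF subspace_T_omega, of f \<omega> c] by (auto simp: scaleR_fun_def)

lemma T_omega_minus: "f \<in> T_omega \<omega> \<Longrightarrow> (\<lambda>\<eta>. - f \<eta>) \<in> T_omega \<omega>"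
  using T_omega_scale[of f \<omega> "-1"] by simp

lemma T_omega_diff: "f \<in> T_omega \<omega> \<Longrightarrow> g \<in> T_omega \<omega> \<Longrightarrow> (\<lambda>\<eta>. f \<eta> - g \<eta>) \<in> T_omega \<omega>"
  using T_omega_add[OF _ T_omega_minus, of f \<omega> g] by simp

lemma T_omega_sum:
  "finite I \<Longrightarrow> (\<And>i. i \<in> I \<Longrightarrow> f i \<in> T_omega \<omega>) \<Longrightarrow> (\<lambda>\<eta>. \<Sum>i\<in>I. f i \<eta>) \<in> T_omega \<omega>"
  by (induction I rule: finite_induct) (auto intro: T_omega_0 T_omega_add)

lemma T_omega_occ_mult:
  assumes w: "C2_circle \<omega>" and f: "f \<in> T_omega \<omega>" and G: "occ_local G"
  shows "(\<lambda>\<eta>. G (occ \<eta>) * f \<eta>) \<in> T_omega \<omega>"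
  using w f
proof (induction rule: T_omega_induct)
  case (add f g)
  from T_omega_add[OF this] show ?case by (simp add: algebra_simps)
next
  case (cong f g)
  from w cong(1) show ?case by (rule T_omega_cong) (simp add: cong(2))
next
  case zero then show ?case by (simp add: T_omega_0)
next
  case (charge v x F)
  from T_omega_charge_term[OF w charge(1) occ_local_comb[OF charge(2) G, of "(*)"], of x]
  show ?case by (simp add: algebra_simps)
qed

text \<open>A relabelling of the sites maps a charge at \<open>x\<close> to a charge at \<open>\<rho> x\<close>, and occupation numbers to
  occupation numbers. This gives at once the stability under translations, exchanges of two sites,
  truncations and the motion of a particle through a truncated configuration.\<close>

lemma T_omega_pull:
  assumes w: "C2_circle \<omega>" and f: "f \<in> T_omega \<omega>"
  shows "(\<lambda>\<eta>. f (pull \<rho> \<eta>)) \<in> T_omega \<omega>"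
  using w f
proof (induction rule: T_omega_induct)
  case (add f g)
  from T_omega_add[OF this] show ?case by simp
next
  case (cong f g)
  from w cong(1) show ?case by (rule T_omega_cong) (simp add: cong(2))
next
  case zero then show ?case by (simp add: T_omega_0)
next
  case (charge v x F)
  show ?case
  proof (cases "\<rho> x")
    case None
    then have "v (pull \<rho> \<eta> x) = 0" for \<eta> using charge by (simp add: pull_def)
    then show ?thesis by (simp add: T_omega_0)
  next
    case (Some z)
    from T_omega_charge_term[OF w charge(1) occ_local_pull[OF charge(2), of \<rho>], of z]
    show ?thesis by (simp add: pull_def[of \<rho> _ x] Some occ_pull)
  qed
qed

lemma translate_pull: "translate x f \<eta> = f (pull (\<lambda>y. Some (x + y)) \<eta>)"
  by (simp add: translate_def pull_def[abs_def])

lemma exch_pull: "exch x y \<eta> = pull (\<lambda>z. Some (if z = y then x else if z = x then y else z)) \<eta>"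
  by (auto simp: exch_def pull_def fun_eq_iff)

lemma T_omega_translate:
  assumes w: "C2_circle \<omega>" and f: "f \<in> T_omega \<omega>"
  shows "translate x f \<in> T_omega \<omega>"
  using T_omega_pull[OF assms, of "\<lambda>y. Some (x + y)"] by (simp add: translate_pull[abs_def])

lemma T_omega_exch:
  assumes w: "C2_circle \<omega>" and f: "f \<in> T_omega \<omega>"
  shows "(\<lambda>\<eta>. f (exch x y \<eta>)) \<in> T_omega \<omega>"
  using T_omega_pull[OF assms] by (simp add: exch_pull[abs_def])

text \<open>All configurations whose only particle sits at \<open>x\<close> have the same occupation numbers, so the
  occupation factors reduce to constants.\<close>

lemma T_omega_single_particle:
  assumes w: "C2_circle \<omega>" and f: "f \<in> T_omega \<omega>"
  shows "\<exists>v\<in>charges \<omega>. \<forall>s\<in>site_states. f ((\<lambda>_. empty_site)(x := s)) = v s"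
  using w f
proof (induction rule: T_omega_induct)
  case (add f g)
  then obtain v w where "v \<in> charges \<omega>" "w \<in> charges \<omega>"
    "\<forall>s\<in>site_states. f ((\<lambda>_. empty_site)(x := s)) = v s" "\<forall>s\<in>site_states. g ((\<lambda>_. empty_site)(x := s)) = w s"
    by blast
  then show ?case using charges_add[of v \<omega> w] by (intro bexI[of _ "\<lambda>s. v s + w s"]) metis+
next
  case (cong f g)
  have "(\<lambda>_::site. empty_site)(x := s) \<in> Sigma_inf" if "s \<in> site_states" for s
    using that by (intro Sigma_inf_upd Sigma_infI) simp_all
  with cong show ?case by metis
next
  case zero then show ?case using charges_0 by (intro bexI[of _ "\<lambda>s. 0"]) auto
next
  case (charge v y F)
  let ?m = "\<lambda>z. of_bool (z = x) :: real"
  have e: "(\<lambda>_::site. empty_site)(x := s) \<in> Sigma_inf" if "s \<in> site_states" for s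
    using that by (intro Sigma_inf_upd Sigma_infI) simp_all
  have o: "occ ((\<lambda>_. empty_site)(x := s)) = ?m" if "s \<in> site_states" "s \<noteq> empty_site" for s
    using occ_Sigma[OF e[OF that(1)]] that by (auto simp: fun_eq_iff)
  show ?case
  proof (cases "y = x")
    case True
    have "v (((\<lambda>_. empty_site)(x := s)) y) * F (occ ((\<lambda>_. empty_site)(x := s))) = F ?m * v s"
      if "s \<in> site_states" for s
    proof (cases "s = empty_site")
      case True
      then show ?thesis using charge by simp
    next
      case False
      then show ?thesis using o[OF that False] \<open>y = x\<close> by simp
    qed
    then show ?thesis using charges_scale[OF charge(1), of "F ?m"] by metis
  next
    case False
    then show ?thesis using charges_0 charge by (intro bexI[of _ "\<lambda>s. 0"]) auto
  qed
qed

section \<open>Paths and closed germs\<close>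

lemma exch_alt: "exch x y \<eta> z = (if z = y then \<eta> x else if z = x then \<eta> y else \<eta> z)"
  by (simp add: exch_def)

lemma exch_exch [simp]: "exch x y (exch x y \<eta>) = \<eta>" "exch y x (exch x y \<eta>) = \<eta>"
  by (auto simp: exch_def fun_eq_iff)

lemma exch_commute: "exch x y \<eta> = exch y x \<eta>"
  by (auto simp: exch_def fun_eq_iff)

lemma exch_empty: "\<eta> x = empty_site \<Longrightarrow> \<eta> y = empty_site \<Longrightarrow> exch x y \<eta> = \<eta>"
  by (auto simp: exch_def fun_eq_iff)

lemma occ_exch: "occ (exch x y \<eta>) z = (if z = y then occ \<eta> x else if z = x then occ \<eta> y else occ \<eta> z)"
  by (simp add: exch_def occ_alt)

lemma evec_simps [simp]: "evec 1 = (1, 0)" "evec (Suc 0) = (1, 0)" "evec 2 = (0, 1)"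
  by (simp_all add: evec_def)

lemma evec_nonzero [simp]: "evec i \<noteq> 0"
  by (simp add: evec_def prod_eq_iff)

lemma unit_step_cases:
  assumes "unit_step z"
  obtains "z = evec 1" | "z = evec 2" | "z = - evec 1" | "z = - evec 2"
proof -
  obtain a b where z: "z = (a, b)" by (cases z)
  with assms have "\<bar>a\<bar> + \<bar>b\<bar> = 1" by (simp add: unit_step_def)
  then have "(a, b) = (1, 0) \<or> (a, b) = (0, 1) \<or> (a, b) = (-1, 0) \<or> (a, b) = (0, -1)"
    by (auto simp: abs_if split: if_splits)
  then show ?thesis using that unfolding z by (auto simp: evec_def)
qed

lemma unit_step_evec [simp]: "unit_step (evec i)" "unit_step (- evec i)"
  by (simp_all add: unit_step_def evec_def)

lemma unit_step_uminus [simp]: "unit_step (- z) = unit_step z"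
  by (simp add: unit_step_def)

definition component :: "nat \<Rightarrow> germ \<Rightarrow> config \<Rightarrow> real" where
  "component i u = (if i = 1 then fst u else snd u)"

lemma form_of_germ_pos: "form_of_germ u x (x + evec i) \<eta> = translate x (component i u) \<eta>"
  by (cases x) (simp add: form_of_germ_def evec_def component_def)

lemma form_of_germ_neg:
  "form_of_germ u x (x - evec i) \<eta> = - translate (x - evec i) (component i u) (exch x (x - evec i) \<eta>)"
  by (cases x) (auto simp: form_of_germ_def evec_def component_def)

lemma form_of_germ_reverse:
  assumes "unit_step z"
  shows "form_of_germ u (x + z) x (exch x (x + z) \<eta>) = - form_of_germ u x (x + z) \<eta>"
proof -
  have p: ?thesis if "z = evec i" for i
    using form_of_germ_neg[of u "x + evec i" i "exch x (x + evec i) \<eta>"]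
      form_of_germ_pos[of u x i \<eta>] that by (simp add: exch_commute[of "x + evec i"])
  have n: ?thesis if "z = - evec i" for i
    using form_of_germ_neg[of u x i \<eta>]
      form_of_germ_pos[of u "x - evec i" i "exch x (x - evec i) \<eta>"] that by simp
  from assms show ?thesis using p[of 1] p[of 2] n[of 1] n[of 2] by (cases rule: unit_step_cases) blast+
qed

lemma licit_append: "licit \<eta> (p @ q) \<longleftrightarrow> licit \<eta> p \<and> licit (path_end \<eta> p) q"
  by (induction \<eta> p rule: licit.induct) auto

lemma path_end_append: "path_end \<eta> (p @ q) = path_end (path_end \<eta> p) q"
  by (induction \<eta> p rule: path_end.induct) auto

lemma path_integral_append:
  "path_integral u \<eta> (p @ q) = path_integral u \<eta> p + path_integral u (path_end \<eta> p) q"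
  by (induction u \<eta> p rule: path_integral.induct) auto

lemma Sigma_inf_path_end [simp]: "\<eta> \<in> Sigma_inf \<Longrightarrow> path_end \<eta> p \<in> Sigma_inf"
  by (induction \<eta> p rule: path_end.induct) auto

definition rev_path :: "jump_path \<Rightarrow> jump_path" where
  "rev_path p = map (\<lambda>(x, z). (x + z, - z)) (rev p)"

lemma rev_path:
  assumes "licit \<eta> p"
  shows "licit (path_end \<eta> p) (rev_path p)" "path_end (path_end \<eta> p) (rev_path p) = \<eta>"
    "path_integral (form_of_germ u) (path_end \<eta> p) (rev_path p)
       = - path_integral (form_of_germ u) \<eta> p"
proof -
  have "licit (path_end \<eta> p) (rev_path p) \<and> path_end (path_end \<eta> p) (rev_path p) = \<eta> \<and>
    path_integral (form_of_germ u) (path_end \<eta> p) (rev_path p)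
       = - path_integral (form_of_germ u) \<eta> p"
    using assms
  proof (induction \<eta> p rule: licit.induct)
    case (2 \<eta> x z p)
    let ?\<xi> = "exch x (x + z) \<eta>"
    from 2 have z: "unit_step z" "occ \<eta> x = 1" "occ \<eta> (x + z) = 0" and l: "licit ?\<xi> p" by auto
    have r: "rev_path ((x, z) # p) = rev_path p @ [(x + z, - z)]" by (simp add: rev_path_def)
    have zx: "x + z \<noteq> x" using z by auto
    show ?case unfolding r
      using 2(1)[OF l] z zx form_of_germ_reverse[OF z(1), of u x \<eta>]
      by (simp add: licit_append path_end_append path_integral_append occ_exch)
  qed (simp add: rev_path_def)
  then show "licit (path_end \<eta> p) (rev_path p)" "path_end (path_end \<eta> p) (rev_path p) = \<eta>"
    "path_integral (form_of_germ u) (path_end \<eta> p) (rev_path p)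
       = - path_integral (form_of_germ u) \<eta> p" by auto
qed

text \<open>Follow one path and return along the other.\<close>

lemma closed_germ_path_independent:
  assumes u: "closed_germ \<alpha> u" and \<eta>: "\<eta> \<in> Sigma_inf"
    and p: "licit \<eta> p" and q: "licit \<eta> q" and e: "path_end \<eta> p = path_end \<eta> q"
  shows "path_integral (form_of_germ u) \<eta> p = path_integral (form_of_germ u) \<eta> q"
proof -
  have "licit \<eta> (p @ rev_path q)" "path_end \<eta> (p @ rev_path q) = \<eta>"
    using p rev_path(1,2)[OF q] e by (simp_all add: licit_append path_end_append)
  then have "path_integral (form_of_germ u) \<eta> (p @ rev_path q) = 0"
    using u \<eta> unfolding closed_germ_def closed_form_def by blast
  then show ?thesis
    using rev_path(3)[OF q, of u] e by (simp add: path_integral_append)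
qed

lemma closed_germ_support:
  assumes u: "closed_germ \<alpha> u" and \<eta>: "\<eta> \<in> Sigma_inf"
  shows "translate x (component i u) \<eta> = occ \<eta> x * (1 - occ \<eta> (x + evec i)) * translate x (component i u) \<eta>"
proof -
  have "form_of_germ u x (x + evec i) \<eta>
      = occ \<eta> x * (1 - occ \<eta> (x + evec i)) * form_of_germ u x (x + evec i) \<eta>"
    using u \<eta> unfolding closed_germ_def closed_form_def differential_form_def
    by (meson unit_step_evec(1))
  then show ?thesis unfolding form_of_germ_pos .
qed

text \<open>Jumps of a possibly absent particle into an empty site. Along such a path a form still
  integrates the increments of a potential, since it vanishes on the jumps of absent particles; this
  allows paths chosen independently of the configuration.\<close>

fun hole_path :: "config \<Rightarrow> jump_path \<Rightarrow> bool" where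
  "hole_path \<eta> [] = True"
| "hole_path \<eta> ((x, z) # p) \<longleftrightarrow>
     unit_step z \<and> occ \<eta> (x + z) = 0 \<and> hole_path (exch x (x + z) \<eta>) p"

lemma licit_hole_path: "licit \<eta> p \<Longrightarrow> hole_path \<eta> p"
  by (induction \<eta> p rule: licit.induct) auto

definition local_potential :: "germ \<Rightarrow> site set \<Rightarrow> (config \<Rightarrow> real) \<Rightarrow> bool" where
  "local_potential u W S \<longleftrightarrow> (\<forall>\<eta>\<in>Sigma_inf. \<forall>x i. i \<in> {1, 2} \<and> x \<in> W \<and> x + evec i \<in> W \<longrightarrow>
     translate x (component i u) \<eta> = occ \<eta> x * (1 - occ \<eta> (x + evec i)) * (S (exch x (x + evec i) \<eta>) - S \<eta>))"

lemma local_potential_form: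
  assumes S: "local_potential u W S" and \<eta>: "\<eta> \<in> Sigma_inf" and z: "unit_step z"
    and W: "x \<in> W" "x + z \<in> W"
  shows "form_of_germ u x (x + z) \<eta> = occ \<eta> x * (1 - occ \<eta> (x + z)) * (S (exch x (x + z) \<eta>) - S \<eta>)"
proof -
  have p: "translate x (component i u) \<eta> = occ \<eta> x * (1 - occ \<eta> (x + evec i)) * (S (exch x (x + evec i) \<eta>) - S \<eta>)"
    if "i \<in> {1, 2}" "x \<in> W" "x + evec i \<in> W" "\<eta> \<in> Sigma_inf" for i x \<eta>
    using S[unfolded local_potential_def, rule_format, of \<eta> i x] that by simp
  have 1: ?thesis if "i \<in> {1, 2}" "z = evec i" for i
    using p[of i x \<eta>] that \<eta> W by (simp add: form_of_germ_pos)
  have 2: ?thesis if "i \<in> {1, 2}" "z = - evec i" for i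
  proof -
    have ne: "x - evec i \<noteq> x" by simp
    have "form_of_germ u x (x - evec i) \<eta> = - (occ \<eta> x * (1 - occ \<eta> (x - evec i))
        * (S \<eta> - S (exch x (x - evec i) \<eta>)))"
      using p[of i "x - evec i" "exch x (x - evec i) \<eta>"] that \<eta> W ne
      by (simp add: form_of_germ_neg occ_exch)
    then show ?thesis using that by (simp add: algebra_simps)
  qed
  from z show ?thesis
    by (cases rule: unit_step_cases) (use 1[of 1] 1[of 2] 2[of 1] 2[of 2] in blast)+
qed

definition path_sites :: "jump_path \<Rightarrow> site set" where
  "path_sites p = (\<Union>(x, z)\<in>set p. {x, x + z})"

lemma finite_path_sites [simp]: "finite (path_sites p)"
  by (auto simp: path_sites_def)

lemma local_potential_path_integral:
  assumes S: "local_potential u W S"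
  shows "\<eta> \<in> Sigma_inf \<Longrightarrow> hole_path \<eta> p \<Longrightarrow> path_sites p \<subseteq> W \<Longrightarrow>
    path_integral (form_of_germ u) \<eta> p = S (path_end \<eta> p) - S \<eta>"
proof (induction \<eta> p rule: hole_path.induct)
  case (2 \<eta> x z p)
  let ?\<xi> = "exch x (x + z) \<eta>"
  have z: "unit_step z" "occ \<eta> (x + z) = 0" and l: "hole_path ?\<xi> p" using 2(3) by auto
  have W: "x \<in> W" "x + z \<in> W" "path_sites p \<subseteq> W" using 2(4) by (auto simp: path_sites_def)
  have "form_of_germ u x (x + z) \<eta> = S ?\<xi> - S \<eta>"
  proof (cases "\<eta> x = empty_site")
    case True
    then have "?\<xi> = \<eta>" using z 2(2) by (intro exch_empty) (simp_all add: occ_eq_0_iff)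
    then show ?thesis using local_potential_form[OF S 2(2) z(1) W(1,2)] by simp
  next
    case False
    then show ?thesis using local_potential_form[OF S 2(2) z(1) W(1,2)] z 2(2) occ_eq_1_iff[of \<eta> x]
      by simp
  qed
  moreover have "path_integral (form_of_germ u) ?\<xi> p = S (path_end ?\<xi> p) - S ?\<xi>"
    by (rule 2(1)) (use 2(2) l W in auto)
  ultimately show ?case by simp
qed simp

text \<open>The potentials of interest, such as \<open>\<Sum>\<^sub>x \<tau>\<^sub>x h\<close>, are infinite sums. Since a path visits finitely
  many sites, it is enough to have a potential on each finite set of sites.\<close>

lemma closed_form_if_local_potentials:
  assumes d: "differential_form \<alpha> (form_of_germ u)"
    and S: "\<And>W. finite W \<Longrightarrow> \<exists>S. local_potential u W S"
  shows "closed_form \<alpha> (form_of_germ u)"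
  unfolding closed_form_def
proof (intro conjI d ballI allI impI, elim conjE)
  fix \<eta> p assume \<eta>: "\<eta> \<in> Sigma_inf" and p: "licit \<eta> p" "path_end \<eta> p = \<eta>"
  from S[of "path_sites p"] obtain S where "local_potential u (path_sites p) S" by auto
  from local_potential_path_integral[OF this \<eta> licit_hole_path[OF p(1)]] p(2)
  show "path_integral (form_of_germ u) \<eta> p = 0" by simp
qed

section \<open>Gradients of translation sums\<close>

definition trans_sum :: "site set \<Rightarrow> (config \<Rightarrow> real) \<Rightarrow> config \<Rightarrow> real" where
  "trans_sum X h \<eta> = (\<Sum>x\<in>X. translate x h \<eta>)"

text \<open>The translations \<open>y\<close> for which \<open>y + A\<close> meets \<open>W\<close>: the only ones for which a function of the sites
  in \<open>A\<close> notices, after translation by \<open>y\<close>, a change of the configuration inside \<open>W\<close>.\<close>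

definition meeting :: "site set \<Rightarrow> site set \<Rightarrow> site set" where
  "meeting A W = (\<lambda>(w, a). w - a) ` (W \<times> A)"

lemma finite_meeting [simp]: "finite A \<Longrightarrow> finite W \<Longrightarrow> finite (meeting A W)"
  by (simp add: meeting_def)

lemma meeting_iff: "y \<in> meeting A W \<longleftrightarrow> (\<exists>a\<in>A. y + a \<in> W)"
  by (force simp: meeting_def)

lemma meeting_mono: "W \<subseteq> W' \<Longrightarrow> meeting A W \<subseteq> meeting A W'"
  unfolding meeting_iff subset_iff by blast

lemma translate_eq_if_not_meeting:
  assumes h: "depends_on h A" and s: "\<eta> \<in> Sigma_inf" "\<xi> \<in> Sigma_inf"
    and "\<And>y. y \<notin> W \<Longrightarrow> \<eta> y = \<xi> y" "w \<notin> meeting A W"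
  shows "translate w h \<eta> = translate w h \<xi>"
  unfolding translate_def
proof (rule depends_onD[OF h Sigma_inf_comp[OF s(1)] Sigma_inf_comp[OF s(2)]])
  show "\<eta> (w + a) = \<xi> (w + a)" if "a \<in> A" for a
    using assms(4,5) that unfolding meeting_iff by blast
qed

lemma trans_sum_diff_eq:
  assumes h: "depends_on h A" and A: "finite A" and s: "\<eta> \<in> Sigma_inf" "\<xi> \<in> Sigma_inf"
    and eq: "\<And>y. y \<notin> W \<Longrightarrow> \<eta> y = \<xi> y" and W: "finite W"
    and X: "finite X" "meeting A W \<subseteq> X"
  shows "trans_sum X h \<xi> - trans_sum X h \<eta> = trans_sum (meeting A W) h \<xi> - trans_sum (meeting A W) h \<eta>"
proof -
  have "(\<Sum>x\<in>X. translate x h \<xi> - translate x h \<eta>)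
      = (\<Sum>x\<in>meeting A W. translate x h \<xi> - translate x h \<eta>)"
    by (rule sum.mono_neutral_right)
       (use X translate_eq_if_not_meeting[OF h s eq] in auto)
  then show ?thesis by (simp add: trans_sum_def sum_subtractf)
qed

text \<open>Every sufficiently large finite sum of translates has the same gradient as the formal sum over
  all translates.\<close>

lemma translate_nabla_Sigma_comp:
  assumes h: "depends_on h A" and A: "finite A" and \<eta>: "\<eta> \<in> Sigma_inf"
    and X: "finite X" "meeting A {x, x + evec i} \<subseteq> X"
  shows "translate x (nabla_Sigma_comp i h) \<eta>
    = occ \<eta> x * (1 - occ \<eta> (x + evec i)) * (trans_sum X h (exch x (x + evec i) \<eta>) - trans_sum X h \<eta>)"
proof -
  define \<xi> where "\<xi> = (\<lambda>y. \<eta> (x + y))"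
  have \<xi>: "\<xi> \<in> Sigma_inf" unfolding \<xi>_def using \<eta> by (rule Sigma_inf_comp)
  have ex: "exch 0 (evec i) \<xi> = (\<lambda>y. exch x (x + evec i) \<eta> (x + y))"
    by (auto simp: \<xi>_def exch_def fun_eq_iff)
  have t: "translate y h \<xi> = translate (x + y) h \<eta>"
    "translate y h (exch 0 (evec i) \<xi>) = translate (x + y) h (exch x (x + evec i) \<eta>)" for y
    unfolding ex unfolding \<xi>_def by (simp_all add: translate_def add.assoc)
  have occ\<xi>: "occ \<xi> y = occ \<eta> (x + y)" for y by (simp add: \<xi>_def occ_alt)
  let ?M = "meeting A {0, evec i}"
  have "nabla_Sigma_comp i h \<xi> = (\<Sum>y\<in>?M. nabla 0 (evec i) (translate y h) \<xi>)"
    unfolding nabla_Sigma_comp_def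
  proof (subst infsum_finite[symmetric])
    show "finite ?M" using A by simp
    show "(\<Sum>\<^sub>\<infinity>y. nabla 0 (evec i) (translate y h) \<xi>) = (\<Sum>\<^sub>\<infinity>y\<in>?M. nabla 0 (evec i) (translate y h) \<xi>)"
    proof (rule infsum_cong_neutral)
      fix y assume "y \<in> UNIV - ?M"
      then have "translate y h \<xi> = translate y h (exch 0 (evec i) \<xi>)"
        by (intro translate_eq_if_not_meeting[OF h \<xi>, where W = "{0, evec i}"]) (auto simp: exch_alt \<xi>)
      then show "nabla 0 (evec i) (translate y h) \<xi> = 0" by (simp add: nabla_def)
    qed auto
  qed
  also have "\<dots> = occ \<eta> x * (1 - occ \<eta> (x + evec i)) * (\<Sum>y\<in>?M. translate (x + y) h (exch x (x + evec i) \<eta>) - translate (x + y) h \<eta>)"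
    by (simp add: nabla_def t occ\<xi> sum_distrib_left)
  also have "(\<Sum>y\<in>?M. translate (x + y) h (exch x (x + evec i) \<eta>) - translate (x + y) h \<eta>)
     = (\<Sum>y\<in>meeting A {x, x + evec i}. translate y h (exch x (x + evec i) \<eta>) - translate y h \<eta>)"
  proof (rule sum.reindex_bij_witness[of _ "\<lambda>y. y - x" "\<lambda>y. x + y"])
    show "y - x \<in> ?M" if y: "y \<in> meeting A {x, x + evec i}" for y
    proof -
      from y obtain a where "a \<in> A" "y + a \<in> {x, x + evec i}" unfolding meeting_iff by blast
      then show ?thesis unfolding meeting_iff by (intro bexI[of _ a]) (auto simp: algebra_simps)
    qed
    show "x + y \<in> meeting A {x, x + evec i}" if y: "y \<in> ?M" for y
    proof -
      from y obtain a where "a \<in> A" "y + a \<in> {0, evec i}" unfolding meeting_iff by blast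
      then show ?thesis unfolding meeting_iff by (intro bexI[of _ a]) (auto simp: algebra_simps)
    qed
  qed auto
  also have "\<dots> = trans_sum X h (exch x (x + evec i) \<eta>) - trans_sum X h \<eta>"
    by (subst trans_sum_diff_eq[OF h A \<eta> Sigma_inf_exch[OF \<eta>] _ _ X])
       (auto simp: exch_def trans_sum_def sum_subtractf)
  finally show ?thesis by (simp add: translate_def \<xi>_def)
qed

lemma component_nabla_Sigma: "i \<in> {1, 2} \<Longrightarrow> component i (nabla_Sigma h) = nabla_Sigma_comp i h"
  by (auto simp: component_def nabla_Sigma_def)

lemma nabla_Sigma_local_potential:
  assumes h: "depends_on h A" and A: "finite A" and X: "finite X" "meeting A W \<subseteq> X"
  shows "local_potential (nabla_Sigma h) W (trans_sum X h)"
  unfolding local_potential_def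
proof (intro ballI allI impI)
  fix \<eta> x and i :: nat assume \<eta>: "\<eta> \<in> Sigma_inf" and i: "i \<in> {1, 2} \<and> x \<in> W \<and> x + evec i \<in> W"
  then have m: "meeting A {x, x + evec i} \<subseteq> X" using X(2) meeting_mono[of "{x, x + evec i}" W A] by auto
  from i have "component i (nabla_Sigma h) = nabla_Sigma_comp i h" by (intro component_nabla_Sigma) auto
  with translate_nabla_Sigma_comp[OF h A \<eta> X(1) m]
  show "translate x (component i (nabla_Sigma h)) \<eta> = occ \<eta> x * (1 - occ \<eta> (x + evec i))
      * (trans_sum X h (exch x (x + evec i) \<eta>) - trans_sum X h \<eta>)" by simp
qed

lemma nabla_Sigma_comp_T_omega:
  assumes w: "C2_circle \<omega>" and h: "h \<in> T_omega \<omega>"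
  shows "nabla_Sigma_comp i h \<in> T_omega \<omega>"
proof -
  from T_omega_cylinder[OF h] obtain A where A: "finite A" "depends_on h A"
    unfolding cylinder_def by blast
  let ?X = "meeting A {0, 0 + evec i}"
  let ?G = "\<lambda>m::site \<Rightarrow> real. m 0 * (1 - m (evec i))"
  have G: "occ_local ?G"
    by (rule occ_local_comb[of "\<lambda>m. m 0" "\<lambda>m. m (evec i)" "\<lambda>a b. a * (1 - b)"])
       (rule occ_local_site[of "\<lambda>r. r"])+
  have "(\<lambda>\<eta>. trans_sum ?X h (exch 0 (evec i) \<eta>) - trans_sum ?X h \<eta>) \<in> T_omega \<omega>"
    unfolding trans_sum_def using A(1)
    by (intro T_omega_diff T_omega_sum T_omega_translate[OF w h]
        T_omega_exch[OF w T_omega_translate[OF w h]]) simp_all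
  from T_omega_occ_mult[OF w this G] show ?thesis
  proof (rule T_omega_cong[OF w])
    show "nabla_Sigma_comp i h \<eta> = occ \<eta> 0 * (1 - occ \<eta> (evec i))
       * (trans_sum ?X h (exch 0 (evec i) \<eta>) - trans_sum ?X h \<eta>)" if "\<eta> \<in> Sigma_inf" for \<eta>
      using translate_nabla_Sigma_comp[OF A(2,1) that, of ?X 0 i] A(1) by (simp add: translate_def)
  qed
qed

section \<open>Germs of currents\<close>

definition charge_current :: "(site_state \<Rightarrow> real) \<Rightarrow> (site_state \<Rightarrow> real) \<Rightarrow> germ" where
  "charge_current v w = ((\<lambda>\<eta>. v (\<eta> 0) * (1 - occ \<eta> (evec 1))), (\<lambda>\<eta>. w (\<eta> 0) * (1 - occ \<eta> (evec 2))))"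

lemma component_charge_current:
  "i \<in> {1, 2} \<Longrightarrow> component i (charge_current v w) \<eta> = (if i = 1 then v else w) (\<eta> 0) * (1 - occ \<eta> (evec i))"
  by (auto simp: component_def charge_current_def)

text \<open>The eight generators of the currents span one charge for each direction.\<close>

lemma germs_J_eq: "germs_J \<omega> = {charge_current v w |v w. v \<in> charges \<omega> \<and> w \<in> charges \<omega>}" (is "_ = ?R")
proof
  let ?G = "\<Union>i\<in>{1, 2}. {current_germ num_a i, current_germ num_p i,
     current_germ (num_a_ang \<omega>) i, current_germ (num_p_ang \<omega>) i}"
  have sub: "subspace ?R"
  proof (rule subspaceI)
    have "0 = charge_current (\<lambda>s. 0) (\<lambda>s. 0)"
      by (simp add: charge_current_def prod_eq_iff zero_fun_def)
    then show "0 \<in> ?R" using charges_0 by blast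
  next
    fix x y assume "x \<in> ?R" "y \<in> ?R"
    then obtain v w v' w' where x: "x = charge_current v w" "v \<in> charges \<omega>" "w \<in> charges \<omega>"
      and y: "y = charge_current v' w'" "v' \<in> charges \<omega>" "w' \<in> charges \<omega>" by blast
    have "x + y = charge_current (\<lambda>s. v s + v' s) (\<lambda>s. w s + w' s)"
      by (simp add: x y charge_current_def plus_fun_def algebra_simps)
    then show "x + y \<in> ?R" using charges_add x y by blast
  next
    fix c x assume "x \<in> ?R"
    then obtain v w where x: "x = charge_current v w" "v \<in> charges \<omega>" "w \<in> charges \<omega>" by blast
    have "c *\<^sub>R x = charge_current (\<lambda>s. c * v s) (\<lambda>s. c * w s)"
      by (simp add: x charge_current_def scaleR_fun_def algebra_simps)
    then show "c *\<^sub>R x \<in> ?R" using charges_scale x by blast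
  qed
  have c: "(\<lambda>s. (a + c * \<omega> (snd s)) * real (fst (fst s))
      + (b + d * \<omega> (snd s)) * real (snd (fst s))) \<in> charges \<omega>" for a b c d
    unfolding charges_def by blast
  have ch: "(\<lambda>s. real (fst (fst s))) \<in> charges \<omega>" "(\<lambda>s. real (snd (fst s))) \<in> charges \<omega>"
    "(\<lambda>s. \<omega> (snd s) * real (fst (fst s))) \<in> charges \<omega>" "(\<lambda>s. \<omega> (snd s) * real (snd (fst s))) \<in> charges \<omega>"
    using c[of 1 0 0 0] c[of 0 0 1 0] c[of 0 1 0 0] c[of 0 0 0 1] by simp_all
  have cg: "current_germ n 1 = charge_current v (\<lambda>s. 0)" "current_germ n 2 = charge_current (\<lambda>s. 0) v"
    if "\<And>\<eta> x. n \<eta> x = v (\<eta> x)" for n v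
    using that by (simp_all add: current_germ_def current_comp_def charge_current_def fun_eq_iff)
  have "?G \<subseteq> ?R"
  proof
    fix g assume "g \<in> ?G"
    then have "\<exists>n\<in>{num_a, num_p, num_a_ang \<omega>, num_p_ang \<omega>}. g = current_germ n 1 \<or> g = current_germ n 2"
      by auto
    then obtain n where n: "n \<in> {num_a, num_p, num_a_ang \<omega>, num_p_ang \<omega>}"
      "g = current_germ n 1 \<or> g = current_germ n 2" by blast
    have "\<exists>v\<in>charges \<omega>. \<forall>\<eta> x. n \<eta> x = v (\<eta> x)"
      using n(1) ch by (auto simp: num_a_def num_p_def num_a_ang_def num_p_ang_def)
    then obtain v where "v \<in> charges \<omega>" "\<And>\<eta> x. n \<eta> x = v (\<eta> x)" by blast
    then show "g \<in> ?R" using n(2) cg[of n v] charges_0 by blast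
  qed
  then show "germs_J \<omega> \<subseteq> ?R" unfolding germs_J_def by (rule span_minimal[OF _ sub])
  show "?R \<subseteq> germs_J \<omega>"
  proof (rule subsetI)
    fix x assume "x \<in> ?R"
    then obtain v w where x: "x = charge_current v w" and "v \<in> charges \<omega>" "w \<in> charges \<omega>" by blast
    then obtain a b c d a' b' c' d' where
      v: "v = (\<lambda>s. (a + c * \<omega> (snd s)) * real (fst (fst s)) + (b + d * \<omega> (snd s)) * real (snd (fst s)))" and
      w: "w = (\<lambda>s. (a' + c' * \<omega> (snd s)) * real (fst (fst s)) + (b' + d' * \<omega> (snd s)) * real (snd (fst s)))"
      unfolding charges_def by blast
    have eq: "charge_current v w = (a *\<^sub>R current_germ num_a 1 + b *\<^sub>R current_germ num_p 1
      + c *\<^sub>R current_germ (num_a_ang \<omega>) 1 + d *\<^sub>R current_germ (num_p_ang \<omega>) 1)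
      + (a' *\<^sub>R current_germ num_a 2 + b' *\<^sub>R current_germ num_p 2
      + c' *\<^sub>R current_germ (num_a_ang \<omega>) 2 + d' *\<^sub>R current_germ (num_p_ang \<omega>) 2)"
      by (simp add: v w charge_current_def current_germ_def current_comp_def scaleR_fun_def plus_fun_def
          num_a_def num_p_def num_a_ang_def num_p_ang_def fun_eq_iff algebra_simps)
    show "x \<in> germs_J \<omega>"
      unfolding x eq germs_J_def by (intro span_add span_scale; rule span_base; simp)
  qed
qed

text \<open>A current is the gradient of the first moment \<open>\<Sum>\<^sub>y y\<^sub>i v(\<eta>\<^sub>y)\<close> of the charge, which only makes sense
  on finite sets of sites.\<close>

lemma charge_current_local_potential:
  assumes v: "v \<in> charges \<omega>" "w \<in> charges \<omega>" and W: "finite W"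
  shows "local_potential (charge_current v w) W
    (\<lambda>\<eta>. \<Sum>y\<in>W. real_of_int (fst y) * v (\<eta> y) + real_of_int (snd y) * w (\<eta> y))"
    (is "local_potential _ _ ?S")
  unfolding local_potential_def
proof (intro ballI allI impI, elim conjE)
  fix \<eta> x and i :: nat assume \<eta>: "\<eta> \<in> Sigma_inf" and i: "i \<in> {1, 2}" and W': "x \<in> W" "x + evec i \<in> W"
  let ?y = "x + evec i"
  let ?t = "\<lambda>\<eta> y. real_of_int (fst y) * v (\<eta> y) + real_of_int (snd y) * w (\<eta> y)"
  have ne: "x \<noteq> ?y" by simp
  have split: "?S \<zeta> = ?t \<zeta> x + ?t \<zeta> ?y + (\<Sum>y\<in>W - {x, ?y}. ?t \<zeta> y)" for \<zeta>
  proof -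
    have "?S \<zeta> = (\<Sum>y\<in>{x, ?y}. ?t \<zeta> y) + (\<Sum>y\<in>W - {x, ?y}. ?t \<zeta> y)"
      by (subst sum.union_disjoint[symmetric]) (use W W' in \<open>auto intro!: sum.cong\<close>)
    then show ?thesis using ne by simp
  qed
  have "(\<Sum>y\<in>W - {x, ?y}. ?t (exch x ?y \<eta>) y) = (\<Sum>y\<in>W - {x, ?y}. ?t \<eta> y)"
    by (rule sum.cong) (auto simp: exch_def)
  then have d: "?S (exch x ?y \<eta>) - ?S \<eta>
     = (?t (exch x ?y \<eta>) x + ?t (exch x ?y \<eta>) ?y) - (?t \<eta> x + ?t \<eta> ?y)"
    unfolding split by simp
  have tr: "translate x (component i (charge_current v w)) \<eta> = (if i = 1 then v else w) (\<eta> x) * (1 - occ \<eta> ?y)"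
    unfolding translate_def component_charge_current[OF i] by (simp add: occ_alt)
  show "translate x (component i (charge_current v w)) \<eta>
      = occ \<eta> x * (1 - occ \<eta> ?y) * (?S (exch x ?y \<eta>) - ?S \<eta>)"
  proof (cases "\<eta> ?y = empty_site \<and> \<eta> x \<noteq> empty_site")
    case True
    then have o: "occ \<eta> x = 1" "occ \<eta> ?y = 0" using \<eta> by (simp_all add: occ_Sigma)
    have "?S (exch x ?y \<eta>) - ?S \<eta> = (if i = 1 then v else w) (\<eta> x)"
      unfolding d using True ne v i by (auto simp: exch_alt evec_def algebra_simps)
    then show ?thesis unfolding tr o by simp
  next
    case False
    then consider "\<eta> x = empty_site" | "\<eta> ?y \<noteq> empty_site" by blast
    then show ?thesis
    proof cases
      case 1
      then show ?thesis unfolding tr using v \<eta> by (simp add: occ_Sigma)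
    next
      case 2
      then show ?thesis unfolding tr using \<eta> by (simp add: occ_Sigma)
    qed
  qed
qed

lemma component_minus: "component i (u - v) = (\<lambda>\<eta>. component i u \<eta> - component i v \<eta>)"
  by (simp add: component_def fun_diff_def)

lemma form_of_germ_plus: "form_of_germ (u + v) x y \<eta> = form_of_germ u x y \<eta> + form_of_germ v x y \<eta>"
  by (simp add: form_of_germ_def translate_def)

lemma path_integral_plus:
  "path_integral (form_of_germ (u + v)) \<eta> p
     = path_integral (form_of_germ u) \<eta> p + path_integral (form_of_germ v) \<eta> p"
  by (induction \<eta> p rule: path_end.induct) (simp_all add: form_of_germ_plus)

section \<open>Integrating a closed germ\<close>

abbreviation particles :: "config \<Rightarrow> site set" where
  "particles \<eta> \<equiv> {x. \<eta> x \<noteq> empty_site}"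

definition ray :: "nat \<Rightarrow> site \<Rightarrow> nat \<Rightarrow> site" where
  "ray i x k = x + (if i = 1 then (int k, 0) else (0, int k))"

lemma ray_0 [simp]: "ray i x 0 = x"
  by (simp add: ray_def prod_eq_iff)

lemma ray_Suc: "ray i x (Suc k) = ray i x k + evec i"
  by (cases x) (simp add: ray_def evec_def)

lemma ray_evec: "ray i (x + evec j) k = ray i x k + evec j"
  by (cases x) (simp add: ray_def evec_def)

lemma ray_coord [simp]:
  "fst (ray 2 x k) = fst x" "snd (ray 2 x k) = snd x + int k"
  "fst (ray (Suc 0) x k) = fst x + int k" "snd (ray (Suc 0) x k) = snd x"
  by (simp_all add: ray_def)

lemma ray_eq_iff [simp]: "ray i x k = ray i x l \<longleftrightarrow> k = l"
  by (cases x) (simp add: ray_def)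

lemma ray_eq_start_iff [simp]: "ray i x k = x \<longleftrightarrow> k = 0" "x = ray i x k \<longleftrightarrow> k = 0"
  using ray_eq_iff[of i x k 0] ray_eq_iff[of i x 0 k] by (auto simp del: ray_eq_iff)

text \<open>The lexicographic order, rows first.\<close>

definition precedes :: "site \<Rightarrow> site \<Rightarrow> bool" where
  "precedes y x \<longleftrightarrow> snd y < snd x \<or> snd y = snd x \<and> fst y < fst x"

lemma precedes_irrefl [simp]: "\<not> precedes x x"
  by (simp add: precedes_def)

lemma precedes_asym: "precedes x y \<Longrightarrow> \<not> precedes y x"
  by (auto simp: precedes_def)

lemma finite_last_site:
  assumes "finite P" "P \<noteq> {}"
  obtains t where "t \<in> P" "\<And>y. y \<in> P \<Longrightarrow> y \<noteq> t \<Longrightarrow> precedes y t"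
proof -
  define m where "m = Max (snd ` P)"
  define Q where "Q = {y \<in> P. snd y = m}"
  have "m \<in> snd ` P" unfolding m_def using assms by (intro Max_in) auto
  then have Q: "finite Q" "Q \<noteq> {}" using assms by (auto simp: Q_def)
  then have "Max (fst ` Q) \<in> fst ` Q" by (intro Max_in) auto
  then obtain t where t: "t \<in> Q" "fst t = Max (fst ` Q)" by auto
  show ?thesis
  proof
    show "t \<in> P" using t by (simp add: Q_def)
    fix y assume y: "y \<in> P" "y \<noteq> t"
    have "snd y \<le> m" unfolding m_def using y assms by simp
    moreover have "fst y \<le> fst t" if "snd y = m"
      unfolding t(2) using Q that y by (intro Max_ge) (auto simp: Q_def)
    ultimately show "precedes y t"
      using t(1) y(2) by (cases y; cases t) (auto simp: precedes_def Q_def)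
  qed
qed

definition below :: "site \<Rightarrow> config \<Rightarrow> config" where
  "below x \<eta> y = (if precedes y x then \<eta> y else empty_site)"

lemma Sigma_inf_below [simp]: "\<eta> \<in> Sigma_inf \<Longrightarrow> below x \<eta> \<in> Sigma_inf"
proof -
  have "below x \<eta> = trunc {y. precedes y x} \<eta>" by (simp add: below_def pull_def fun_eq_iff)
  then show "\<eta> \<in> Sigma_inf \<Longrightarrow> ?thesis" by simp
qed

definition clear_above :: "site \<Rightarrow> config \<Rightarrow> bool" where
  "clear_above x \<rho> \<longleftrightarrow> (\<forall>k. \<rho> (ray 2 x k) = empty_site)"

definition line :: "nat \<Rightarrow> site \<Rightarrow> nat \<Rightarrow> jump_path" where
  "line i x L = map (\<lambda>k. (ray i x k, evec i)) [0..<L]"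

lemma line_0 [simp]: "line i x 0 = []" and line_Suc: "line i x (Suc L) = line i x L @ [(ray i x L, evec i)]"
  by (simp_all add: line_def)

lemma exch_move:
  "\<rho> a = empty_site \<Longrightarrow> \<rho> b = empty_site \<Longrightarrow> exch a b (\<rho>(a := s)) = \<rho>(b := s)"
  by (auto simp: exch_def fun_eq_iff)

text \<open>A closed germ of finite range for which the jumps of an isolated particle are free. The second
  property is no loss of generality, as it is achieved by subtracting a current. It makes sense of
  the work needed to carry a particle away to infinity: beyond the range of the germ the particle
  moves freely.\<close>

locale isolated_closed_germ =
  fixes \<alpha> :: param and u :: germ and R :: nat
  assumes closed: "closed_germ \<alpha> u"
    and finite_range: "i \<in> {1, 2} \<Longrightarrow> depends_on (component i u) (site_box R)"
    and isolated: "i \<in> {1, 2} \<Longrightarrow> s \<in> site_states \<Longrightarrow> component i u ((\<lambda>_. empty_site)(0 := s)) = 0"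
begin

definition bond :: "nat \<Rightarrow> site \<Rightarrow> config \<Rightarrow> real" where
  "bond i x = translate x (component i u)"

definition near :: "site \<Rightarrow> site \<Rightarrow> bool" where
  "near x y \<longleftrightarrow> \<bar>fst y - fst x\<bar> \<le> int R \<and> \<bar>snd y - snd x\<bar> \<le> int R"

lemma bond_cong:
  assumes i: "i \<in> {1, 2}" and s: "\<eta> \<in> Sigma_inf" "\<xi> \<in> Sigma_inf" and eq: "\<And>y. near x y \<Longrightarrow> \<eta> y = \<xi> y"
  shows "bond i x \<eta> = bond i x \<xi>"
  unfolding bond_def translate_def
proof (rule depends_onD[OF finite_range[OF i] Sigma_inf_comp[OF s(1)] Sigma_inf_comp[OF s(2)]])
  show "\<eta> (x + y) = \<xi> (x + y)" if "y \<in> site_box R" for y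
    using that by (intro eq) (auto simp: near_def site_box_def)
qed

lemma bond_isolated:
  assumes i: "i \<in> {1, 2}" and s: "\<eta> \<in> Sigma_inf"
    and e: "\<And>y. near x y \<Longrightarrow> y \<noteq> x \<Longrightarrow> \<eta> y = empty_site"
  shows "bond i x \<eta> = 0"
proof -
  let ?\<xi> = "(\<lambda>_. empty_site)(x := \<eta> x)"
  have e0: "(\<lambda>_. empty_site) \<in> Sigma_inf" by (rule Sigma_infI) simp
  have "bond i x \<eta> = bond i x ?\<xi>"
    by (rule bond_cong[OF i s]) (use e e0 s Sigma_inf_site in auto)
  also have "\<dots> = component i u ((\<lambda>_. empty_site)(0 := \<eta> x))"
    unfolding bond_def translate_def by (rule arg_cong[where f = "component i u"]) auto
  finally show ?thesis using isolated[OF i Sigma_inf_site[OF s]] by simp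
qed

lemma bond_support:
  "\<eta> \<in> Sigma_inf \<Longrightarrow> bond i x \<eta> = occ \<eta> x * (1 - occ \<eta> (x + evec i)) * bond i x \<eta>"
  unfolding bond_def by (rule closed_germ_support[OF closed])

lemma bond_shift: "bond i y (\<lambda>z. \<eta> (x + z)) = bond i (x + y) \<eta>"
  by (simp add: bond_def translate_def algebra_simps)

lemma line_path:
  assumes \<rho>: "\<rho> \<in> Sigma_inf" and s: "s \<in> site_states" "s \<noteq> empty_site"
    and e: "\<And>k. k \<le> L \<Longrightarrow> \<rho> (ray i x k) = empty_site"
  shows "licit (\<rho>(x := s)) (line i x L)" "path_end (\<rho>(x := s)) (line i x L) = \<rho>(ray i x L := s)"
    "path_integral (form_of_germ u) (\<rho>(x := s)) (line i x L)
      = (\<Sum>k<L. bond i (ray i x k) (\<rho>(ray i x k := s)))"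
proof -
  have "licit (\<rho>(x := s)) (line i x L) \<and> path_end (\<rho>(x := s)) (line i x L) = \<rho>(ray i x L := s) \<and>
    path_integral (form_of_germ u) (\<rho>(x := s)) (line i x L)
      = (\<Sum>k<L. bond i (ray i x k) (\<rho>(ray i x k := s)))"
    using e
  proof (induction L)
    case (Suc L)
    let ?\<xi> = "\<rho>(ray i x L := s)"
    have "\<And>k. k \<le> L \<Longrightarrow> \<rho> (ray i x k) = empty_site" using Suc.prems by simp
    note IH' = Suc.IH[OF this]
    note IH = IH'[THEN conjunct1] IH'[THEN conjunct2, THEN conjunct1] IH'[THEN conjunct2, THEN conjunct2]
    have e: "\<rho> (ray i x L) = empty_site" "\<rho> (ray i x L + evec i) = empty_site"
      using Suc.prems[of L] Suc.prems[of "Suc L"] by (simp_all add: ray_Suc)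
    have \<xi>: "?\<xi> \<in> Sigma_inf" using \<rho> s by simp
    have "occ ?\<xi> (ray i x L) = 1" "occ ?\<xi> (ray i x L + evec i) = 0"
      using e s by (simp_all add: occ_Sigma[OF \<xi>])
    moreover have "exch (ray i x L) (ray i x L + evec i) ?\<xi> = \<rho>(ray i x (Suc L) := s)"
      using exch_move[OF e] by (simp add: ray_Suc)
    ultimately show ?case
      using IH by (simp add: line_Suc licit_append path_end_append path_integral_append
          form_of_germ_pos bond_def del: fun_upd_apply)
  qed simp
  then show "licit (\<rho>(x := s)) (line i x L)" "path_end (\<rho>(x := s)) (line i x L) = \<rho>(ray i x L := s)"
    "path_integral (form_of_germ u) (\<rho>(x := s)) (line i x L)
      = (\<Sum>k<L. bond i (ray i x k) (\<rho>(ray i x k := s)))" by auto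
qed

lemma single_jump:
  assumes \<rho>: "\<rho> \<in> Sigma_inf" and s: "s \<in> site_states" "s \<noteq> empty_site"
    and e: "\<rho> x = empty_site" "\<rho> (x + evec i) = empty_site"
  shows "licit (\<rho>(x := s)) [(x, evec i)]" "path_end (\<rho>(x := s)) [(x, evec i)] = \<rho>(x + evec i := s)"
    "path_integral (form_of_germ u) (\<rho>(x := s)) [(x, evec i)] = bond i x (\<rho>(x := s))"
proof -
  have r: "\<And>k. k \<le> Suc 0 \<Longrightarrow> \<rho> (ray i x k) = empty_site"
    using e ray_Suc[of i x 0] by (auto simp: le_Suc_eq)
  have l: "line i x (Suc 0) = [(x, evec i)]" by (simp add: line_Suc)
  show "licit (\<rho>(x := s)) [(x, evec i)]" "path_end (\<rho>(x := s)) [(x, evec i)] = \<rho>(x + evec i := s)"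
    "path_integral (form_of_germ u) (\<rho>(x := s)) [(x, evec i)] = bond i x (\<rho>(x := s))"
    using line_path[where L = "Suc 0" and i = i, OF \<rho> s r] ray_Suc[of i x 0] by (simp_all add: l)
qed

lemmas path_independent = closed_germ_path_independent[OF closed]

text \<open>The work of moving a particle up by \<open>L\<close> sites in the environment \<open>\<rho>\<close>.\<close>

definition lift :: "site_state \<Rightarrow> site \<Rightarrow> config \<Rightarrow> nat \<Rightarrow> real" where
  "lift s x \<rho> L = (\<Sum>k<L. bond 2 (ray 2 x k) (\<rho>(ray 2 x k := s)))"

lemma lift_Suc: "lift s x \<rho> (Suc L) = bond 2 x (\<rho>(x := s)) + lift s (x + evec 2) \<rho> L"
  unfolding lift_def by (simp add: sum.lessThan_Suc_shift ray_Suc ray_evec del: evec_simps sum.lessThan_Suc)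

lemma lift_cong:
  assumes "\<rho> \<in> Sigma_inf" "\<rho>' \<in> Sigma_inf" "s \<in> site_states"
    and "\<And>k y. k < L \<Longrightarrow> near (ray 2 x k) y \<Longrightarrow> \<rho> y = \<rho>' y"
  shows "lift s x \<rho> L = lift s x \<rho>' L"
  unfolding lift_def
  by (rule sum.cong[OF refl], rule bond_cong) (use assms in auto)

lemma lift_stable:
  assumes \<rho>: "\<rho> \<in> Sigma_inf" "s \<in> site_states" and "K \<le> L"
    and e: "\<And>k y. K \<le> k \<Longrightarrow> near (ray 2 x k) y \<Longrightarrow> \<rho> y = empty_site"
  shows "lift s x \<rho> L = lift s x \<rho> K"
  unfolding lift_def
proof (rule sum.mono_neutral_right)
  show "\<forall>k\<in>{..<L} - {..<K}. bond 2 (ray 2 x k) (\<rho>(ray 2 x k := s)) = 0"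
    by (intro ballI bond_isolated) (use \<rho> e in auto)
qed (use assms in auto)

text \<open>Minus the work of removing the particle at \<open>0\<close> upwards, once all its successors in the
  lexicographic order are gone. As the remaining particles do not lie in higher rows, they are out of
  range after \<open>R + 1\<close> steps, and only those near the first \<open>R + 1\<close> positions matter.\<close>

definition removal :: "config \<Rightarrow> real" where
  "removal \<eta> = - lift (\<eta> 0) 0 (below 0 \<eta>) (Suc R)"

lemma translate_removal: "translate x removal \<eta> = - lift (\<eta> x) x (below x \<eta>) (Suc R)"
proof -
  have "bond 2 (ray 2 0 k) ((below 0 (\<lambda>z. \<eta> (x + z)))(ray 2 0 k := \<eta> x))
      = bond 2 (ray 2 x k) ((below x \<eta>)(ray 2 x k := \<eta> x))" for k
  proof -
    have r: "x + ray 2 0 k = ray 2 x k" by (simp add: ray_def)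
    have "(below 0 (\<lambda>z. \<eta> (x + z)))(ray 2 0 k := \<eta> x) = (\<lambda>z. ((below x \<eta>)(ray 2 x k := \<eta> x)) (x + z))"
      by (rule ext) (auto simp: below_def precedes_def r[symmetric])
    then show ?thesis using bond_shift[of 2 "ray 2 0 k" "(below x \<eta>)(ray 2 x k := \<eta> x)" x] r by simp
  qed
  then show ?thesis by (simp add: translate_def removal_def lift_def)
qed

lemma removal_empty:
  assumes \<eta>: "\<eta> \<in> Sigma_inf" and e: "\<eta> x = empty_site"
  shows "translate x removal \<eta> = 0"
proof -
  have "bond 2 (ray 2 x k) ((below x \<eta>)(ray 2 x k := empty_site)) = 0" for k
    using bond_support[of "(below x \<eta>)(ray 2 x k := empty_site)" 2 "ray 2 x k"] \<eta>
    by (simp add: occ_alt)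
  then show ?thesis by (simp add: translate_removal lift_def e)
qed

lemma removal_depends_on: "depends_on removal (site_box (2 * R))"
  unfolding depends_on_def
proof (intro ballI impI)
  fix \<eta> \<xi> assume s: "\<eta> \<in> Sigma_inf" "\<xi> \<in> Sigma_inf" and eq: "\<forall>x\<in>site_box (2 * R). \<eta> x = \<xi> x"
  have "0 \<in> site_box (2 * R)" by (simp add: site_box_def mem_Times_iff)
  with eq have 0: "\<eta> 0 = \<xi> 0" by blast
  have "lift (\<eta> 0) 0 (below 0 \<eta>) (Suc R) = lift (\<eta> 0) 0 (below 0 \<xi>) (Suc R)"
  proof (rule lift_cong)
    fix k y assume k: "k < Suc R" and y: "near (ray 2 0 k) y"
    show "below 0 \<eta> y = below 0 \<xi> y"
    proof (cases "precedes y 0")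
      case True
      then have "y \<in> site_box (2 * R)" using k y
        by (cases y) (auto simp: near_def site_box_def precedes_def)
      then show ?thesis using eq by (simp add: below_def)
    qed (simp add: below_def)
  qed (use s Sigma_inf_site in auto)
  then show "removal \<eta> = removal \<xi>" by (simp add: removal_def 0)
qed

text \<open>Minus the work of removing all particles, the last one first.\<close>

definition potential :: "config \<Rightarrow> real" where
  "potential \<eta> = (\<Sum>x\<in>particles \<eta>. translate x removal \<eta>)"

lemma potential_trans_sum:
  assumes "\<eta> \<in> Sigma_inf" "finite X" "particles \<eta> \<subseteq> X"
  shows "potential \<eta> = trans_sum X removal \<eta>"
  unfolding potential_def trans_sum_def
  by (rule sum.mono_neutral_left) (use assms removal_empty in auto)

lemma particles_upd_empty: "particles (\<eta>(t := empty_site)) = particles \<eta> - {t}"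
  by auto

lemma potential_remove_last:
  assumes \<eta>: "\<eta> \<in> Sigma_inf" "finite (particles \<eta>)" and t: "t \<in> particles \<eta>"
    and last: "\<And>y. y \<in> particles \<eta> \<Longrightarrow> y \<noteq> t \<Longrightarrow> precedes y t" and L: "Suc R \<le> L"
  shows "potential \<eta> = potential (\<eta>(t := empty_site)) - lift (\<eta> t) t (\<eta>(t := empty_site)) L"
proof -
  let ?\<xi> = "\<eta>(t := empty_site)"
  have "translate x removal ?\<xi> = translate x removal \<eta>" if x: "x \<in> particles \<eta> - {t}" for x
  proof -
    have "\<not> precedes t x" using last[of x] x precedes_asym by blast
    then have "below x ?\<xi> = below x \<eta>" by (auto simp: below_def fun_eq_iff)
    then show ?thesis using x by (simp add: translate_removal)
  qed
  then have 1: "potential ?\<xi> = (\<Sum>x\<in>particles \<eta> - {t}. translate x removal \<eta>)"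
    unfolding potential_def particles_upd_empty by (intro sum.cong) auto
  have 2: "potential \<eta> = translate t removal \<eta> + (\<Sum>x\<in>particles \<eta> - {t}. translate x removal \<eta>)"
    unfolding potential_def by (rule sum.remove[OF \<eta>(2) t])
  have b: "below t \<eta> = ?\<xi>"
  proof
    show "below t \<eta> y = ?\<xi> y" for y
      using last[of y] by (cases "y = t"; cases "\<eta> y = empty_site") (auto simp: below_def)
  qed
  have "lift (\<eta> t) t ?\<xi> L = lift (\<eta> t) t ?\<xi> (Suc R)"
  proof (rule lift_stable)
    fix k y assume "Suc R \<le> k" "near (ray 2 t k) y"
    then have "\<not> precedes y t" by (auto simp: near_def precedes_def)
    then show "?\<xi> y = empty_site" using last[of y] by auto
  qed (use \<eta> L Sigma_inf_site in auto)
  then show ?thesis unfolding 1 2 translate_removal b by simp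
qed

text \<open>The last particle \<open>t\<close> and another particle \<open>x\<close> can be removed in either order, with the same work,
  because both orders lead to the same configuration. On straight columns one of the two would have
  to overtake the other, possibly within its range; so \<open>t\<close> is parked just above the remaining
  particles, far to the right.\<close>

lemma lift_commute:
  assumes \<rho>: "\<rho> \<in> Sigma_inf" and s: "s \<in> site_states" "s \<noteq> empty_site" and r: "r \<in> site_states" "r \<noteq> empty_site"
    and xt: "precedes x t" and last: "\<And>y. y \<in> particles \<rho> \<Longrightarrow> precedes y t"
    and clear: "clear_above x \<rho>" and tx: "\<And>k. t \<noteq> ray 2 x k"
  shows "\<forall>\<^sub>F L in sequentially. lift r t (\<rho>(x := s)) (Suc R) + lift s x \<rho> L
    = lift s x (\<rho>(t := r)) L + lift r t \<rho> (Suc R)"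
proof -
  \<comment> \<open>The particle \<open>t\<close> goes up to \<open>t1\<close>, then right to its parking position \<open>t2\<close>.\<close>
  define N where "N = nat \<bar>fst x - fst t\<bar> + Suc R"
  define t1 where "t1 = ray 2 t (Suc R)"
  define t2 where "t2 = ray 1 t1 N"
  have t1: "fst t1 = fst t" "snd t1 = snd t + int R + 1" by (simp_all add: t1_def)
  have t2: "fst t2 = fst t + int N" "snd t2 = snd t + int R + 1" by (simp_all add: t2_def t1)
  have rho_e: "\<rho> y = empty_site" if "snd t < snd y \<or> (snd t = snd y \<and> fst t \<le> fst y)" for y
    by (rule ccontr) (use last[of y] that in \<open>auto simp: precedes_def\<close>)
  have xe: "\<rho> (ray 2 x k) = empty_site" for k using clear by (simp add: clear_above_def)
  have x_le: "snd x \<le> snd t" using xt by (auto simp: precedes_def)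
  have main: "lift r t (\<rho>(x := s)) (Suc R) + lift s x \<rho> L
    = lift s x (\<rho>(t := r)) L + lift r t \<rho> (Suc R)" if L: "int L > snd t - snd x + 2 * int R + 1" for L
  proof -
    define x1 where "x1 = ray 2 x L"
    have x1: "fst x1 = fst x" "snd x1 = snd x + int L" by (simp_all add: x1_def)
    have ne: "x \<noteq> t" "x \<noteq> t1" "x \<noteq> t2" "x1 \<noteq> t" "x1 \<noteq> t1" "x1 \<noteq> t2"
      using tx[of 0] x_le t1 t2 x1 L by auto
    have e_t: "(\<rho>(x := s)) (ray 2 t k) = empty_site" for k
      using rho_e[of "ray 2 t k"] xt by (auto simp: precedes_def)
    have e_t1: "(\<rho>(x := s)) (ray 1 t1 k) = empty_site" for k
      using rho_e[of "ray 1 t1 k"] x_le t1 by auto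
    have e_x: "(\<rho>(t2 := r)) (ray 2 x k) = empty_site" for k
    proof -
      have "fst (ray 2 x k) \<noteq> fst t2" by (simp add: t2 N_def)
      then have "ray 2 x k \<noteq> t2" by metis
      then show ?thesis using xe by simp
    qed
    have e_x': "(\<rho>(t := r)) (ray 2 x k) = empty_site" for k
      using tx[of k] xe by auto
    have e_t': "(\<rho>(x1 := s)) (ray 2 t k) = empty_site" if "k \<le> Suc R" for k
    proof -
      have "snd (ray 2 t k) \<noteq> snd x1" using L x1 that by simp
      then have "ray 2 t k \<noteq> x1" by metis
      then show ?thesis using rho_e[of "ray 2 t k"] by (cases "k = 0") auto
    qed
    have e_t1': "(\<rho>(x1 := s)) (ray 1 t1 k) = empty_site" for k
    proof -
      have "snd (ray 1 t1 k) \<noteq> snd x1" using L x1 t1 by simp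
      then have "ray 1 t1 k \<noteq> x1" by metis
      then show ?thesis using rho_e[of "ray 1 t1 k"] t1 by simp
    qed
    note A1 = line_path[where i = 2 and x = t and L = "Suc R", OF Sigma_inf_upd[OF \<rho> s(1), of x] r e_t]
    note A2 = line_path[where i = 1 and x = t1 and L = N, OF Sigma_inf_upd[OF \<rho> s(1), of x] r e_t1]
    note A3 = line_path[where i = 2 and x = x and L = L, OF Sigma_inf_upd[OF \<rho> r(1), of t2] s e_x]
    note B1 = line_path[where i = 2 and x = x and L = L, OF Sigma_inf_upd[OF \<rho> r(1), of t] s e_x']
    note B2 = line_path[where i = 2 and x = t and L = "Suc R", OF Sigma_inf_upd[OF \<rho> s(1), of x1] r e_t']
    note B3 = line_path[where i = 1 and x = t1 and L = N, OF Sigma_inf_upd[OF \<rho> s(1), of x1] r e_t1']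
    let ?p = "line 2 t (Suc R) @ line 1 t1 N @ line 2 x L"
    let ?q = "line 2 x L @ line 2 t (Suc R) @ line 1 t1 N"
    let ?\<eta> = "\<rho>(x := s, t := r)"
    have tw: "?\<eta> = \<rho>(t := r, x := s)" "\<rho>(x := s, t2 := r) = \<rho>(t2 := r, x := s)"
      "\<rho>(t := r, x1 := s) = \<rho>(x1 := s, t := r)" "\<rho>(t2 := r, x1 := s) = \<rho>(x1 := s, t2 := r)"
      using ne by (simp_all add: fun_upd_twist)
    have "licit ?\<eta> ?p" "path_end ?\<eta> ?p = \<rho>(t2 := r, x1 := s)"
      using A1(1,2) A2(1,2) A3(1,2)
      by (simp_all add: licit_append path_end_append tw(2) del: fun_upd_apply One_nat_def flip: t1_def t2_def x1_def)
    moreover have "licit ?\<eta> ?q" "path_end ?\<eta> ?q = \<rho>(t2 := r, x1 := s)"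
      using B1(1,2) B2(1,2) B3(1,2)
      by (simp_all add: licit_append path_end_append tw(1,3,4) del: fun_upd_apply One_nat_def flip: t1_def t2_def x1_def)
    ultimately have "path_integral (form_of_germ u) ?\<eta> ?p = path_integral (form_of_germ u) ?\<eta> ?q"
      using \<rho> s r by (intro path_independent) simp_all
    moreover have "path_integral (form_of_germ u) ?\<eta> ?p = lift r t (\<rho>(x := s)) (Suc R) + lift s x \<rho> L"
    proof -
      have "bond 1 (ray 1 t1 k) (\<rho>(x := s, ray 1 t1 k := r)) = 0" for k
      proof (rule bond_isolated)
        fix y assume "near (ray 1 t1 k) y" "y \<noteq> ray 1 t1 k"
        moreover from this have "snd y > snd t" by (auto simp: near_def t1)
        then have "y \<noteq> x" "\<rho> y = empty_site" using x_le rho_e by auto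
        ultimately show "(\<rho>(x := s, ray 1 t1 k := r)) y = empty_site" by simp
      qed (use \<rho> s r in simp_all)
      then have 2: "path_integral (form_of_germ u) (\<rho>(x := s, t1 := r)) (line 1 t1 N) = 0"
        unfolding A2(3) by (intro sum.neutral ballI)
      have 3: "lift s x (\<rho>(t2 := r)) L = lift s x \<rho> L"
      proof (rule lift_cong)
        fix k y assume "near (ray 2 x k) y"
        then have "fst y < fst t2" by (auto simp: near_def t2 N_def)
        then show "(\<rho>(t2 := r)) y = \<rho> y" by auto
      qed (use \<rho> s r in simp_all)
      show ?thesis
        using A1(2,3) A2(2) A3(3) 2 3
        by (simp add: path_integral_append path_end_append tw(2) del: fun_upd_apply One_nat_def flip: t1_def t2_def x1_def lift_def)
    qed
    moreover have "path_integral (form_of_germ u) ?\<eta> ?q = lift s x (\<rho>(t := r)) L + lift r t \<rho> (Suc R)"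
    proof -
      have "bond 1 (ray 1 t1 k) (\<rho>(x1 := s, ray 1 t1 k := r)) = 0" for k
      proof (rule bond_isolated)
        fix y assume "near (ray 1 t1 k) y" "y \<noteq> ray 1 t1 k"
        moreover from this have "snd y > snd t" "snd y \<le> snd t + 2 * int R + 1" by (auto simp: near_def t1)
        then have "y \<noteq> x1" "\<rho> y = empty_site" using L x1 rho_e by auto
        ultimately show "(\<rho>(x1 := s, ray 1 t1 k := r)) y = empty_site" by simp
      qed (use \<rho> s r in simp_all)
      then have 2: "path_integral (form_of_germ u) (\<rho>(x1 := s, t1 := r)) (line 1 t1 N) = 0"
        unfolding B3(3) by (intro sum.neutral ballI)
      have 3: "lift r t (\<rho>(x1 := s)) (Suc R) = lift r t \<rho> (Suc R)"
      proof (rule lift_cong)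
        fix k y assume "k < Suc R" "near (ray 2 t k) y"
        then have "snd y < snd x1" using L by (auto simp: near_def x1)
        then show "(\<rho>(x1 := s)) y = \<rho> y" by auto
      qed (use \<rho> s r in simp_all)
      show ?thesis
        using B1(2,3) B2(2,3) 2 3
        by (simp add: path_integral_append path_end_append tw(1,3) del: fun_upd_apply One_nat_def flip: t1_def t2_def x1_def lift_def)
    qed
    ultimately show ?thesis by simp
  qed
  show ?thesis
  proof (rule eventually_sequentiallyI[of "nat (snd t - snd x) + 2 * R + 2"])
    fix L assume "nat (snd t - snd x) + 2 * R + 2 \<le> L"
    then show "lift r t (\<rho>(x := s)) (Suc R) + lift s x \<rho> L
      = lift s x (\<rho>(t := r)) L + lift r t \<rho> (Suc R)"
      using x_le by (intro main) linarith
  qed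
qed

text \<open>The potential does not remember the order in which the particles are removed: any particle with a
  free column above it may go first. By induction this particle may go right after the last one, and
  those two removals commute.\<close>

lemma potential_remove:
  assumes "\<eta> \<in> Sigma_inf" "finite (particles \<eta>)" "x \<in> particles \<eta>" "clear_above x (\<eta>(x := empty_site))"
  shows "\<forall>\<^sub>F L in sequentially.
    potential \<eta> = potential (\<eta>(x := empty_site)) - lift (\<eta> x) x (\<eta>(x := empty_site)) L"
  using assms
proof (induction "card (particles \<eta>)" arbitrary: \<eta> rule: less_induct)
  case less
  note \<eta> = less.prems(1) and fin = less.prems(2) and x = less.prems(3) and clear = less.prems(4)
  from x have "particles \<eta> \<noteq> {}" by blast
  from finite_last_site[OF fin this] obtain t where t: "t \<in> particles \<eta>"
    and last: "\<And>y. y \<in> particles \<eta> \<Longrightarrow> y \<noteq> t \<Longrightarrow> precedes y t" by blast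
  show ?case
  proof (cases "x = t")
    case True
    show ?thesis
      by (rule eventually_sequentiallyI[of "Suc R"])
         (use potential_remove_last[OF \<eta> fin t last] True in simp)
  next
    case False
    define \<eta>t \<eta>x \<rho> where "\<eta>t = \<eta>(t := empty_site)" and "\<eta>x = \<eta>(x := empty_site)"
      and "\<rho> = \<eta>(t := empty_site, x := empty_site)"
    define s r where "s = \<eta> x" and "r = \<eta> t"
    have upd: "\<eta>t = \<rho>(x := s)" "\<eta>x = \<rho>(t := r)" "\<eta>x(t := empty_site) = \<rho>" "\<eta>t(x := empty_site) = \<rho>"
      "\<eta>t x = s" "\<eta>x t = r"
      using False by (auto simp: \<eta>t_def \<eta>x_def \<rho>_def s_def r_def fun_eq_iff)
    have S: "\<eta>t \<in> Sigma_inf" "\<eta>x \<in> Sigma_inf" "\<rho> \<in> Sigma_inf" "s \<in> site_states" "r \<in> site_states"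
      using \<eta> Sigma_inf_site[OF \<eta>] by (auto simp: \<eta>t_def \<eta>x_def \<rho>_def s_def r_def)
    have ne: "s \<noteq> empty_site" "r \<noteq> empty_site" using x t by (auto simp: s_def r_def)
    have "\<forall>\<^sub>F L in sequentially. potential \<eta>t = potential (\<eta>t(x := empty_site)) - lift (\<eta>t x) x (\<eta>t(x := empty_site)) L"
    proof (rule less.hyps)
      show "card (particles \<eta>t) < card (particles \<eta>)"
        unfolding \<eta>t_def particles_upd_empty using fin t by (rule card_Diff1_less)
      show "finite (particles \<eta>t)" unfolding \<eta>t_def particles_upd_empty using fin by simp
      show "x \<in> particles \<eta>t" using x False by (simp add: \<eta>t_def)
      show "clear_above x (\<eta>t(x := empty_site))"
        unfolding clear_above_def
      proof
        show "(\<eta>t(x := empty_site)) (ray 2 x k) = empty_site" for k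
          using clear[unfolded clear_above_def, THEN spec, of k] by (auto simp: \<eta>t_def)
      qed
    qed (use S in simp)
    then have IH: "\<forall>\<^sub>F L in sequentially. potential \<eta>t = potential \<rho> - lift s x \<rho> L" by (simp only: upd(4,5))
    have 1: "potential \<eta> = potential \<eta>t - lift r t \<eta>t (Suc R)"
      unfolding \<eta>t_def r_def by (rule potential_remove_last[OF \<eta> fin t last]) simp_all
    have "potential \<eta>x = potential (\<eta>x(t := empty_site)) - lift (\<eta>x t) t (\<eta>x(t := empty_site)) (Suc R)"
    proof (rule potential_remove_last[OF S(2)])
      show "finite (particles \<eta>x)" unfolding \<eta>x_def particles_upd_empty using fin by simp
      show "t \<in> particles \<eta>x" using t False by (simp add: \<eta>x_def)
      show "precedes y t" if "y \<in> particles \<eta>x" "y \<noteq> t" for y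
        using that last[of y] by (auto simp: \<eta>x_def split: if_splits)
    qed simp
    then have 2: "potential \<eta>x = potential \<rho> - lift r t \<rho> (Suc R)" by (simp only: upd(3,6))
    have "\<forall>\<^sub>F L in sequentially. lift r t (\<rho>(x := s)) (Suc R) + lift s x \<rho> L
      = lift s x (\<rho>(t := r)) L + lift r t \<rho> (Suc R)"
    proof (rule lift_commute[OF S(3,4) ne(1) S(5) ne(2)])
      show "precedes x t" using last[OF x False] .
      show "precedes y t" if "y \<in> particles \<rho>" for y
        using that last[of y] by (auto simp: \<rho>_def split: if_splits)
      show "clear_above x \<rho>"
        unfolding clear_above_def
      proof
        show "\<rho> (ray 2 x k) = empty_site" for k
          using clear[unfolded clear_above_def, THEN spec, of k] by (auto simp: \<rho>_def)
      qed
      show "t \<noteq> ray 2 x k" for k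
      proof
        assume tk: "t = ray 2 x k"
        from clear have "(\<eta>(x := empty_site)) (ray 2 x k) = empty_site" unfolding clear_above_def by blast
        with tk t False show False by auto
      qed
    qed
    from eventually_conj[OF this IH] show ?thesis
      by (rule eventually_mono) (use 1 2 in \<open>simp add: upd(1,2) flip: \<eta>x_def s_def\<close>)
  qed
qed

lemma finite_particles_bounded:
  assumes "finite (particles \<rho>)" obtains M :: nat where "\<And>y. y \<in> particles \<rho> \<Longrightarrow> snd y \<le> int M"
proof -
  let ?m = "Max (insert 0 (snd ` particles \<rho>))"
  have "snd y \<le> ?m" if "y \<in> particles \<rho>" for y using assms that by (intro Max_ge) auto
  moreover have "0 \<le> ?m" using assms by (intro Max_ge) auto
  ultimately show ?thesis by (intro that[of "nat ?m"]) simp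
qed

text \<open>If the particle can be removed upwards both before and after the jump, then the jump is part of
  the removal (when it goes up), or may be postponed until the particle is so high that it is free
  (when it goes right).\<close>

lemma jump_lift:
  assumes \<rho>: "\<rho> \<in> Sigma_inf" "finite (particles \<rho>)" and s: "s \<in> site_states" "s \<noteq> empty_site"
    and i: "i \<in> {1, 2}" and clear: "clear_above x \<rho>" "clear_above (x + evec i) \<rho>"
  shows "\<forall>\<^sub>F L in sequentially. \<exists>L'\<ge>L. lift s x \<rho> L' = bond i x (\<rho>(x := s)) + lift s (x + evec i) \<rho> L"
proof (cases "i = 2")
  case True
  then show ?thesis
    by (intro always_eventually allI exI[of _ "Suc _"]) (auto simp: lift_Suc simp del: evec_simps)
next
  case False
  then have i1: "i = 1" using i by simp
  let ?y = "x + evec 1"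
  obtain M :: nat where M: "\<And>y. y \<in> particles \<rho> \<Longrightarrow> snd y \<le> int M"
    using finite_particles_bounded[OF \<rho>(2)] by blast
  have "lift s x \<rho> L = bond 1 x (\<rho>(x := s)) + lift s ?y \<rho> L"
    if L: "int L > int M - snd x + int R" for L
  proof -
    have ray_y: "ray 2 ?y k = ray 2 x k + evec 1" for k by (rule ray_evec)
    have e: "\<rho> (ray 2 x k) = empty_site" "\<rho> (ray 2 x k + evec 1) = empty_site" for k
      using clear i1 unfolding clear_above_def by (simp_all add: ray_evec del: evec_simps)
    have e': "\<rho> (ray 2 ?y k) = empty_site" for k unfolding ray_y by (rule e)
    note A1 = line_path[where i = 2 and x = x and L = L, OF \<rho>(1) s e(1)]
    note A2 = single_jump[where i = 1 and x = "ray 2 x L", OF \<rho>(1) s e]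
    note B1 = single_jump[where i = 1 and x = x, OF \<rho>(1) s e(1)[of 0, unfolded ray_0] e(2)[of 0, unfolded ray_0]]
    note B2 = line_path[where i = 2 and x = ?y and L = L, OF \<rho>(1) s e']
    let ?p = "line 2 x L @ [(ray 2 x L, evec 1)]" and ?q = "[(x, evec 1)] @ line 2 ?y L"
    have "path_integral (form_of_germ u) (\<rho>(x := s)) ?p = path_integral (form_of_germ u) (\<rho>(x := s)) ?q"
    proof (rule path_independent)
      show "licit (\<rho>(x := s)) ?p" unfolding licit_append A1(2) using A1(1) A2(1) by blast
      show "licit (\<rho>(x := s)) ?q" unfolding licit_append B1(2) using B1(1) B2(1) by blast
      show "path_end (\<rho>(x := s)) ?p = path_end (\<rho>(x := s)) ?q"
        unfolding path_end_append A1(2) B1(2) A2(2) B2(2) ray_y ..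
    qed (use \<rho> s in simp)
    moreover have "bond 1 (ray 2 x L) (\<rho>(ray 2 x L := s)) = 0"
    proof (rule bond_isolated)
      fix y assume "near (ray 2 x L) y" "y \<noteq> ray 2 x L"
      moreover from this have "snd y > int M" using L by (auto simp: near_def)
      ultimately show "(\<rho>(ray 2 x L := s)) y = empty_site" using M[of y] by auto
    qed (use \<rho> s in simp_all)
    ultimately show ?thesis
      unfolding path_integral_append A1(2,3) B1(2,3) A2(3) B2(3) lift_def by simp
  qed
  then show ?thesis unfolding i1
    by (intro eventually_sequentiallyI[of "nat (int M - snd x + int R) + 1"] exI[of _ L for L]) auto
qed

text \<open>A bystander \<open>t\<close> can be removed before or after the jump from \<open>x\<close>; once it is gone, the jump does
  not feel it any more.\<close>

lemma jump_lift_bystander: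
  assumes \<rho>: "\<rho> \<in> Sigma_inf" and s: "s \<in> site_states" "s \<noteq> empty_site" and r: "r \<in> site_states" "r \<noteq> empty_site"
    and i: "i \<in> {1, 2}" and e: "\<rho> x = empty_site" "\<rho> (x + evec i) = empty_site"
    and clear: "clear_above t (\<rho>(x := s))" "clear_above t (\<rho>(x + evec i := s))"
  shows "\<forall>\<^sub>F L in sequentially. lift r t (\<rho>(x := s)) L + bond i x (\<rho>(x := s))
     = bond i x (\<rho>(t := r, x := s)) + lift r t (\<rho>(x + evec i := s)) L"
proof -
  let ?y = "x + evec i"
  have ne: "ray 2 t k \<noteq> x" "ray 2 t k \<noteq> ?y" "\<rho> (ray 2 t k) = empty_site" for k
    using clear s unfolding clear_above_def by (metis fun_upd_apply)+
  have "lift r t (\<rho>(x := s)) L + bond i x (\<rho>(x := s))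
     = bond i x (\<rho>(t := r, x := s)) + lift r t (\<rho>(?y := s)) L" if L: "snd t + int L > snd x + int R" for L
  proof -
    let ?t = "ray 2 t L"
    have Sx: "\<rho>(x := s) \<in> Sigma_inf" and Sy: "\<rho>(?y := s) \<in> Sigma_inf"
      and St: "\<rho>(?t := r) \<in> Sigma_inf" "\<rho>(t := r) \<in> Sigma_inf" using \<rho> s r by simp_all
    have et: "(\<rho>(?t := r)) x = empty_site" "(\<rho>(?t := r)) ?y = empty_site"
      "(\<rho>(t := r)) x = empty_site" "(\<rho>(t := r)) ?y = empty_site"
      using ne[of L] ne[of 0] e by auto
    have cx: "(\<rho>(x := s)) (ray 2 t k) = empty_site" and cy: "(\<rho>(?y := s)) (ray 2 t k) = empty_site" for k
      using clear unfolding clear_above_def by blast+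
    note A1 = line_path[where i = 2 and x = t and L = L, OF Sx r cx]
    note A2 = single_jump[OF St(1) s et(1,2)]
    note B1 = single_jump[OF St(2) s et(3,4)]
    note B2 = line_path[where i = 2 and x = t and L = L, OF Sy r cy]
    have tw: "\<rho>(x := s, t := r) = \<rho>(t := r, x := s)" "\<rho>(x := s, ?t := r) = \<rho>(?t := r, x := s)"
      "\<rho>(t := r, ?y := s) = \<rho>(?y := s, t := r)" "\<rho>(?t := r, ?y := s) = \<rho>(?y := s, ?t := r)"
      using ne[of 0] ne[of L] by (simp_all add: fun_upd_twist)
    let ?p = "line 2 t L @ [(x, evec i)]" and ?q = "[(x, evec i)] @ line 2 t L"
    let ?\<eta> = "\<rho>(t := r, x := s)"
    have "path_integral (form_of_germ u) ?\<eta> ?p = path_integral (form_of_germ u) ?\<eta> ?q"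
    proof (rule path_independent)
      show "licit ?\<eta> ?p" unfolding licit_append tw(1)[symmetric] A1(2)
        unfolding tw(2) using A1(1) A2(1) by blast
      show "licit ?\<eta> ?q" unfolding licit_append B1(2) tw(3) using B1(1) B2(1) by blast
      show "path_end ?\<eta> ?p = path_end ?\<eta> ?q"
        unfolding path_end_append B1(2) tw(3) B2(2)
        unfolding tw(1)[symmetric] A1(2) unfolding tw(2) A2(2) tw(4) ..
    qed (use \<rho> s r in simp)
    moreover have "path_integral (form_of_germ u) ?\<eta> ?p
       = lift r t (\<rho>(x := s)) L + bond i x (\<rho>(?t := r, x := s))"
      unfolding path_integral_append tw(1)[symmetric] A1(2,3)
      unfolding tw(2) A2(3) lift_def ..
    moreover have "path_integral (form_of_germ u) ?\<eta> ?q
       = bond i x (\<rho>(t := r, x := s)) + lift r t (\<rho>(?y := s)) L"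
      unfolding path_integral_append B1(2,3) tw(3) B2(3) lift_def ..
    moreover have "bond i x (\<rho>(?t := r, x := s)) = bond i x (\<rho>(x := s))"
    proof (rule bond_cong[OF i])
      fix y assume "near x y"
      then have "snd y < snd ?t" using L by (auto simp: near_def)
      then show "(\<rho>(?t := r, x := s)) y = (\<rho>(x := s)) y" by auto
    qed (use \<rho> s r in simp_all)
    ultimately show ?thesis by simp
  qed
  then show ?thesis
    by (intro eventually_sequentiallyI[of "nat (snd x - snd t + int R) + 1"]) auto
qed

text \<open>The highest particle of the column is the one that is free to leave.\<close>

lemma clear_above_or_blocked:
  assumes "finite (particles \<rho>)"
  obtains "clear_above x \<rho>" | t k where "t = ray 2 x k" "\<rho> t \<noteq> empty_site" "clear_above t (\<rho>(t := empty_site))"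
proof (cases "clear_above x \<rho>")
  case False
  define K where "K = {k. \<rho> (ray 2 x k) \<noteq> empty_site}"
  have "inj (ray 2 x)" by (rule injI) simp
  then have "finite K" unfolding K_def using finite_vimageI[OF assms, of "ray 2 x"] by (simp add: vimage_def)
  moreover have "K \<noteq> {}" using False by (auto simp: K_def clear_above_def)
  ultimately have m: "Max K \<in> K" "\<And>k. k \<in> K \<Longrightarrow> k \<le> Max K" by auto
  have "clear_above (ray 2 x (Max K)) (\<rho>(ray 2 x (Max K) := empty_site))"
    unfolding clear_above_def
  proof
    fix k
    have r: "ray 2 (ray 2 x (Max K)) k = ray 2 x (Max K + k)" by (simp add: ray_def)
    show "(\<rho>(ray 2 x (Max K) := empty_site)) (ray 2 (ray 2 x (Max K)) k) = empty_site"
      unfolding r using m(2)[of "Max K + k"] by (auto simp: K_def)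
  qed
  then show ?thesis using that(2)[OF refl] m(1) unfolding K_def by blast
qed (use that in blast)

lemma clear_above_upd: "clear_above t \<rho> \<Longrightarrow> (\<And>k. x \<noteq> ray 2 t k) \<Longrightarrow> clear_above t (\<rho>(x := s))"
  by (auto simp: clear_above_def)

text \<open>Induction on the number of other particles. If the jumping particle can be removed upwards before
  and after the jump, remove it. Otherwise its column, or the column that it enters, contains a
  particle above it; the highest such particle is a bystander that can be removed first.\<close>

lemma bond_eq_potential_difference:
  assumes "\<rho> \<in> Sigma_inf" "finite (particles \<rho>)" "\<rho> x = empty_site" "\<rho> (x + evec i) = empty_site"
    and s: "s \<in> site_states" "s \<noteq> empty_site" and i: "i \<in> {1, 2}"
  shows "bond i x (\<rho>(x := s)) = potential (\<rho>(x + evec i := s)) - potential (\<rho>(x := s))"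
  using assms(1-4)
proof (induction "card (particles \<rho>)" arbitrary: \<rho> rule: less_induct)
  case less
  note \<rho> = less.prems(1) and fin = less.prems(2) and e = less.prems(3,4)
  let ?y = "x + evec i"
  have fins: "finite (particles (\<rho>'(z := a)))" if "finite (particles \<rho>')" for \<rho>' z a
    by (rule finite_subset[of _ "insert z (particles \<rho>')"]) (use that in auto)
  have bystander: ?case
    if t: "\<rho> t \<noteq> empty_site" and clear: "clear_above t (\<rho>(t := empty_site))"
      and off: "\<And>k. x \<noteq> ray 2 t k" "\<And>k. ?y \<noteq> ray 2 t k" for t
  proof -
    define r where "r = \<rho> t"
    define \<zeta> where "\<zeta> = \<rho>(t := empty_site)"
    have tne: "t \<noteq> x" "t \<noteq> ?y" using off[of 0] by auto
    have Z: "\<zeta> \<in> Sigma_inf" "r \<in> site_states" "r \<noteq> empty_site" "finite (particles \<zeta>)"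
      using \<rho> t Sigma_inf_site[OF \<rho>] fins[OF fin] by (auto simp: \<zeta>_def r_def)
    have eZ: "\<zeta> x = empty_site" "\<zeta> ?y = empty_site" using e by (auto simp: \<zeta>_def)
    have cl: "clear_above t (\<zeta>(x := s))" "clear_above t (\<zeta>(?y := s))"
      using clear off by (auto simp: \<zeta>_def intro: clear_above_upd)
    have u: "\<rho>(x := s) = \<zeta>(t := r, x := s)" "\<rho>(?y := s) = \<zeta>(t := r, ?y := s)"
      "(\<rho>(x := s))(t := empty_site) = \<zeta>(x := s)" "(\<rho>(?y := s))(t := empty_site) = \<zeta>(?y := s)"
      "(\<rho>(x := s)) t = r" "(\<rho>(?y := s)) t = r"
      using tne by (auto simp: \<zeta>_def r_def fun_eq_iff)
    have IH: "bond i x (\<zeta>(x := s)) = potential (\<zeta>(?y := s)) - potential (\<zeta>(x := s))"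
    proof (rule less.hyps)
      show "card (particles \<zeta>) < card (particles \<rho>)"
        unfolding \<zeta>_def particles_upd_empty using fin t by (intro card_Diff1_less) auto
    qed (use Z eZ in auto)
    have "\<forall>\<^sub>F L in sequentially. potential (\<rho>(x := s)) = potential ((\<rho>(x := s))(t := empty_site))
        - lift ((\<rho>(x := s)) t) t ((\<rho>(x := s))(t := empty_site)) L"
      by (rule potential_remove) (use \<rho> s fins[OF fin] t tne cl in \<open>simp_all only: u(3), auto\<close>)
    then have 1: "\<forall>\<^sub>F L in sequentially. potential (\<rho>(x := s)) = potential (\<zeta>(x := s)) - lift r t (\<zeta>(x := s)) L"
      by (simp only: u(3-6))
    have "\<forall>\<^sub>F L in sequentially. potential (\<rho>(?y := s)) = potential ((\<rho>(?y := s))(t := empty_site))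
        - lift ((\<rho>(?y := s)) t) t ((\<rho>(?y := s))(t := empty_site)) L"
      by (rule potential_remove) (use \<rho> s fins[OF fin] t tne cl in \<open>simp_all only: u(4), auto\<close>)
    then have 2: "\<forall>\<^sub>F L in sequentially. potential (\<rho>(?y := s)) = potential (\<zeta>(?y := s)) - lift r t (\<zeta>(?y := s)) L"
      by (simp only: u(3-6))
    have 3: "\<forall>\<^sub>F L in sequentially. lift r t (\<zeta>(x := s)) L + bond i x (\<zeta>(x := s))
     = bond i x (\<rho>(x := s)) + lift r t (\<zeta>(?y := s)) L"
      unfolding u(1) by (rule jump_lift_bystander[OF Z(1) s Z(2,3) i eZ cl])
    have "\<forall>\<^sub>F L in sequentially. bond i x (\<rho>(x := s)) = potential (\<rho>(?y := s)) - potential (\<rho>(x := s))"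
      using 1 2 3 by eventually_elim (use IH in linarith)
    then show ?thesis by (simp add: eventually_const)
  qed
  have ne: "x \<noteq> ?y" by simp
  show ?case
  proof (cases rule: clear_above_or_blocked[OF fin, of x])
    case (2 t k)
    have "k \<noteq> 0" using 2 e by (intro notI) simp
    have "snd t > snd x" "fst t = fst x" using 2 \<open>k \<noteq> 0\<close> by simp_all
    moreover have "?y \<noteq> t" using 2 e by auto
    ultimately have "?y \<noteq> ray 2 t l" "x \<noteq> ray 2 t l" for l
      by (cases x; cases t; auto simp: ray_def evec_def split: if_splits)+
    then show ?thesis using 2 by (intro bystander) auto
  next
    case cx: 1
    show ?thesis
    proof (cases rule: clear_above_or_blocked[OF fin, of ?y])
      case (2 t k)
      have "k \<noteq> 0" using 2 e by (intro notI) simp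
      have "snd t > snd ?y" "fst t = fst ?y" using 2 \<open>k \<noteq> 0\<close> by simp_all
      moreover have "x \<noteq> t" using 2 e by auto
      ultimately have "?y \<noteq> ray 2 t l" "x \<noteq> ray 2 t l" for l
        by (cases x; cases t; auto simp: ray_def evec_def split: if_splits)+
      then show ?thesis using 2 by (intro bystander) auto
    next
      case cy: 1
      have u: "(\<rho>(z := s))(z := empty_site) = \<rho>" if "\<rho> z = empty_site" for z
        using that by (auto simp: fun_eq_iff)
      have pr: "\<forall>\<^sub>F L in sequentially. potential (\<rho>(z := s)) = potential \<rho> - lift s z \<rho> L"
        if "clear_above z \<rho>" "\<rho> z = empty_site" for z
        using potential_remove[of "\<rho>(z := s)" z] that \<rho> s fins[OF fin, of z s] u[OF that(2)] by simp
      from pr[OF cx e(1)] obtain L0 where L0: "\<And>L. L \<ge> L0 \<Longrightarrow> potential (\<rho>(x := s)) = potential \<rho> - lift s x \<rho> L"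
        by (auto simp: eventually_sequentially)
      have "\<forall>\<^sub>F L in sequentially. bond i x (\<rho>(x := s)) = potential (\<rho>(?y := s)) - potential (\<rho>(x := s))"
        using pr[OF cy e(2)] jump_lift[OF \<rho> fin s i cx cy] eventually_ge_at_top[of L0]
      proof eventually_elim
        case (elim L)
        then obtain L' where "L' \<ge> L" "lift s x \<rho> L' = bond i x (\<rho>(x := s)) + lift s ?y \<rho> L" by blast
        then show ?case using elim L0[of L'] by simp
      qed
      then show ?thesis by (simp add: eventually_const)
    qed
  qed
qed

text \<open>On finite configurations the potential is the sum of the translates of its local contribution.\<close>

lemma exact_on_finite_configurations:
  assumes \<eta>: "\<eta> \<in> Sigma_inf" and fin: "finite (particles \<eta>)" and i: "i \<in> {1, 2}"
  shows "component i u \<eta> = nabla_Sigma_comp i removal \<eta>"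
proof -
  let ?A = "site_box (2 * R)"
  let ?e = "evec i"
  define X where "X = particles \<eta> \<union> {0, ?e} \<union> meeting ?A {0, ?e}"
  have fA: "finite ?A" by (simp add: site_box_def)
  have X: "finite X" using fin fA by (simp add: X_def)
  have n: "nabla_Sigma_comp i removal \<eta> = occ \<eta> 0 * (1 - occ \<eta> ?e)
      * (trans_sum X removal (exch 0 ?e \<eta>) - trans_sum X removal \<eta>)"
  proof -
    have "meeting ?A {0, 0 + ?e} \<subseteq> X" by (auto simp: X_def)
    from translate_nabla_Sigma_comp[OF removal_depends_on fA \<eta> X this]
    show ?thesis by (simp add: translate_def)
  qed
  have b: "component i u \<eta> = bond i 0 \<eta>" by (simp add: bond_def translate_def)
  show ?thesis
  proof (cases "\<eta> 0 \<noteq> empty_site \<and> \<eta> ?e = empty_site")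
    case True
    define \<rho> where "\<rho> = \<eta>(0 := empty_site)"
    have \<rho>: "\<rho> \<in> Sigma_inf" "finite (particles \<rho>)" "\<rho> 0 = empty_site" "\<rho> (0 + ?e) = empty_site"
      using \<eta> fin True by (simp_all add: \<rho>_def particles_upd_empty del: fun_upd_apply, simp_all)
    have u: "\<rho>(0 := \<eta> 0) = \<eta>" "\<rho>(?e := \<eta> 0) = exch 0 ?e \<eta>"
      using True by (auto simp: \<rho>_def exch_def fun_eq_iff)
    have "bond i 0 \<eta> = potential (exch 0 ?e \<eta>) - potential \<eta>"
      using bond_eq_potential_difference[OF \<rho> Sigma_inf_site[OF \<eta>, of 0] _ i] True by (simp add: u)
    moreover have "potential \<eta> = trans_sum X removal \<eta>"
      by (rule potential_trans_sum[OF \<eta> X]) (auto simp: X_def)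
    moreover have "potential (exch 0 ?e \<eta>) = trans_sum X removal (exch 0 ?e \<eta>)"
      by (rule potential_trans_sum[OF _ X]) (use \<eta> in \<open>auto simp: X_def exch_alt\<close>)
    ultimately show ?thesis unfolding n b using True \<eta> by (simp add: occ_Sigma)
  next
    case False
    then have z: "occ \<eta> 0 * (1 - occ \<eta> ?e) = 0" using \<eta> by (auto simp: occ_Sigma)
    have "bond i 0 \<eta> = occ \<eta> 0 * (1 - occ \<eta> ?e) * bond i 0 \<eta>"
      using bond_support[OF \<eta>, of i 0] by simp
    then show ?thesis unfolding n b z by simp
  qed
qed

text \<open>The contribution is built from the germ by motions and truncations that only depend on the
  positions of the particles.\<close>

lemma removal_T_omega:
  assumes w: "C2_circle \<omega>" and u: "component 2 u \<in> T_omega \<omega>"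
  shows "removal \<in> T_omega \<omega>"
proof -
  have eq: "removal = (\<lambda>\<eta>. - (\<Sum>k<Suc R. bond 2 (ray 2 0 k)
     (pull (\<lambda>y. if y = ray 2 0 k then Some 0 else if precedes y 0 then Some y else None) \<eta>)))"
    unfolding removal_def lift_def
    by (rule ext, rule arg_cong[where f = uminus], rule sum.cong[OF refl],
        rule arg_cong[where f = "bond 2 _"]) (auto simp: fun_eq_iff below_def pull_def)
  show ?thesis unfolding eq bond_def
    by (intro T_omega_minus T_omega_sum T_omega_pull[OF w] T_omega_translate[OF w] u) simp
qed

end

section \<open>Square-integrable germs\<close>

lemma space_mu' [simp]: "space (mu \<alpha>) = Sigma_inf"
  by (rule space_mu)

lemma measurable_mu_cong:
  "(\<And>\<eta>. \<eta> \<in> Sigma_inf \<Longrightarrow> f \<eta> = g \<eta>) \<Longrightarrow> f \<in> borel_measurable (mu \<alpha>) \<longleftrightarrow> g \<in> borel_measurable (mu \<alpha>)"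
  by (rule measurable_cong) simp

lemma measurable_site: "(\<lambda>\<eta>. \<eta> x) \<in> measurable (mu \<alpha>) (site_law \<alpha>)"
  unfolding mu_def by (rule measurable_component_singleton) simp

lemma measurable_relabel: "(\<lambda>\<eta> x. \<eta> (\<pi> x)) \<in> measurable (mu \<alpha>) (mu \<alpha>)"
proof -
  have "(\<lambda>\<eta> x. \<eta> (\<pi> x)) \<in> measurable (mu \<alpha>) (PiM UNIV (\<lambda>_. site_law \<alpha>))"
    by (rule measurable_PiM_single') (auto simp: measurable_site Sigma_inf_site)
  then show ?thesis by (simp add: mu_def)
qed

lemma mu_relabel:
  assumes "\<alpha> \<in> M1_circle" "inj \<pi>"
  shows "distr (mu \<alpha>) (mu \<alpha>) (\<lambda>\<eta> x. \<eta> (\<pi> x)) = mu \<alpha>"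
  using distr_PiM_reindex[of UNIV "\<lambda>_. site_law \<alpha>" \<pi> UNIV] assms
  by (simp add: mu_def prob_space_site_law restrict_def)

lemma integral_relabel:
  fixes f :: "config \<Rightarrow> real"
  assumes "\<alpha> \<in> M1_circle" "inj \<pi>" "f \<in> borel_measurable (mu \<alpha>)"
  shows "(\<integral>\<eta>. f (\<lambda>x. \<eta> (\<pi> x)) \<partial>mu \<alpha>) = (\<integral>\<eta>. f \<eta> \<partial>mu \<alpha>)"
  using integral_distr[OF measurable_relabel assms(3), of \<pi>] mu_relabel[OF assms(1,2)] by simp

lemma measurable_comp_relabel:
  "f \<in> borel_measurable (mu \<alpha>) \<Longrightarrow> (\<lambda>\<eta>. f (\<lambda>x. \<eta> (\<pi> x))) \<in> borel_measurable (mu \<alpha>)"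
  by (rule measurable_compose[OF measurable_relabel])

lemma L2_relabel:
  assumes "\<alpha> \<in> M1_circle" "inj \<pi>" "f \<in> L2 \<alpha>"
  shows "(\<lambda>\<eta>. f (\<lambda>x. \<eta> (\<pi> x))) \<in> L2 \<alpha>"
proof -
  have f: "f \<in> borel_measurable (mu \<alpha>)" "integrable (mu \<alpha>) (\<lambda>\<eta>. (f \<eta>)\<^sup>2)"
    using assms by (auto simp: L2_def)
  then have "integrable (mu \<alpha>) (\<lambda>\<eta>. (f (\<lambda>x. \<eta> (\<pi> x)))\<^sup>2)"
    using integrable_distr_eq[OF measurable_relabel, of "\<lambda>\<eta>. (f \<eta>)\<^sup>2" \<alpha> \<pi>] mu_relabel[OF assms(1,2)] by simp
  then show ?thesis using measurable_comp_relabel[OF f(1)] by (simp add: L2_def)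
qed

definition bounded_observables :: "param \<Rightarrow> (config \<Rightarrow> real) set" where
  "bounded_observables \<alpha> = {f \<in> borel_measurable (mu \<alpha>). \<exists>M. \<forall>\<eta>\<in>Sigma_inf. \<bar>f \<eta>\<bar> \<le> M}"

lemma bounded_observablesI:
  "f \<in> borel_measurable (mu \<alpha>) \<Longrightarrow> (\<And>\<eta>. \<eta> \<in> Sigma_inf \<Longrightarrow> \<bar>f \<eta>\<bar> \<le> M) \<Longrightarrow> f \<in> bounded_observables \<alpha>"
  by (auto simp: bounded_observables_def)

lemma bounded_observables_cong:
  assumes "g \<in> bounded_observables \<alpha>" "\<And>\<eta>. \<eta> \<in> Sigma_inf \<Longrightarrow> f \<eta> = g \<eta>"
  shows "f \<in> bounded_observables \<alpha>"
  using assms measurable_mu_cong[of f g \<alpha>] by (auto simp: bounded_observables_def)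

lemma bounded_observables_const [simp]: "(\<lambda>\<eta>. c) \<in> bounded_observables \<alpha>"
  by (rule bounded_observablesI[of _ _ "\<bar>c\<bar>"]) simp_all

lemma bounded_observables_add:
  assumes "f \<in> bounded_observables \<alpha>" "g \<in> bounded_observables \<alpha>"
  shows "(\<lambda>\<eta>. f \<eta> + g \<eta>) \<in> bounded_observables \<alpha>"
proof -
  from assms obtain M M' where M: "\<And>\<eta>. \<eta> \<in> Sigma_inf \<Longrightarrow> \<bar>f \<eta>\<bar> \<le> M" "\<And>\<eta>. \<eta> \<in> Sigma_inf \<Longrightarrow> \<bar>g \<eta>\<bar> \<le> M'"
    and f: "f \<in> borel_measurable (mu \<alpha>)" "g \<in> borel_measurable (mu \<alpha>)"
    by (auto simp: bounded_observables_def)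
  show ?thesis
  proof (rule bounded_observablesI[of _ _ "M + M'"])
    show "\<bar>f \<eta> + g \<eta>\<bar> \<le> M + M'" if "\<eta> \<in> Sigma_inf" for \<eta> using M[OF that] by linarith
  qed (use f in simp)
qed

lemma bounded_observables_mult:
  assumes "f \<in> bounded_observables \<alpha>" "g \<in> bounded_observables \<alpha>"
  shows "(\<lambda>\<eta>. f \<eta> * g \<eta>) \<in> bounded_observables \<alpha>"
proof -
  from assms obtain M M' where M: "\<And>\<eta>. \<eta> \<in> Sigma_inf \<Longrightarrow> \<bar>f \<eta>\<bar> \<le> M" "\<And>\<eta>. \<eta> \<in> Sigma_inf \<Longrightarrow> \<bar>g \<eta>\<bar> \<le> M'"
    and f: "f \<in> borel_measurable (mu \<alpha>)" "g \<in> borel_measurable (mu \<alpha>)"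
    by (auto simp: bounded_observables_def)
  show ?thesis
  proof (rule bounded_observablesI[of _ _ "M * M'"])
    show "\<bar>f \<eta> * g \<eta>\<bar> \<le> M * M'" if "\<eta> \<in> Sigma_inf" for \<eta>
      unfolding abs_mult using M[OF that] by (intro mult_mono) auto
  qed (use f in simp)
qed

lemma bounded_observables_diff:
  assumes "f \<in> bounded_observables \<alpha>" "g \<in> bounded_observables \<alpha>"
  shows "(\<lambda>\<eta>. f \<eta> - g \<eta>) \<in> bounded_observables \<alpha>"
  using bounded_observables_add[OF assms(1) bounded_observables_mult[OF bounded_observables_const[of "-1"] assms(2)]]
  by simp

lemma bounded_observables_sum:
  "finite I \<Longrightarrow> (\<And>i. i \<in> I \<Longrightarrow> f i \<in> bounded_observables \<alpha>) \<Longrightarrow> (\<lambda>\<eta>. \<Sum>i\<in>I. f i \<eta>) \<in> bounded_observables \<alpha>"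
  by (induction I rule: finite_induct) (auto intro: bounded_observables_add)

lemma bounded_observables_prod:
  "finite I \<Longrightarrow> (\<And>i. i \<in> I \<Longrightarrow> f i \<in> bounded_observables \<alpha>) \<Longrightarrow> (\<lambda>\<eta>. \<Prod>i\<in>I. f i \<eta>) \<in> bounded_observables \<alpha>"
  by (induction I rule: finite_induct) (auto intro: bounded_observables_mult)

lemma bounded_observables_relabel:
  assumes "f \<in> bounded_observables \<alpha>"
  shows "(\<lambda>\<eta>. f (\<lambda>x. \<eta> (\<pi> x))) \<in> bounded_observables \<alpha>"
proof -
  from assms obtain M where M: "\<And>\<eta>. \<eta> \<in> Sigma_inf \<Longrightarrow> \<bar>f \<eta>\<bar> \<le> M" "f \<in> borel_measurable (mu \<alpha>)"
    by (auto simp: bounded_observables_def)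
  show ?thesis
    by (rule bounded_observablesI[OF measurable_comp_relabel[OF M(2)]]) (rule M(1)[OF Sigma_inf_comp])
qed

lemma bounded_observables_translate:
  "f \<in> bounded_observables \<alpha> \<Longrightarrow> translate x f \<in> bounded_observables \<alpha>"
  using bounded_observables_relabel[of f \<alpha> "\<lambda>y. x + y"] by (simp add: translate_def[abs_def])

lemma bounded_observables_integrable:
  assumes "\<alpha> \<in> M1_circle" "f \<in> bounded_observables \<alpha>" shows "integrable (mu \<alpha>) f"
proof -
  interpret prob_space "mu \<alpha>" by (rule prob_space_mu[OF assms(1)])
  from assms obtain M where "\<And>\<eta>. \<eta> \<in> Sigma_inf \<Longrightarrow> \<bar>f \<eta>\<bar> \<le> M" "f \<in> borel_measurable (mu \<alpha>)"
    by (auto simp: bounded_observables_def)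
  then show ?thesis by (intro integrable_const_bound[of _ M] AE_I2) simp_all
qed

lemma bounded_observables_L2:
  assumes "\<alpha> \<in> M1_circle" "f \<in> bounded_observables \<alpha>" shows "f \<in> L2 \<alpha>"
  using bounded_observables_integrable[OF assms(1) bounded_observables_mult[OF assms(2,2)]] assms(2)
  by (simp add: L2_def power2_eq_square bounded_observables_def)

lemma borel_measurable_charge:
  assumes w: "C2_circle \<omega>" and v: "v \<in> charges \<omega>"
  shows "v \<in> borel_measurable (site_law \<alpha>)"
proof -
  from v obtain a b c d where v': "v = (\<lambda>s. (a + c * \<omega> (snd s)) * real (fst (fst s))
        + (b + d * \<omega> (snd s)) * real (snd (fst s)))" unfolding charges_def by blast
  from w have c: "continuous_on UNIV (\<lambda>s. \<omega> (s rmod (2 * pi)))"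
    unfolding C2_circle_def by (auto intro: DERIV_continuous_on)
  have c2: "continuous_on UNIV (\<lambda>s::site_state. \<omega> (snd s rmod (2 * pi)))"
    by (rule continuous_on_compose2[OF c]) (auto intro: continuous_intros)
  define V where "V = (\<lambda>s::site_state. (a + c * \<omega> (snd s rmod (2 * pi))) * real (fst (fst s))
        + (b + d * \<omega> (snd s rmod (2 * pi))) * real (snd (fst s)))"
  have "continuous_on UNIV V"
    unfolding V_def by (intro continuous_intros c2)
  then have "V \<in> borel_measurable (restrict_space borel site_states)"
    by (intro measurable_restrict_space1 borel_measurable_continuous_onI)
  then have "V \<in> borel_measurable (site_law \<alpha>)" by (simp cong: measurable_cong_sets)
  then show ?thesis
  proof (rule measurable_cong[THEN iffD1, rotated])
    fix s assume "s \<in> space (site_law \<alpha>)"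
    then have "snd s rmod (2 * pi) = snd s"
      by (intro rmod_idem) (auto simp: site_states_def circle_def)
    then show "V s = v s" by (simp add: V_def v')
  qed
qed

lemma charge_bounded:
  assumes w: "C2_circle \<omega>" and v: "v \<in> charges \<omega>"
  shows "\<exists>M. \<forall>s\<in>site_states. \<bar>v s\<bar> \<le> M"
proof -
  from v obtain a b c d where v': "v = (\<lambda>s. (a + c * \<omega> (snd s)) * real (fst (fst s))
        + (b + d * \<omega> (snd s)) * real (snd (fst s)))" unfolding charges_def by blast
  from w have "continuous_on UNIV (\<lambda>s. \<omega> (s rmod (2 * pi)))"
    unfolding C2_circle_def by (auto intro: DERIV_continuous_on)
  then have "continuous_on {0..2 * pi} (\<lambda>s. \<omega> (s rmod (2 * pi)))" by (rule continuous_on_subset) simp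
  then have "bounded ((\<lambda>s. \<omega> (s rmod (2 * pi))) ` {0..2 * pi})"
    by (intro compact_imp_bounded compact_continuous_image) simp_all
  then obtain B where "\<forall>t\<in>{0..2 * pi}. \<bar>\<omega> (t rmod (2 * pi))\<bar> \<le> B"
    unfolding bounded_iff by auto
  then have B: "\<And>t. t \<in> {0..2 * pi} \<Longrightarrow> \<bar>\<omega> (t rmod (2 * pi))\<bar> \<le> B" by blast
  have ca: "\<bar>a + c * \<omega> t\<bar> \<le> \<bar>a\<bar> + \<bar>c\<bar> * B" if "t \<in> circle" for a c t
  proof -
    have "t rmod (2 * pi) = t" using that by (intro rmod_idem) (auto simp: circle_def)
    then have "\<bar>\<omega> t\<bar> \<le> B" using B[of t] that by (simp add: circle_def)
    then have "\<bar>c * \<omega> t\<bar> \<le> \<bar>c\<bar> * B" unfolding abs_mult by (intro mult_left_mono) auto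
    then show ?thesis by linarith
  qed
  show ?thesis
  proof (intro exI ballI)
    fix s assume "s \<in> site_states"
    then have s: "snd s \<in> circle" "fst s = (1, 0) \<or> fst s = (0, 1) \<or> fst s = (0, 0)"
      by (auto simp: site_states_def)
    have "0 \<le> \<bar>a\<bar> + \<bar>c\<bar> * B" "0 \<le> \<bar>b\<bar> + \<bar>d\<bar> * B"
      using ca[OF s(1), of a c] ca[OF s(1), of b d] by linarith+
    then show "\<bar>v s\<bar> \<le> (\<bar>a\<bar> + \<bar>c\<bar> * B) + (\<bar>b\<bar> + \<bar>d\<bar> * B)"
      using s(2) ca[OF s(1), of a c] ca[OF s(1), of b d] by (elim disjE) (simp_all add: v')
  qed
qed

lemma bounded_observables_charge:
  assumes "C2_circle \<omega>" "v \<in> charges \<omega>"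
  shows "(\<lambda>\<eta>. v (\<eta> x)) \<in> bounded_observables \<alpha>"
proof -
  from charge_bounded[OF assms] obtain M where "\<forall>s\<in>site_states. \<bar>v s\<bar> \<le> M" by blast
  then show ?thesis
    by (intro bounded_observablesI[of _ _ M] measurable_compose[OF measurable_site borel_measurable_charge[OF assms]])
       (use Sigma_inf_site in blast)
qed

lemma occ_charge: "(\<lambda>s. real (fst (fst s)) + real (snd (fst s))) \<in> charges \<omega>"
  unfolding charges_def mem_Collect_eq
  by (rule exI[of _ 1], rule exI[of _ 1], rule exI[of _ 0], rule exI[of _ 0]) simp

lemma C2_circle_const: "C2_circle (\<lambda>_. c)"
  unfolding C2_circle_def by (rule exI[of _ "\<lambda>_. 0"], rule exI[of _ "\<lambda>_. 0"]) auto

lemma bounded_observables_occ: "(\<lambda>\<eta>. occ \<eta> x) \<in> bounded_observables \<alpha>"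
  using bounded_observables_charge[OF C2_circle_const occ_charge, of x \<alpha>] by (simp add: occ_alt)

text \<open>Expand the function over the finitely many occupation patterns of the sites on which it depends.\<close>

lemma bounded_observables_occ_local:
  assumes F: "occ_local F" shows "(\<lambda>\<eta>. F (occ \<eta>)) \<in> bounded_observables \<alpha>"
proof -
  from F obtain B where B: "finite B" "\<And>m m'. (\<forall>y\<in>B. m y = m' y) \<Longrightarrow> F m = F m'"
    unfolding occ_local_def by blast
  let ?g = "\<lambda>C \<eta>. F (\<lambda>y. of_bool (y \<in> C)) * (\<Prod>y\<in>B. if y \<in> C then occ \<eta> y else 1 - occ \<eta> y)"
  have "(\<lambda>\<eta>. \<Sum>C\<in>Pow B. ?g C \<eta>) \<in> bounded_observables \<alpha>"
  proof (intro bounded_observables_sum bounded_observables_mult bounded_observables_prod)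
    show "(\<lambda>\<eta>. if y \<in> C then occ \<eta> y else 1 - occ \<eta> y) \<in> bounded_observables \<alpha>" for y C
      using bounded_observables_occ bounded_observables_diff[OF bounded_observables_const bounded_observables_occ]
      by (cases "y \<in> C") auto
  qed (use B in auto)
  then show ?thesis
  proof (rule bounded_observables_cong)
    fix \<eta> assume \<eta>: "\<eta> \<in> Sigma_inf"
    let ?C = "{y \<in> B. \<eta> y \<noteq> empty_site}"
    have "(\<Sum>C\<in>Pow B. ?g C \<eta>) = (\<Sum>C\<in>{?C}. ?g C \<eta>)"
    proof (rule sum.mono_neutral_right)
      show "\<forall>C\<in>Pow B - {?C}. ?g C \<eta> = 0"
      proof
        fix C assume C: "C \<in> Pow B - {?C}"
        then obtain y where "y \<in> B" "y \<in> C \<longleftrightarrow> \<eta> y = empty_site" by auto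
        then have "\<exists>y\<in>B. (if y \<in> C then occ \<eta> y else 1 - occ \<eta> y) = 0"
          using \<eta> by (intro bexI[of _ y]) (auto simp: occ_Sigma)
        then have "(\<Prod>y\<in>B. if y \<in> C then occ \<eta> y else 1 - occ \<eta> y) = 0"
          using B(1) by (intro prod_zero) auto
        then show "?g C \<eta> = 0" by simp
      qed
    qed (use B in auto)
    also have "\<dots> = F (\<lambda>y. of_bool (y \<in> ?C))"
    proof -
      have "(\<Prod>y\<in>B. if y \<in> ?C then occ \<eta> y else 1 - occ \<eta> y) = 1"
        by (rule prod.neutral) (use \<eta> in \<open>auto simp: occ_Sigma\<close>)
      then show ?thesis by simp
    qed
    also have "\<dots> = F (occ \<eta>)" by (rule B(2)) (use \<eta> in \<open>auto simp: occ_Sigma\<close>)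
    finally show "F (occ \<eta>) = (\<Sum>C\<in>Pow B. ?g C \<eta>)" by simp
  qed
qed

lemma T_omega_bounded_observables:
  assumes w: "C2_circle \<omega>" and f: "f \<in> T_omega \<omega>" shows "f \<in> bounded_observables \<alpha>"
  using w f
proof (induction rule: T_omega_induct)
  case (add f g)
  then show ?case by (rule bounded_observables_add)
next
  case (cong f g)
  then show ?case by (rule bounded_observables_cong)
next
  case zero
  show ?case by simp
next
  case (charge v x F)
  then show ?case
    by (intro bounded_observables_mult bounded_observables_charge[OF w] bounded_observables_occ_local)
qed

text \<open>The sites are independent, hence so are blocks of sites without a common site.\<close>

lemma integral_mult_disjoint:
  assumes \<alpha>: "\<alpha> \<in> M1_circle" and f: "f \<in> bounded_observables \<alpha>" "depends_on f A"
    and g: "g \<in> bounded_observables \<alpha>" "depends_on g B" and AB: "A \<inter> B = {}"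
  shows "(\<integral>\<eta>. f \<eta> * g \<eta> \<partial>mu \<alpha>) = (\<integral>\<eta>. f \<eta> \<partial>mu \<alpha>) * (\<integral>\<eta>. g \<eta> \<partial>mu \<alpha>)"
proof -
  interpret prob_space "mu \<alpha>" by (rule prob_space_mu[OF \<alpha>])
  let ?S = "\<lambda>_::site. site_law \<alpha>"
  have "distr (mu \<alpha>) (site_law \<alpha>) (\<lambda>\<eta>. \<eta> i) = site_law \<alpha>" for i
    unfolding mu_def by (rule distr_PiM_component) (auto intro: prob_space_site_law \<alpha>)
  moreover have "distr (mu \<alpha>) (PiM UNIV ?S) (\<lambda>x. \<lambda>i\<in>UNIV. x i) = mu \<alpha>"
    by (simp add: mu_def restrict_def)
  ultimately have ind: "indep_vars ?S (\<lambda>i \<eta>. \<eta> i) UNIV"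
    by (subst indep_vars_iff_distr_eq_PiM) (auto intro: measurable_site simp: mu_def)
  define ext where "ext P \<xi> = (\<lambda>x. if x \<in> P then \<xi> x else empty_site)" for P and \<xi> :: config
  have ext: "ext P \<in> measurable (PiM P ?S) (mu \<alpha>)" for P
  proof -
    have "(\<lambda>\<xi> x. if x \<in> P then \<xi> x else empty_site) \<in> measurable (PiM P ?S) (PiM UNIV ?S)"
    proof (rule measurable_PiM_single')
      show "(\<lambda>\<xi>. if x \<in> P then \<xi> x else empty_site) \<in> measurable (PiM P ?S) (site_law \<alpha>)" for x
        by (cases "x \<in> P") (auto intro!: measurable_component_singleton)
    qed (auto simp: space_PiM PiE_def Pi_def)
    then show ?thesis by (simp add: mu_def ext_def[abs_def])
  qed
  have ext_eq: "f (ext P (restrict (\<lambda>i. \<eta> i) P)) = f \<eta>" if "depends_on f P" "\<eta> \<in> Sigma_inf" for f P \<eta>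
  proof -
    have "ext P (restrict (\<lambda>i. \<eta> i) P) = trunc P \<eta>" by (auto simp: ext_def trunc_apply fun_eq_iff)
    then show ?thesis using depends_on_trunc[OF that(1) _ that(2), of P] by simp
  qed
  have m: "f \<in> borel_measurable (mu \<alpha>)" "g \<in> borel_measurable (mu \<alpha>)"
    using f g by (auto simp: bounded_observables_def)
  have "indep_var (PiM A ?S) (\<lambda>\<eta>. restrict (\<lambda>i. \<eta> i) A) (PiM B ?S) (\<lambda>\<eta>. restrict (\<lambda>i. \<eta> i) B)"
    by (rule indep_var_restrict[OF ind AB]) simp_all
  from indep_var_compose[OF this measurable_compose[OF ext m(1)] measurable_compose[OF ext m(2)]]
  have iv: "indep_var borel (\<lambda>\<eta>. f (ext A (restrict (\<lambda>i. \<eta> i) A))) borel (\<lambda>\<eta>. g (ext B (restrict (\<lambda>i. \<eta> i) B)))"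
    by (simp add: comp_def)
  have e: "integrable (mu \<alpha>) (\<lambda>\<eta>. h (ext P (restrict (\<lambda>i. \<eta> i) P))) \<longleftrightarrow> integrable (mu \<alpha>) h"
    "(\<integral>\<eta>. h (ext P (restrict (\<lambda>i. \<eta> i) P)) \<partial>mu \<alpha>) = (\<integral>\<eta>. h \<eta> \<partial>mu \<alpha>)"
    if "depends_on h P" for h P
    by (rule Bochner_Integration.integrable_cong, simp_all add: ext_eq[OF that])
       (rule Bochner_Integration.integral_cong, simp_all add: ext_eq[OF that])
  have "(\<integral>\<eta>. f \<eta> * g \<eta> \<partial>mu \<alpha>)
    = (\<integral>\<eta>. f (ext A (restrict (\<lambda>i. \<eta> i) A)) * g (ext B (restrict (\<lambda>i. \<eta> i) B)) \<partial>mu \<alpha>)"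
    by (rule Bochner_Integration.integral_cong) (simp_all add: ext_eq f g)
  also have "\<dots> = (\<integral>\<eta>. f (ext A (restrict (\<lambda>i. \<eta> i) A)) \<partial>mu \<alpha>) * (\<integral>\<eta>. g (ext B (restrict (\<lambda>i. \<eta> i) B)) \<partial>mu \<alpha>)"
    by (rule indep_var_lebesgue_integral[OF iv])
       (simp_all add: e f g bounded_observables_integrable[OF \<alpha>])
  finally show ?thesis by (simp add: e f g)
qed

lemma L2_add:
  assumes "f \<in> L2 \<alpha>" "g \<in> L2 \<alpha>" shows "(\<lambda>\<eta>. f \<eta> + g \<eta>) \<in> L2 \<alpha>"
proof -
  have m: "f \<in> borel_measurable (mu \<alpha>)" "g \<in> borel_measurable (mu \<alpha>)"
    and i: "integrable (mu \<alpha>) (\<lambda>\<eta>. (f \<eta>)\<^sup>2)" "integrable (mu \<alpha>) (\<lambda>\<eta>. (g \<eta>)\<^sup>2)"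
    using assms by (auto simp: L2_def)
  have "integrable (mu \<alpha>) (\<lambda>\<eta>. (f \<eta> + g \<eta>)\<^sup>2)"
  proof (rule Bochner_Integration.integrable_bound)
    show "integrable (mu \<alpha>) (\<lambda>\<eta>. 2 * (f \<eta>)\<^sup>2 + 2 * (g \<eta>)\<^sup>2)" using i by simp
    have "(a + b)\<^sup>2 \<le> 2 * a\<^sup>2 + 2 * b\<^sup>2" for a b :: real
      using sum_squares_ge_zero[of "a - b" 0] by (simp add: power2_eq_square algebra_simps)
    then show "AE \<eta> in mu \<alpha>. norm ((f \<eta> + g \<eta>)\<^sup>2) \<le> norm (2 * (f \<eta>)\<^sup>2 + 2 * (g \<eta>)\<^sup>2)" by simp
  qed (use m in simp)
  then show ?thesis using m by (simp add: L2_def)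
qed

lemma L2_scale: "f \<in> L2 \<alpha> \<Longrightarrow> (\<lambda>\<eta>. c * f \<eta>) \<in> L2 \<alpha>"
  by (auto simp: L2_def power_mult_distrib)

abbreviation L2_germs :: "param \<Rightarrow> germ set" where
  "L2_germs \<alpha> \<equiv> L2 \<alpha> \<times> L2 \<alpha>"

lemma subspace_L2_germs: "subspace (L2_germs \<alpha>)"
proof (rule subspaceI)
  show "0 \<in> L2_germs \<alpha>"
    unfolding mem_Times_iff by (simp add: L2_def zero_fun_def)
next
  fix u v assume "u \<in> L2_germs \<alpha>" "v \<in> L2_germs \<alpha>"
  then show "u + v \<in> L2_germs \<alpha>"
    unfolding mem_Times_iff by (simp add: L2_add plus_fun_def)
next
  fix c u assume "u \<in> L2_germs \<alpha>"
  then show "c *\<^sub>R u \<in> L2_germs \<alpha>"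
    unfolding mem_Times_iff by (simp add: L2_scale scaleR_fun_def)
qed

lemma L2_germs_integrable:
  "u \<in> L2_germs \<alpha> \<Longrightarrow> integrable (mu \<alpha>) (\<lambda>\<eta>. (fst u \<eta>)\<^sup>2 + (snd u \<eta>)\<^sup>2)"
  by (auto simp: L2_def)

lemma germ_norm_nonneg [simp]: "0 \<le> germ_norm \<alpha> u"
  by (simp add: germ_norm_def)

text \<open>Up to the constant, this is the triangle inequality; it follows from
  \<open>(a + b)\<^sup>2 \<le> 2 a\<^sup>2 + 2 b\<^sup>2\<close> and suffices for all closure arguments.\<close>

lemma germ_norm_quasi_triangle:
  assumes "u \<in> L2_germs \<alpha>" "v \<in> L2_germs \<alpha>"
  shows "germ_norm \<alpha> (u + v) \<le> 2 * (germ_norm \<alpha> u + germ_norm \<alpha> v)"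
proof -
  let ?I = "\<lambda>u. \<integral>\<eta>. (fst u \<eta>)\<^sup>2 + (snd u \<eta>)\<^sup>2 \<partial>mu \<alpha>"
  have sq: "(a + b)\<^sup>2 \<le> 2 * a\<^sup>2 + 2 * b\<^sup>2" for a b :: real
    using sum_squares_ge_zero[of "a - b" 0] by (simp add: power2_eq_square algebra_simps)
  have p: "(fst (u + v) \<eta>)\<^sup>2 + (snd (u + v) \<eta>)\<^sup>2
      \<le> 2 * ((fst u \<eta>)\<^sup>2 + (snd u \<eta>)\<^sup>2) + 2 * ((fst v \<eta>)\<^sup>2 + (snd v \<eta>)\<^sup>2)" for \<eta>
    using sq[of "fst u \<eta>" "fst v \<eta>"] sq[of "snd u \<eta>" "snd v \<eta>"] by (simp add: algebra_simps)
  have "?I (u + v) \<le> (\<integral>\<eta>. 2 * ((fst u \<eta>)\<^sup>2 + (snd u \<eta>)\<^sup>2) + 2 * ((fst v \<eta>)\<^sup>2 + (snd v \<eta>)\<^sup>2) \<partial>mu \<alpha>)"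
    by (intro integral_mono p L2_germs_integrable subspace_add[OF subspace_L2_germs] assms
        Bochner_Integration.integrable_add integrable_mult_right)
  also have "\<dots> = 2 * ?I u + 2 * ?I v"
    by (simp only: Bochner_Integration.integral_add[OF integrable_mult_right[OF L2_germs_integrable[OF assms(1)]]
          integrable_mult_right[OF L2_germs_integrable[OF assms(2)]]] integral_mult_right_zero)
  finally have le: "?I (u + v) \<le> 2 * ?I u + 2 * ?I v" .
  have nn: "0 \<le> ?I u" "0 \<le> ?I v" by simp_all
  have "?I (u + v) \<le> (2 * (sqrt (?I u) + sqrt (?I v)))\<^sup>2"
  proof -
    have "(2 * (sqrt (?I u) + sqrt (?I v)))\<^sup>2 = 4 * ?I u + 4 * ?I v + 8 * (sqrt (?I u) * sqrt (?I v))"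
      using nn by (simp add: power_mult_distrib power2_sum algebra_simps)
    moreover have "0 \<le> sqrt (?I u) * sqrt (?I v)" using nn by simp
    ultimately show ?thesis using le nn by linarith
  qed
  then show ?thesis unfolding germ_norm_def
    by (intro real_le_lsqrt) (use nn in simp_all)
qed

lemma germ_norm_scale: "germ_norm \<alpha> (c *\<^sub>R u) = \<bar>c\<bar> * germ_norm \<alpha> u"
proof -
  have "(\<lambda>\<eta>. (fst (c *\<^sub>R u) \<eta>)\<^sup>2 + (snd (c *\<^sub>R u) \<eta>)\<^sup>2) = (\<lambda>\<eta>. c\<^sup>2 * ((fst u \<eta>)\<^sup>2 + (snd u \<eta>)\<^sup>2))"
    by (simp add: scaleR_fun_def power_mult_distrib algebra_simps fun_eq_iff)
  then show ?thesis by (simp add: germ_norm_def real_sqrt_mult)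
qed

lemma germ_norm_bound:
  assumes \<alpha>: "\<alpha> \<in> M1_circle" and "\<And>\<eta>. \<eta> \<in> Sigma_inf \<Longrightarrow> \<bar>fst u \<eta>\<bar> \<le> b" "\<And>\<eta>. \<eta> \<in> Sigma_inf \<Longrightarrow> \<bar>snd u \<eta>\<bar> \<le> b"
    and u: "u \<in> L2_germs \<alpha>"
  shows "germ_norm \<alpha> u \<le> 2 * b"
proof -
  interpret prob_space "mu \<alpha>" by (rule prob_space_mu[OF \<alpha>])
  have "(\<lambda>_. empty_site) \<in> Sigma_inf" by (rule Sigma_infI) simp
  then have b: "0 \<le> b" using assms(2) abs_ge_zero order_trans by blast
  have "(\<integral>\<eta>. (fst u \<eta>)\<^sup>2 + (snd u \<eta>)\<^sup>2 \<partial>mu \<alpha>) \<le> (\<integral>\<eta>. 4 * b\<^sup>2 \<partial>mu \<alpha>)"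
  proof (intro integral_mono L2_germs_integrable[OF u] integrable_const)
    fix \<eta> assume "\<eta> \<in> space (mu \<alpha>)"
    then have "(fst u \<eta>)\<^sup>2 \<le> b\<^sup>2" "(snd u \<eta>)\<^sup>2 \<le> b\<^sup>2"
      using assms(2,3)[of \<eta>] b abs_le_square_iff[of "fst u \<eta>" b] abs_le_square_iff[of "snd u \<eta>" b] by simp_all
    then show "(fst u \<eta>)\<^sup>2 + (snd u \<eta>)\<^sup>2 \<le> 4 * b\<^sup>2" using zero_le_power2[of b] by linarith
  qed
  also have "\<dots> = (2 * b)\<^sup>2" using prob_space by (simp add: power_mult_distrib)
  finally show ?thesis unfolding germ_norm_def using b by (intro real_le_lsqrt) simp_all
qed

text \<open>By Jensen's inequality, pairing with a bounded observable is continuous in mean square.\<close>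

lemma abs_integral_mult_le:
  assumes \<alpha>: "\<alpha> \<in> M1_circle" and f: "f \<in> L2 \<alpha>" and g: "g \<in> borel_measurable (mu \<alpha>)"
    and M: "\<And>\<eta>. \<eta> \<in> Sigma_inf \<Longrightarrow> \<bar>g \<eta>\<bar> \<le> M"
  shows "integrable (mu \<alpha>) (\<lambda>\<eta>. g \<eta> * f \<eta>)"
    "\<bar>\<integral>\<eta>. g \<eta> * f \<eta> \<partial>mu \<alpha>\<bar> \<le> M * sqrt (\<integral>\<eta>. (f \<eta>)\<^sup>2 \<partial>mu \<alpha>)"
proof -
  interpret prob_space "mu \<alpha>" by (rule prob_space_mu[OF \<alpha>])
  have mf: "f \<in> borel_measurable (mu \<alpha>)" and sq: "integrable (mu \<alpha>) (\<lambda>\<eta>. (f \<eta>)\<^sup>2)"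
    using f by (auto simp: L2_def)
  have "(\<lambda>_. empty_site) \<in> Sigma_inf" by (rule Sigma_infI) simp
  then have M0: "0 \<le> M" using M abs_ge_zero order_trans by blast
  have fi: "integrable (mu \<alpha>) f" by (rule square_integrable_imp_integrable[OF mf sq])
  then have ai: "integrable (mu \<alpha>) (\<lambda>\<eta>. \<bar>f \<eta>\<bar>)" by simp
  have pt: "\<bar>g \<eta> * f \<eta>\<bar> \<le> M * \<bar>f \<eta>\<bar>" if "\<eta> \<in> Sigma_inf" for \<eta>
    unfolding abs_mult using M[OF that] by (intro mult_right_mono) auto
  show gi: "integrable (mu \<alpha>) (\<lambda>\<eta>. g \<eta> * f \<eta>)"
  proof (rule Bochner_Integration.integrable_bound)
    show "integrable (mu \<alpha>) (\<lambda>\<eta>. M * \<bar>f \<eta>\<bar>)" using ai by simp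
    show "AE \<eta> in mu \<alpha>. norm (g \<eta> * f \<eta>) \<le> norm (M * \<bar>f \<eta>\<bar>)"
      by (rule AE_I2) (use pt M0 in \<open>simp add: abs_mult\<close>)
  qed (use g mf in simp)
  have "\<bar>\<integral>\<eta>. g \<eta> * f \<eta> \<partial>mu \<alpha>\<bar> \<le> (\<integral>\<eta>. \<bar>g \<eta> * f \<eta>\<bar> \<partial>mu \<alpha>)" by (rule integral_abs_bound)
  also have "\<dots> \<le> (\<integral>\<eta>. M * \<bar>f \<eta>\<bar> \<partial>mu \<alpha>)"
    by (rule integral_mono) (use gi ai pt in auto)
  also have "\<dots> = M * (\<integral>\<eta>. \<bar>f \<eta>\<bar> \<partial>mu \<alpha>)" by simp
  also have "\<dots> \<le> M * sqrt (\<integral>\<eta>. (f \<eta>)\<^sup>2 \<partial>mu \<alpha>)"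
  proof (rule mult_left_mono[OF real_le_rsqrt M0])
    have "0 \<le> variance (\<lambda>\<eta>. \<bar>f \<eta>\<bar>)" by (rule variance_positive)
    also have "\<dots> = expectation (\<lambda>\<eta>. \<bar>f \<eta>\<bar>\<^sup>2) - (expectation (\<lambda>\<eta>. \<bar>f \<eta>\<bar>))\<^sup>2"
      by (rule variance_eq) (use ai sq in simp_all)
    finally show "(\<integral>\<eta>. \<bar>f \<eta>\<bar> \<partial>mu \<alpha>)\<^sup>2 \<le> (\<integral>\<eta>. (f \<eta>)\<^sup>2 \<partial>mu \<alpha>)" by simp
  qed
  finally show "\<bar>\<integral>\<eta>. g \<eta> * f \<eta> \<partial>mu \<alpha>\<bar> \<le> M * sqrt (\<integral>\<eta>. (f \<eta>)\<^sup>2 \<partial>mu \<alpha>)" .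
qed

section \<open>Closed germs form a space\<close>

text \<open>Every entry of the form is a component of the germ, up to sign, read off after a relabelling of the
  sites that preserves the measure.\<close>

lemma form_of_germ_L2:
  assumes \<alpha>: "\<alpha> \<in> M1_circle" and u: "u \<in> L2_germs \<alpha>" and z: "unit_step z"
  shows "form_of_germ u x (x + z) \<in> L2 \<alpha>"
    "(\<integral>\<eta>. (form_of_germ u x (x + z) \<eta>)\<^sup>2 \<partial>mu \<alpha>) \<le> (germ_norm \<alpha> u)\<^sup>2"
proof -
  have c: "component i u \<in> L2 \<alpha>" for i using u by (auto simp: component_def)
  have n: "(\<integral>\<eta>. (component i u \<eta>)\<^sup>2 \<partial>mu \<alpha>) \<le> (germ_norm \<alpha> u)\<^sup>2" for i
  proof -
    have "(\<integral>\<eta>. (component i u \<eta>)\<^sup>2 \<partial>mu \<alpha>) \<le> (\<integral>\<eta>. (fst u \<eta>)\<^sup>2 + (snd u \<eta>)\<^sup>2 \<partial>mu \<alpha>)"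
      by (rule integral_mono) (use c[of i] L2_germs_integrable[OF u] in \<open>auto simp: L2_def component_def\<close>)
    then show ?thesis by (simp add: germ_norm_def)
  qed
  have relabel: "(\<lambda>\<eta>. component i u (\<lambda>y. \<eta> (\<pi> y))) \<in> L2 \<alpha> \<and>
     (\<integral>\<eta>. (component i u (\<lambda>y. \<eta> (\<pi> y)))\<^sup>2 \<partial>mu \<alpha>) \<le> (germ_norm \<alpha> u)\<^sup>2" if "inj \<pi>" for i \<pi>
  proof -
    have "(\<lambda>\<eta>. (component i u \<eta>)\<^sup>2) \<in> borel_measurable (mu \<alpha>)"
      using c[of i] by (intro borel_measurable_power) (simp add: L2_def)
    from integral_relabel[OF \<alpha> that this] show ?thesis
      using L2_relabel[OF \<alpha> that c[of i]] n[of i] by simp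
  qed
  have "form_of_germ u x (x + z) \<in> L2 \<alpha> \<and>
    (\<integral>\<eta>. (form_of_germ u x (x + z) \<eta>)\<^sup>2 \<partial>mu \<alpha>) \<le> (germ_norm \<alpha> u)\<^sup>2"
  proof -
    have p: ?thesis if "z = evec i" for i
      using relabel[of "\<lambda>y. x + y" i] by (simp add: that form_of_germ_pos[abs_def] translate_def inj_def)
    have ng: ?thesis if z: "z = - evec i" for i
    proof -
      let ?\<pi> = "\<lambda>y. let w = x - evec i + y in if w = x - evec i then x else if w = x then x - evec i else w"
      have eq: "form_of_germ u x (x + z) = (\<lambda>\<eta>. - component i u (\<lambda>y. \<eta> (?\<pi> y)))"
      proof (rule ext)
        fix \<eta>
        have 1: "x + - evec i = x - evec i" by simp
        have 2: "(\<lambda>y. exch x (x - evec i) \<eta> (x - evec i + y)) = (\<lambda>y. \<eta> (?\<pi> y))"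
          by (rule ext) (auto simp: exch_alt Let_def)
        show "form_of_germ u x (x + z) \<eta> = - component i u (\<lambda>y. \<eta> (?\<pi> y))"
          unfolding z 1 form_of_germ_neg translate_def 2 ..
      qed
      have "inj ?\<pi>"
        by (rule injI) (auto simp: Let_def split: if_splits)
      from relabel[OF this, of i] L2_scale[of "\<lambda>\<eta>. component i u (\<lambda>y. \<eta> (?\<pi> y))" \<alpha> "-1"]
      show ?thesis unfolding eq by simp
    qed
    from z show ?thesis using p ng by (cases rule: unit_step_cases) blast+
  qed
  then show "form_of_germ u x (x + z) \<in> L2 \<alpha>"
    "(\<integral>\<eta>. (form_of_germ u x (x + z) \<eta>)\<^sup>2 \<partial>mu \<alpha>) \<le> (germ_norm \<alpha> u)\<^sup>2" by auto
qed

lemma closed_germ_if_local_potentials: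
  assumes \<alpha>: "\<alpha> \<in> M1_circle" and u: "u \<in> L2_germs \<alpha>"
    and S: "\<And>W. finite W \<Longrightarrow> \<exists>S. local_potential u W S"
  shows "closed_germ \<alpha> u"
  unfolding closed_germ_def
proof (intro conjI u closed_form_if_local_potentials S)
  show "differential_form \<alpha> (form_of_germ u)"
    unfolding differential_form_def
  proof (intro allI impI conjI ballI)
    fix x z \<eta> assume z: "unit_step z"
    show "form_of_germ u x (x + z) \<in> L2 \<alpha>" by (rule form_of_germ_L2[OF \<alpha> u z])
    assume \<eta>: "\<eta> \<in> Sigma_inf"
    from S[of "{x, x + z}"] obtain S where S: "local_potential u {x, x + z} S" by auto
    have "form_of_germ u x (x + z) \<eta>
       = occ \<eta> x * (1 - occ \<eta> (x + z)) * (S (exch x (x + z) \<eta>) - S \<eta>)"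
      by (rule local_potential_form[OF S \<eta> z]) simp_all
    then show "form_of_germ u x (x + z) \<eta> = occ \<eta> x * (1 - occ \<eta> (x + z)) * form_of_germ u x (x + z) \<eta>"
      using \<eta> by (auto simp: occ_Sigma)
  qed
qed

lemma closed_germ_add:
  assumes "closed_germ \<alpha> u" "closed_germ \<alpha> v" shows "closed_germ \<alpha> (u + v)"
  unfolding closed_germ_def closed_form_def differential_form_def
proof (intro conjI allI impI ballI)
  have u: "u \<in> L2_germs \<alpha>" "v \<in> L2_germs \<alpha>" using assms unfolding closed_germ_def by blast+
  show "u + v \<in> L2_germs \<alpha>" by (rule subspace_add[OF subspace_L2_germs u])
  fix x z assume z: "unit_step z"
  have d: "form_of_germ u x (x + z) \<in> L2 \<alpha>" "form_of_germ v x (x + z) \<in> L2 \<alpha>"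
    using assms z unfolding closed_germ_def closed_form_def differential_form_def by blast+
  show "form_of_germ (u + v) x (x + z) \<in> L2 \<alpha>"
    using L2_add[OF d] by (simp add: form_of_germ_plus[abs_def])
  fix \<eta> assume \<eta>: "\<eta> \<in> Sigma_inf"
  have e: "form_of_germ w x (x + z) \<eta> = occ \<eta> x * (1 - occ \<eta> (x + z)) * form_of_germ w x (x + z) \<eta>"
    if "closed_germ \<alpha> w" for w
    using that z \<eta> unfolding closed_germ_def closed_form_def differential_form_def by blast
  show "form_of_germ (u + v) x (x + z) \<eta> = occ \<eta> x * (1 - occ \<eta> (x + z)) * form_of_germ (u + v) x (x + z) \<eta>"
    unfolding form_of_germ_plus distrib_left by (simp only: e[OF assms(1), symmetric] e[OF assms(2), symmetric])
next
  fix \<eta> p assume "\<eta> \<in> Sigma_inf" "licit \<eta> p \<and> path_end \<eta> p = \<eta>"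
  then have "path_integral (form_of_germ u) \<eta> p = 0" "path_integral (form_of_germ v) \<eta> p = 0"
    using assms unfolding closed_germ_def closed_form_def by blast+
  then show "path_integral (form_of_germ (u + v)) \<eta> p = 0" by (simp add: path_integral_plus)
qed

lemma T_omega_germ_L2:
  assumes "\<alpha> \<in> M1_circle" "C2_circle \<omega>" "fst u \<in> T_omega \<omega>" "snd u \<in> T_omega \<omega>"
  shows "u \<in> L2_germs \<alpha>"
  using bounded_observables_L2[OF assms(1) T_omega_bounded_observables[OF assms(2)]] assms(3,4)
  by (simp add: mem_Times_iff)

lemma charge_current_T_omega:
  assumes w: "C2_circle \<omega>" and v: "v \<in> charges \<omega>" "v' \<in> charges \<omega>"
  shows "fst (charge_current v v') \<in> T_omega \<omega>" "snd (charge_current v v') \<in> T_omega \<omega>"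
proof -
  have "(\<lambda>\<eta>. v (\<eta> 0) * (1 - occ \<eta> y)) \<in> T_omega \<omega>" if "v \<in> charges \<omega>" for v y
    by (rule T_omega_charge_term[OF w that occ_local_site[of "\<lambda>r. 1 - r"]])
  with v show "fst (charge_current v v') \<in> T_omega \<omega>" "snd (charge_current v v') \<in> T_omega \<omega>"
    by (simp_all add: charge_current_def del: evec_simps)
qed

lemma closed_germ_charge_current:
  assumes "\<alpha> \<in> M1_circle" "C2_circle \<omega>" "v \<in> charges \<omega>" "v' \<in> charges \<omega>"
  shows "closed_germ \<alpha> (charge_current v v')"
  by (rule closed_germ_if_local_potentials[OF assms(1)
        T_omega_germ_L2[OF assms(1,2) charge_current_T_omega[OF assms(2-4)]]])
     (rule exI, erule charge_current_local_potential[OF assms(3,4)])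

section \<open>Closed subspaces and finite-dimensional extensions\<close>

lemma germ_norm_0 [simp]: "germ_norm \<alpha> 0 = 0"
  by (simp add: germ_norm_def zero_fun_def)

lemma germ_norm_commute: "germ_norm \<alpha> (u - v) = germ_norm \<alpha> (v - u)"
  using germ_norm_scale[of \<alpha> "-1" "v - u"] by simp

lemmas L2_germs_diff = subspace_diff[OF subspace_L2_germs]
  and L2_germs_add = subspace_add[OF subspace_L2_germs]
  and L2_germs_scale = subspace_scale[OF subspace_L2_germs]

lemma L2_closureI:
  assumes "u \<in> L2_germs \<alpha>" "\<And>\<epsilon>. 0 < \<epsilon> \<Longrightarrow> \<exists>v\<in>S. v \<in> L2_germs \<alpha> \<and> germ_norm \<alpha> (u - v) < \<epsilon>"
  shows "u \<in> L2_closure \<alpha> S"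
  unfolding L2_closure_def using assms by blast

lemma L2_closureD:
  assumes "u \<in> L2_closure \<alpha> S" "0 < \<epsilon>"
  obtains v where "v \<in> S" "v \<in> L2_germs \<alpha>" "germ_norm \<alpha> (u - v) < \<epsilon>"
  using assms unfolding L2_closure_def by blast

lemma L2_closure_L2: "L2_closure \<alpha> S \<subseteq> L2_germs \<alpha>"
  unfolding L2_closure_def by blast

lemma L2_closure_mono: "S \<subseteq> T \<Longrightarrow> L2_closure \<alpha> S \<subseteq> L2_closure \<alpha> T"
  unfolding L2_closure_def by blast

lemma L2_closure_superset:
  assumes "S \<subseteq> L2_germs \<alpha>" shows "S \<subseteq> L2_closure \<alpha> S"
proof
  fix u assume u: "u \<in> S"
  then show "u \<in> L2_closure \<alpha> S"
    by (intro L2_closureI bexI[OF _ u]) (use assms in auto)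
qed

text \<open>The fractions of \<open>\<epsilon>\<close> make up for the constant in the quasi-triangle inequality.\<close>

lemma L2_closure_idem: "L2_closure \<alpha> (L2_closure \<alpha> S) \<subseteq> L2_closure \<alpha> S"
proof
  fix u assume u: "u \<in> L2_closure \<alpha> (L2_closure \<alpha> S)"
  then have uL: "u \<in> L2_germs \<alpha>" using L2_closure_L2 by blast
  show "u \<in> L2_closure \<alpha> S"
  proof (rule L2_closureI[OF uL])
    fix \<epsilon> :: real assume e: "0 < \<epsilon>"
    obtain v where v: "v \<in> L2_closure \<alpha> S" "v \<in> L2_germs \<alpha>" "germ_norm \<alpha> (u - v) < \<epsilon> / 4"
      using L2_closureD[OF u, of "\<epsilon> / 4"] e by auto
    obtain w where w: "w \<in> S" "w \<in> L2_germs \<alpha>" "germ_norm \<alpha> (v - w) < \<epsilon> / 4"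
      using L2_closureD[OF v(1), of "\<epsilon> / 4"] e by auto
    have "germ_norm \<alpha> ((u - v) + (v - w)) \<le> 2 * (germ_norm \<alpha> (u - v) + germ_norm \<alpha> (v - w))"
      by (rule germ_norm_quasi_triangle) (use L2_germs_diff uL v w in blast)+
    then have "germ_norm \<alpha> (u - w) < \<epsilon>" using v(3) w(3) by simp
    then show "\<exists>v\<in>S. v \<in> L2_germs \<alpha> \<and> germ_norm \<alpha> (u - v) < \<epsilon>"
      by (intro bexI[OF _ w(1)] conjI w(2))
  qed
qed

lemma subspace_L2_closure:
  assumes S: "subspace S" shows "subspace (L2_closure \<alpha> S)"
proof (rule subspaceI)
  show "0 \<in> L2_closure \<alpha> S"
  proof (rule L2_closureI[OF subspace_0[OF subspace_L2_germs]])
    fix \<epsilon> :: real assume "0 < \<epsilon>"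
    then have "germ_norm \<alpha> (0 - 0) < \<epsilon>" unfolding diff_self germ_norm_0 .
    then show "\<exists>v\<in>S. v \<in> L2_germs \<alpha> \<and> germ_norm \<alpha> (0 - v) < \<epsilon>"
      using subspace_0[OF S] subspace_0[OF subspace_L2_germs] by blast
  qed
next
  fix u u' assume u: "u \<in> L2_closure \<alpha> S" and u': "u' \<in> L2_closure \<alpha> S"
  have uL: "u \<in> L2_germs \<alpha>" "u' \<in> L2_germs \<alpha>" using u u' L2_closure_L2 by blast+
  show "u + u' \<in> L2_closure \<alpha> S"
  proof (rule L2_closureI[OF L2_germs_add[OF uL]])
    fix \<epsilon> :: real assume e: "0 < \<epsilon>"
    obtain v where v: "v \<in> S" "v \<in> L2_germs \<alpha>" "germ_norm \<alpha> (u - v) < \<epsilon> / 4"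
      using L2_closureD[OF u, of "\<epsilon> / 4"] e by auto
    obtain w where w: "w \<in> S" "w \<in> L2_germs \<alpha>" "germ_norm \<alpha> (u' - w) < \<epsilon> / 4"
      using L2_closureD[OF u', of "\<epsilon> / 4"] e by auto
    have "germ_norm \<alpha> ((u - v) + (u' - w)) \<le> 2 * (germ_norm \<alpha> (u - v) + germ_norm \<alpha> (u' - w))"
      by (rule germ_norm_quasi_triangle) (use L2_germs_diff uL v w in blast)+
    moreover have "(u - v) + (u' - w) = (u + u') - (v + w)" by (simp add: algebra_simps)
    ultimately have "germ_norm \<alpha> ((u + u') - (v + w)) < \<epsilon>" using v(3) w(3) by simp
    then show "\<exists>v\<in>S. v \<in> L2_germs \<alpha> \<and> germ_norm \<alpha> ((u + u') - v) < \<epsilon>"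
      by (intro bexI[OF _ subspace_add[OF S v(1) w(1)]] conjI L2_germs_add[OF v(2) w(2)])
  qed
next
  fix c u assume u: "u \<in> L2_closure \<alpha> S"
  have uL: "u \<in> L2_germs \<alpha>" using u L2_closure_L2 by blast
  show "c *\<^sub>R u \<in> L2_closure \<alpha> S"
  proof (rule L2_closureI[OF L2_germs_scale[OF uL]])
    fix \<epsilon> :: real assume e: "0 < \<epsilon>"
    then have "0 < \<epsilon> / (\<bar>c\<bar> + 1)" by (intro divide_pos_pos) auto
    from L2_closureD[OF u this] obtain v where v: "v \<in> S" "v \<in> L2_germs \<alpha>"
      "germ_norm \<alpha> (u - v) < \<epsilon> / (\<bar>c\<bar> + 1)" by blast
    have "germ_norm \<alpha> (c *\<^sub>R u - c *\<^sub>R v) = \<bar>c\<bar> * germ_norm \<alpha> (u - v)"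
      unfolding scaleR_diff_right[symmetric] by (rule germ_norm_scale)
    also have "\<dots> \<le> (\<bar>c\<bar> + 1) * germ_norm \<alpha> (u - v)" by (intro mult_right_mono) auto
    also have "\<dots> < \<epsilon>" using v(3) by (simp add: field_simps add_pos_nonneg)
    finally show "\<exists>v\<in>S. v \<in> L2_germs \<alpha> \<and> germ_norm \<alpha> (c *\<^sub>R u - v) < \<epsilon>"
      by (intro bexI[OF _ subspace_scale[OF S v(1)]] conjI L2_germs_scale[OF v(2)])
  qed
qed

text \<open>If \<open>v\<close> is at positive distance from a closed subspace \<open>E\<close>, the coefficient of \<open>v\<close> is a
  continuous function on \<open>E + \<real> v\<close>; so it converges along convergent sequences.\<close>

lemma L2_closure_add_line:
  assumes E: "subspace E" "E \<subseteq> L2_germs \<alpha>" "L2_closure \<alpha> E \<subseteq> E" and v: "v \<in> L2_germs \<alpha>"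
    and u: "u \<in> L2_closure \<alpha> {e + t *\<^sub>R v |e t. e \<in> E}"
  shows "\<exists>e\<in>E. \<exists>t. u = e + t *\<^sub>R v"
proof (cases "v \<in> E")
  case True
  have "{e + t *\<^sub>R v |e t. e \<in> E} \<subseteq> E"
  proof
    fix x assume "x \<in> {e + t *\<^sub>R v |e t. e \<in> E}"
    then obtain e t where "x = e + t *\<^sub>R v" "e \<in> E" by blast
    then show "x \<in> E" by (simp only: subspace_add[OF E(1)] subspace_scale[OF E(1) True])
  qed
  then have "u \<in> E" using u L2_closure_mono E(3) by blast
  then show ?thesis by (intro bexI[of _ u] exI[of _ 0]) simp_all
next
  case False
  let ?N = "germ_norm \<alpha>"
  have uL: "u \<in> L2_germs \<alpha>" using u L2_closure_L2 by blast
  from False E(3) have "v \<notin> L2_closure \<alpha> E" by blast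
  then have "\<exists>d>0. \<forall>e\<in>E. d \<le> ?N (v - e)"
    using L2_closureI[OF v, of E] E(2) by (meson not_le subsetD)
  then obtain d where d: "0 < d" "\<And>e. e \<in> E \<Longrightarrow> d \<le> ?N (v - e)" by blast
  have "\<exists>e t. e \<in> E \<and> ?N (u - (e + t *\<^sub>R v)) < 1 / real (Suc n)" for n
    using L2_closureD[OF u, of "1 / real (Suc n)"] by fastforce
  then obtain e t where et: "\<And>n. e n \<in> E" "\<And>n. ?N (u - (e n + t n *\<^sub>R v)) < 1 / real (Suc n)"
    by metis
  have eL: "e n \<in> L2_germs \<alpha>" for n using et E(2) by blast
  define w where "w n = e n + t n *\<^sub>R v" for n
  have wL: "w n \<in> L2_germs \<alpha>" for n unfolding w_def by (intro L2_germs_add L2_germs_scale eL v)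
  have tt: "\<bar>t n - t m\<bar> * d \<le> 2 * (1 / real (Suc n) + 1 / real (Suc m))" for n m
  proof (cases "t n = t m")
    case False
    define c where "c = t n - t m"
    have c: "c \<noteq> 0" using False by (simp add: c_def)
    define e' where "e' = inverse c *\<^sub>R (e m - e n)"
    have e': "e' \<in> E" unfolding e'_def by (intro subspace_scale[OF E(1)] subspace_diff[OF E(1)] et)
    have "c *\<^sub>R e' = e m - e n" using c by (simp add: e'_def)
    then have "w n - w m = c *\<^sub>R (v - e')"
      unfolding scaleR_diff_right by (simp add: w_def c_def algebra_simps)
    then have "?N (w n - w m) = \<bar>c\<bar> * ?N (v - e')" by (simp add: germ_norm_scale)
    then have "\<bar>c\<bar> * d \<le> ?N (w n - w m)" using d(2)[OF e'] by (simp add: mult_left_mono)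
    also have "\<dots> = ?N ((u - w m) + (w n - u))" by (simp add: algebra_simps)
    also have "\<dots> \<le> 2 * (?N (u - w m) + ?N (w n - u))"
      by (rule germ_norm_quasi_triangle) (intro L2_germs_diff uL wL)+
    also have "\<dots> \<le> 2 * (1 / real (Suc n) + 1 / real (Suc m))"
      using et(2)[of n] et(2)[of m] germ_norm_commute[of \<alpha> u "w n"] by (simp add: w_def)
    finally show ?thesis by (simp add: c_def)
  qed simp
  have "Cauchy t"
  proof (rule CauchyI)
    fix \<epsilon> :: real assume "0 < \<epsilon>"
    then have "0 < \<epsilon> * d / 4" using d by simp
    then obtain M where M: "1 / real (Suc M) < \<epsilon> * d / 4" using nat_approx_posE by blast
    show "\<exists>M. \<forall>m\<ge>M. \<forall>n\<ge>M. norm (t m - t n) < \<epsilon>"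
    proof (intro exI allI impI)
      fix m n assume "M \<le> m" "M \<le> n"
      then have "1 / real (Suc m) \<le> 1 / real (Suc M)" "1 / real (Suc n) \<le> 1 / real (Suc M)"
        by (simp_all add: frac_le)
      then have "2 * (1 / real (Suc m) + 1 / real (Suc n)) \<le> 2 * (1 / real (Suc M) + 1 / real (Suc M))"
        by (intro mult_left_mono add_mono) simp_all
      also have "\<dots> = 4 * (1 / real (Suc M))" by simp
      also have "\<dots> < 4 * (\<epsilon> * d / 4)" using M by (intro mult_strict_left_mono) simp_all
      finally have "\<bar>t m - t n\<bar> * d < \<epsilon> * d" using tt[of m n] by simp
      then show "norm (t m - t n) < \<epsilon>" using d by simp
    qed
  qed
  then obtain t' where t': "t \<longlonglongrightarrow> t'" using real_Cauchy_convergent by (auto simp: convergent_def)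
  have "u - t' *\<^sub>R v \<in> L2_closure \<alpha> E"
  proof (rule L2_closureI)
    show "u - t' *\<^sub>R v \<in> L2_germs \<alpha>" by (intro L2_germs_diff L2_germs_scale uL v)
    fix \<epsilon> :: real assume \<epsilon>: "0 < \<epsilon>"
    have "(\<lambda>n. 2 * (1 / real (Suc n) + \<bar>t n - t'\<bar> * ?N v)) \<longlonglongrightarrow> 2 * (0 + \<bar>t' - t'\<bar> * ?N v)"
      by (intro tendsto_intros t' LIMSEQ_Suc[OF lim_1_over_n])
    then have "\<forall>\<^sub>F n in sequentially. 2 * (1 / real (Suc n) + \<bar>t n - t'\<bar> * ?N v) < \<epsilon>"
      using \<epsilon> by (intro order_tendstoD) auto
    then obtain n where n: "2 * (1 / real (Suc n) + \<bar>t n - t'\<bar> * ?N v) < \<epsilon>"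
      by (auto simp: eventually_sequentially)
    have eq: "(u - t' *\<^sub>R v) - e n = (u - w n) + (t n - t') *\<^sub>R v" by (simp add: w_def algebra_simps)
    have "?N ((u - t' *\<^sub>R v) - e n) \<le> 2 * (?N (u - w n) + ?N ((t n - t') *\<^sub>R v))"
      unfolding eq by (rule germ_norm_quasi_triangle[OF L2_germs_diff[OF uL wL[of n]] L2_germs_scale[OF v]])
    also have "\<dots> \<le> 2 * (1 / real (Suc n) + \<bar>t n - t'\<bar> * ?N v)"
      using et(2)[of n] by (simp add: w_def germ_norm_scale)
    finally show "\<exists>x\<in>E. x \<in> L2_germs \<alpha> \<and> ?N ((u - t' *\<^sub>R v) - x) < \<epsilon>"
      using n et(1) eL by (intro bexI[of _ "e n"]) auto
  qed
  then have "u - t' *\<^sub>R v \<in> E" using E(3) by blast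
  then show ?thesis by (intro bexI[of _ "u - t' *\<^sub>R v"] exI[of _ t']) simp_all
qed

lemma subspace_set_plus:
  fixes E F :: "'a::real_vector set"
  assumes "subspace E" "subspace F" shows "subspace (E + F)"
proof -
  have "E + F = {x + y |x y. x \<in> E \<and> y \<in> F}" by (auto simp: set_plus_def)
  then show ?thesis using subspace_sums[OF assms] by simp
qed

text \<open>Add the finitely many directions one at a time.\<close>

lemma L2_closure_add_span:
  assumes "finite F" "F \<subseteq> L2_germs \<alpha>" and E: "subspace E" "E \<subseteq> L2_germs \<alpha>" "L2_closure \<alpha> E \<subseteq> E"
  shows "L2_closure \<alpha> (E + span F) \<subseteq> E + span F"
  using assms(1,2)
proof (induction F rule: finite_induct)
  case empty
  have "E + span {} = E" by (auto simp: set_plus_def)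
  then show ?case using E(3) by simp
next
  case (insert v F)
  let ?E = "E + span F"
  have IH: "L2_closure \<alpha> ?E \<subseteq> ?E" using insert by simp
  have v: "v \<in> L2_germs \<alpha>" using insert by simp
  have sE: "subspace ?E" by (rule subspace_set_plus[OF E(1) subspace_span])
  have "span F \<subseteq> L2_germs \<alpha>" using insert.prems by (intro span_minimal subspace_L2_germs) auto
  then have EL: "?E \<subseteq> L2_germs \<alpha>"
    using E(2) L2_germs_add unfolding set_plus_def by blast
  have eq: "E + span (insert v F) = {e + t *\<^sub>R v |e t. e \<in> ?E}"
  proof (intro equalityI subsetI)
    fix x assume "x \<in> E + span (insert v F)"
    then obtain e f where x: "x = e + f" "e \<in> E" "f \<in> span (insert v F)" by (auto simp: set_plus_def)
    then obtain k where "f - k *\<^sub>R v \<in> span F" unfolding span_insert by blast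
    then have "e + (f - k *\<^sub>R v) \<in> ?E" using x(2) by (rule set_plus_intro[rotated])
    then show "x \<in> {e + t *\<^sub>R v |e t. e \<in> ?E}"
      unfolding x(1) by (intro CollectI exI[of _ "e + (f - k *\<^sub>R v)"] exI[of _ k]) simp
  next
    fix x assume "x \<in> {e + t *\<^sub>R v |e t. e \<in> ?E}"
    then obtain e f t where x: "x = (e + f) + t *\<^sub>R v" "e \<in> E" "f \<in> span F" by (auto simp: set_plus_def)
    have "f + t *\<^sub>R v \<in> span (insert v F)"
      by (intro span_add subsetD[OF span_mono[OF subset_insertI] x(3)] span_scale span_base) simp
    then show "x \<in> E + span (insert v F)" unfolding x(1) add.assoc using x(2) by (rule set_plus_intro[rotated])
  qed
  show ?case
  proof
    fix u assume "u \<in> L2_closure \<alpha> (E + span (insert v F))"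
    then have "\<exists>e\<in>?E. \<exists>t. u = e + t *\<^sub>R v"
      unfolding eq by (rule L2_closure_add_line[OF sE EL IH v])
    then show "u \<in> E + span (insert v F)" unfolding eq by blast
  qed
qed

section \<open>Averaging over a box\<close>

lemma finite_site_box [simp]: "finite (site_box l)"
  by (simp add: site_box_def)

lemma card_site_box: "card (site_box l) = (2 * l + 1)\<^sup>2"
proof -
  have "card {- int l..int l} = 2 * l + 1" unfolding card_atLeastAtMost_int by linarith
  then show ?thesis by (simp only: site_box_def card_cartesian_product power2_eq_square)
qed

lemma site_box_mono: "l \<le> m \<Longrightarrow> site_box l \<subseteq> site_box m"
  by (auto simp: site_box_def)

lemma finite_subset_site_box: assumes A: "finite A" shows "\<exists>l. A \<subseteq> site_box l"
proof (intro exI subsetI)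
  fix a assume a: "a \<in> A"
  let ?n = "\<lambda>a::site. nat \<bar>fst a\<bar> + nat \<bar>snd a\<bar>"
  define l where "l = (\<Sum>a\<in>A. ?n a)"
  have "?n a \<le> l" unfolding l_def by (rule member_le_sum[OF a, of ?n]) (use A in auto)
  then have "a \<in> site_box l" by (cases a) (auto simp: site_box_def)
  then show "a \<in> site_box (\<Sum>a\<in>A. nat \<bar>fst a\<bar> + nat \<bar>snd a\<bar>)" unfolding l_def .
qed

text \<open>The canonical expectation of \<open>h\<close> in the box, as a function of the configuration. The average over
  permutations of the sites stays visibly in the same class of functions as \<open>h\<close>.\<close>

definition box_average :: "nat \<Rightarrow> (config \<Rightarrow> real) \<Rightarrow> config \<Rightarrow> real" where
  "box_average l h \<eta> = (\<Sum>\<pi> | \<pi> permutes site_box l. h (\<lambda>y. \<eta> (\<pi> y))) / fact (card (site_box l))"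

text \<open>Composition with a transposition shows that all images of \<open>a\<close> are equally frequent.\<close>

lemma card_permutations_sending:
  assumes B: "finite B" "a \<in> B" "z \<in> B"
  shows "card {\<pi>. \<pi> permutes B \<and> \<pi> a = z} * card B = fact (card B)"
proof -
  let ?P = "\<lambda>z. {\<pi>. \<pi> permutes B \<and> \<pi> a = z}"
  have fin: "finite (?P z)" for z
    using finite_permutations[OF B(1)] by (rule finite_subset[rotated]) auto
  have "card (?P z') = card (?P z)" if z': "z' \<in> B" for z'
  proof (rule bij_betw_same_card[of "\<lambda>\<pi>. Transposition.transpose z z' \<circ> \<pi>"], rule bij_betwI)
    have t: "Transposition.transpose z z' permutes B" using B z' by (intro permutes_swap_id)
    show "(\<lambda>\<pi>. Transposition.transpose z z' \<circ> \<pi>) \<in> ?P z' \<rightarrow> ?P z"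
      using permutes_compose[OF _ t] by auto
    show "(\<lambda>\<pi>. Transposition.transpose z z' \<circ> \<pi>) \<in> ?P z \<rightarrow> ?P z'"
      using permutes_compose[OF _ t] by auto
  qed (auto simp: fun_eq_iff)
  then have "(\<Sum>z'\<in>B. card (?P z')) = card B * card (?P z)" by simp
  moreover have "(\<Sum>z'\<in>B. card (?P z')) = card (\<Union>z'\<in>B. ?P z')"
    by (rule card_UN_disjoint[symmetric]) (use B fin in auto)
  moreover have "(\<Union>z'\<in>B. ?P z') = {\<pi>. \<pi> permutes B}"
    using B(2) by (auto simp: permutes_in_image)
  ultimately show ?thesis using card_permutations[OF refl B(1)] by (simp add: mult.commute)
qed

lemma box_average_relabel:
  assumes "\<sigma> permutes site_box l" shows "box_average l h (\<lambda>y. \<eta> (\<sigma> y)) = box_average l h \<eta>"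
  using setum_permutations_compose_left[OF assms, of "\<lambda>\<pi>. h (\<lambda>y. \<eta> (\<pi> y))"]
  by (simp add: box_average_def)

lemma box_average_depends_on:
  assumes h: "depends_on h (site_box l)" shows "depends_on (box_average l h) (site_box l)"
  unfolding depends_on_def
proof (intro ballI impI)
  fix \<eta> \<xi> assume s: "\<eta> \<in> Sigma_inf" "\<xi> \<in> Sigma_inf" and eq: "\<forall>x\<in>site_box l. \<eta> x = \<xi> x"
  have "h (\<lambda>y. \<eta> (\<pi> y)) = h (\<lambda>y. \<xi> (\<pi> y))" if "\<pi> permutes site_box l" for \<pi>
    by (rule depends_onD[OF h Sigma_inf_comp[OF s(1)] Sigma_inf_comp[OF s(2)]])
       (use eq permutes_in_image[OF that] in auto)
  then show "box_average l h \<eta> = box_average l h \<xi>" by (simp add: box_average_def)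
qed

text \<open>A change of one site of the box is only felt by the few permutations moving it into the
  support of \<open>h\<close>.\<close>

lemma box_average_change_site:
  assumes A: "A \<subseteq> site_box l" and h: "depends_on h A" and M: "\<And>\<eta>. \<eta> \<in> Sigma_inf \<Longrightarrow> \<bar>h \<eta>\<bar> \<le> M"
    and s: "\<eta> \<in> Sigma_inf" "\<xi> \<in> Sigma_inf" and z: "z \<in> site_box l"
    and eq: "\<And>y. y \<in> site_box l \<Longrightarrow> y \<noteq> z \<Longrightarrow> \<eta> y = \<xi> y"
  shows "\<bar>box_average l h \<eta> - box_average l h \<xi>\<bar> \<le> 2 * M * real (card A) / real (card (site_box l))"
proof -
  let ?B = "site_box l" and ?P = "{\<pi>. \<pi> permutes site_box l}"
  let ?f = "fact (card ?B) :: real"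
  have M0: "0 \<le> M" using M[OF s(1)] by linarith
  have fP: "finite ?P" by (rule finite_permutations) simp
  have fA: "finite A" by (rule finite_subset[OF A finite_site_box])
  have cB: "0 < card ?B" using z card_gt_0_iff finite_site_box by blast
  have d: "\<bar>h (\<lambda>y. \<eta> (\<pi> y)) - h (\<lambda>y. \<xi> (\<pi> y))\<bar> \<le> (\<Sum>a\<in>A. 2 * M * of_bool (\<pi> a = z))" if \<pi>: "\<pi> permutes ?B" for \<pi>
  proof (cases "\<exists>a\<in>A. \<pi> a = z")
    case True
    then obtain a where a: "a \<in> A" "\<pi> a = z" by blast
    have "\<bar>h (\<lambda>y. \<eta> (\<pi> y)) - h (\<lambda>y. \<xi> (\<pi> y))\<bar> \<le> 2 * M"
      using M[OF Sigma_inf_comp[OF s(1), of \<pi>]] M[OF Sigma_inf_comp[OF s(2), of \<pi>]] by linarith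
    also have "\<dots> = 2 * M * of_bool (\<pi> a = z)" using a by simp
    also have "\<dots> \<le> (\<Sum>a\<in>A. 2 * M * of_bool (\<pi> a = z))"
      by (rule member_le_sum[OF a(1)]) (use M0 fA in auto)
    finally show ?thesis .
  next
    case False
    have "h (\<lambda>y. \<eta> (\<pi> y)) = h (\<lambda>y. \<xi> (\<pi> y))"
      by (rule depends_onD[OF h Sigma_inf_comp[OF s(1)] Sigma_inf_comp[OF s(2)]], rule eq)
         (use False A permutes_in_image[OF \<pi>] in auto)
    then show ?thesis using M0 by (simp add: sum_nonneg)
  qed
  have "\<bar>\<Sum>\<pi>\<in>?P. h (\<lambda>y. \<eta> (\<pi> y)) - h (\<lambda>y. \<xi> (\<pi> y))\<bar> \<le> (\<Sum>\<pi>\<in>?P. \<Sum>a\<in>A. 2 * M * of_bool (\<pi> a = z))"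
    by (rule order_trans[OF sum_abs sum_mono]) (use d in auto)
  also have "\<dots> = (\<Sum>a\<in>A. \<Sum>\<pi>\<in>?P. 2 * M * of_bool (\<pi> a = z))" by (rule sum.swap)
  also have "\<dots> = (\<Sum>a\<in>A. 2 * M * (?f / real (card ?B)))"
  proof (rule sum.cong[OF refl])
    fix a assume "a \<in> A"
    then have "real (card {\<pi>. \<pi> permutes ?B \<and> \<pi> a = z} * card ?B) = ?f"
      using card_permutations_sending[OF finite_site_box, of a l z] A z by (subst card_permutations_sending) auto
    then have c: "real (card {\<pi>. \<pi> permutes ?B \<and> \<pi> a = z}) = ?f / real (card ?B)"
      using cB z by (auto simp: eq_divide_eq)
    have "(\<Sum>\<pi>\<in>?P. of_bool (\<pi> a = z) :: real) = real (card (?P \<inter> {\<pi>. \<pi> a = z}))"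
      by (rule sum_of_bool_eq) (rule fP)+
    also have "?P \<inter> {\<pi>. \<pi> a = z} = {\<pi>. \<pi> permutes ?B \<and> \<pi> a = z}"
      by (rule Collect_conj_eq[symmetric])
    finally show "(\<Sum>\<pi>\<in>?P. 2 * M * of_bool (\<pi> a = z)) = 2 * M * (?f / real (card ?B))"
      unfolding sum_distrib_left[symmetric] by (simp only: c)
  qed
  also have "\<dots> = 2 * M * real (card A) / real (card ?B) * ?f" by simp
  finally have "\<bar>(\<Sum>\<pi>\<in>?P. h (\<lambda>y. \<eta> (\<pi> y)) - h (\<lambda>y. \<xi> (\<pi> y))) / ?f\<bar> \<le> 2 * M * real (card A) / real (card ?B)"
    by (simp add: abs_divide divide_le_eq)
  then show ?thesis by (simp add: box_average_def sum_subtractf diff_divide_distrib)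
qed

lemma box_average_T_omega:
  assumes "C2_circle \<omega>" "h \<in> T_omega \<omega>" shows "box_average l h \<in> T_omega \<omega>"
proof -
  have eq: "box_average l h = (\<lambda>\<eta>. inverse (fact (card (site_box l)))
     * (\<Sum>\<pi> | \<pi> permutes site_box l. h (pull (\<lambda>y. Some (\<pi> y)) \<eta>)))"
    by (simp add: box_average_def[abs_def] pull_def[abs_def] divide_inverse mult.commute)
  show ?thesis unfolding eq
    by (intro T_omega_scale T_omega_sum T_omega_pull assms finite_permutations) simp
qed

text \<open>Only the translates of the box that contain exactly one of the two sites contribute: a number
  of order \<open>l\<close>, each contributing an increment of order \<open>1 / l\<^sup>2\<close>.\<close>

lemma nabla_Sigma_box_average:
  assumes A: "A \<subseteq> site_box l" and h: "depends_on h A" and M: "\<And>\<eta>. \<eta> \<in> Sigma_inf \<Longrightarrow> \<bar>h \<eta>\<bar> \<le> M"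
    and \<eta>: "\<eta> \<in> Sigma_inf" and i: "i \<in> {1, 2}"
  shows "\<bar>nabla_Sigma_comp i (box_average l h) \<eta>\<bar> \<le> 4 * M * real (card A) / (2 * real l + 1)"
proof -
  let ?B = "site_box l" and ?e = "evec i" and ?g = "box_average l h"
  let ?\<xi> = "exch 0 ?e \<eta>" and ?X = "meeting ?B {0, 0 + ?e}"
  let ?c = "2 * M * real (card A) / real (card ?B)"
  have M0: "0 \<le> M" using M[OF \<eta>] by linarith
  have g: "depends_on ?g ?B" by (rule box_average_depends_on[OF depends_on_mono[OF h A]])
  \<comment> \<open>The translates for which exactly one of \<open>0\<close> and \<open>e\<close> lies in the box.\<close>
  define Y where "Y = {x \<in> ?X. \<not> (- x \<in> ?B \<and> ?e - x \<in> ?B)}"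
  have X: "- x \<in> ?B \<or> ?e - x \<in> ?B" if x: "x \<in> ?X" for x
  proof -
    from x obtain b where "b \<in> ?B" "x + b \<in> {0, 0 + ?e}" unfolding meeting_iff by blast
    then have "b = - x \<or> b = ?e - x" by (auto simp: algebra_simps add_eq_0_iff)
    then show ?thesis using \<open>b \<in> ?B\<close> by auto
  qed
  have eq0: "translate x ?g ?\<xi> = translate x ?g \<eta>" if x: "x \<in> ?X - Y" for x
  proof -
    have t: "Transposition.transpose (- x) (?e - x) permutes ?B"
      using x by (intro permutes_swap_id) (auto simp: Y_def)
    have "(\<lambda>y. ?\<xi> (x + y)) = (\<lambda>y. (\<lambda>y. \<eta> (x + y)) (Transposition.transpose (- x) (?e - x) y))"
    proof
      fix y
      have 0: "x + y = 0 \<longleftrightarrow> y = - x" by (rule add_eq_0_iff)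
      have 1: "x + y = ?e \<longleftrightarrow> y = ?e - x" by (simp add: eq_diff_eq add.commute)
      show "?\<xi> (x + y) = \<eta> (x + Transposition.transpose (- x) (?e - x) y)"
        unfolding exch_alt 0 1 Transposition.transpose_def by simp
    qed
    then show ?thesis using box_average_relabel[OF t, of h "\<lambda>y. \<eta> (x + y)"] by (simp add: translate_def)
  qed
  have le: "\<bar>translate x ?g ?\<xi> - translate x ?g \<eta>\<bar> \<le> ?c" if x: "x \<in> Y" for x
  proof -
    have xX: "x \<in> ?X" using x by (simp add: Y_def)
    have ag: "?\<xi> (x + y) = \<eta> (x + y)" if "y \<noteq> - x" "y \<noteq> ?e - x" for y
      using that by (auto simp: exch_alt algebra_simps add_eq_0_iff)
    show ?thesis
    proof (cases "- x \<in> ?B")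
      case True
      then have "?e - x \<notin> ?B" using x by (simp add: Y_def)
      then show ?thesis unfolding translate_def
        by (intro box_average_change_site[OF A h M Sigma_inf_comp[OF Sigma_inf_exch[OF \<eta>]] Sigma_inf_comp[OF \<eta>] True] ag) auto
    next
      case False
      then have ex: "?e - x \<in> ?B" using X[OF xX] by blast
      show ?thesis unfolding translate_def
        by (intro box_average_change_site[OF A h M Sigma_inf_comp[OF Sigma_inf_exch[OF \<eta>]] Sigma_inf_comp[OF \<eta>] ex] ag)
           (use False in auto)
    qed
  qed
  have cY: "card Y \<le> 2 * (2 * l + 1)"
  proof (cases "i = 1")
    case True
    have "Y \<subseteq> {- int l, int l + 1} \<times> {- int l..int l}"
    proof
      fix x assume x: "x \<in> Y"
      then have "- x \<in> ?B \<or> ?e - x \<in> ?B" "\<not> (- x \<in> ?B \<and> ?e - x \<in> ?B)" using X by (auto simp: Y_def)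
      then show "x \<in> {- int l, int l + 1} \<times> {- int l..int l}"
        by (cases x) (auto simp: site_box_def True)
    qed
    then have "card Y \<le> card ({- int l, int l + 1} \<times> {- int l..int l})" by (intro card_mono) auto
    also have "\<dots> = card {- int l, int l + 1} * (2 * l + 1)" by (simp add: card_cartesian_product nat_add_distrib)
    also have "\<dots> \<le> 2 * (2 * l + 1)" by (intro mult_right_mono) (simp_all add: card_insert_if)
    finally show ?thesis .
  next
    case False
    then have i2: "i = 2" using i by simp
    have "Y \<subseteq> {- int l..int l} \<times> {- int l, int l + 1}"
    proof
      fix x assume x: "x \<in> Y"
      then have "- x \<in> ?B \<or> ?e - x \<in> ?B" "\<not> (- x \<in> ?B \<and> ?e - x \<in> ?B)" using X by (auto simp: Y_def)
      then show "x \<in> {- int l..int l} \<times> {- int l, int l + 1}"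
        by (cases x) (auto simp: site_box_def i2)
    qed
    then have "card Y \<le> card ({- int l..int l} \<times> {- int l, int l + 1})" by (intro card_mono) auto
    also have "\<dots> = (2 * l + 1) * card {- int l, int l + 1}" by (simp add: card_cartesian_product nat_add_distrib)
    also have "\<dots> \<le> 2 * (2 * l + 1)" by (simp add: card_insert_if)
    finally show ?thesis .
  qed
  have fX: "finite ?X" by simp
  have "nabla_Sigma_comp i ?g \<eta> = occ \<eta> 0 * (1 - occ \<eta> ?e) * (trans_sum ?X ?g ?\<xi> - trans_sum ?X ?g \<eta>)"
    using translate_nabla_Sigma_comp[OF g finite_site_box \<eta> fX order_refl] by (simp add: translate_def)
  then have "\<bar>nabla_Sigma_comp i ?g \<eta>\<bar> = \<bar>occ \<eta> 0 * (1 - occ \<eta> ?e)\<bar> * \<bar>trans_sum ?X ?g ?\<xi> - trans_sum ?X ?g \<eta>\<bar>"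
    by (simp add: abs_mult)
  also have "\<dots> \<le> 1 * \<bar>trans_sum ?X ?g ?\<xi> - trans_sum ?X ?g \<eta>\<bar>"
    using \<eta> by (intro mult_right_mono) (auto simp: occ_Sigma)
  also have "trans_sum ?X ?g ?\<xi> - trans_sum ?X ?g \<eta> = (\<Sum>x\<in>Y. translate x ?g ?\<xi> - translate x ?g \<eta>)"
    unfolding trans_sum_def sum_subtractf[symmetric]
    by (rule sum.mono_neutral_right) (use eq0 in \<open>auto simp: Y_def\<close>)
  also have "1 * \<bar>\<dots>\<bar> \<le> (\<Sum>x\<in>Y. ?c)"
    unfolding mult_1_left by (rule order_trans[OF sum_abs sum_mono]) (rule le)
  also have "\<dots> \<le> real (2 * (2 * l + 1)) * ?c"
    using cY M0 by (simp only: sum_constant) (intro mult_right_mono, simp_all only: of_nat_le_iff, simp)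
  also have "\<dots> = 4 * M * real (card A) / (2 * real l + 1)"
  proof -
    define r where "r = 2 * real l + 1"
    have r: "r > 0" "real (card ?B) = r * r" "real (2 * (2 * l + 1)) = 2 * r"
      by (simp_all add: card_site_box power2_eq_square r_def algebra_simps)
    show ?thesis unfolding r r_def[symmetric] using r(1) by (simp add: field_simps)
  qed
  finally show ?thesis .
qed

lemma nabla_Sigma_comp_add:
  assumes "cylinder f" "cylinder g" and \<eta>: "\<eta> \<in> Sigma_inf"
  shows "nabla_Sigma_comp i (\<lambda>\<eta>. f \<eta> + c * g \<eta>) \<eta> = nabla_Sigma_comp i f \<eta> + c * nabla_Sigma_comp i g \<eta>"
proof -
  from assms obtain A B where A: "finite A" "depends_on f A" and B: "finite B" "depends_on g B"
    unfolding cylinder_def by blast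
  let ?C = "A \<union> B"
  have C: "finite ?C" "depends_on f ?C" "depends_on g ?C"
    using A B by (auto intro: depends_on_mono)
  have fg: "depends_on (\<lambda>\<eta>. f \<eta> + c * g \<eta>) ?C"
    unfolding depends_on_def
    by (intro ballI impI arg_cong2[where f = "\<lambda>a b. a + c * b"] depends_onD[OF C(2)] depends_onD[OF C(3)]) simp_all
  let ?X = "meeting ?C {0, 0 + evec i}"
  have X: "finite ?X" using C(1) by simp
  have n: "nabla_Sigma_comp i h \<eta>
    = occ \<eta> 0 * (1 - occ \<eta> (evec i)) * (trans_sum ?X h (exch 0 (evec i) \<eta>) - trans_sum ?X h \<eta>)"
    if "depends_on h ?C" for h
    using translate_nabla_Sigma_comp[OF that C(1) \<eta> X order_refl] by (simp add: translate_def)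
  show ?thesis unfolding n[OF fg] n[OF C(2)] n[OF C(3)]
    by (simp add: trans_sum_def translate_def sum.distrib sum_distrib_left[symmetric] algebra_simps)
qed

text \<open>The number of particles is conserved.\<close>

lemma nabla_Sigma_occ:
  assumes \<eta>: "\<eta> \<in> Sigma_inf" shows "nabla_Sigma_comp i (\<lambda>\<eta>. occ \<eta> c) \<eta> = 0"
proof -
  let ?e = "evec i"
  have d: "depends_on (\<lambda>\<eta>. occ \<eta> c) {c}" by (auto simp: depends_on_def occ_alt)
  have ne: "- c \<noteq> ?e - c" using evec_nonzero[of i] by (metis add_diff_cancel_left' diff_0 diff_add_cancel)
  have X: "finite {- c, ?e - c}" "meeting {c} {0, 0 + ?e} \<subseteq> {- c, ?e - c}" by (auto simp: meeting_def)
  have t: "trans_sum {- c, ?e - c} (\<lambda>\<eta>. occ \<eta> c) \<xi> = occ \<xi> 0 + occ \<xi> ?e" for \<xi>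
    using ne by (simp add: trans_sum_def translate_def occ_alt)
  show ?thesis
    using translate_nabla_Sigma_comp[OF d _ \<eta> X] unfolding t by (simp add: translate_def occ_exch)
qed

lemma occ_T_omega: "C2_circle \<omega> \<Longrightarrow> (\<lambda>\<eta>. occ \<eta> x) \<in> T_omega \<omega>"
  using T_omega_charge_term[OF _ occ_charge occ_local_const[of 1], of \<omega> x] by (simp add: occ_alt)

lemma place_relabel:
  assumes "bij \<pi>" shows "(\<lambda>y. place K xs (\<pi> y)) = place K (map (inv \<pi>) xs)"
proof
  have "map_of (zip xs K) (\<pi> y) = map_of (zip (map (inv \<pi>) xs) K) y" for y
  proof (induction xs arbitrary: K)
    case (Cons x xs)
    have "\<pi> y = x \<longleftrightarrow> y = inv \<pi> x" using assms by (metis bij_inv_eq_iff)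
    with Cons show ?case by (cases K) auto
  qed simp
  then show "place K xs (\<pi> y) = place K (map (inv \<pi>) xs) y" for y by (simp add: place_def)
qed

lemma canonical_placements:
  assumes "K \<in> canonical_states l"
  shows "finite {xs. length xs = length K \<and> distinct xs \<and> set xs \<subseteq> site_box l}" (is "finite ?S")
    and "{xs. length xs = length K \<and> distinct xs \<and> set xs \<subseteq> site_box l} \<noteq> {}"
proof -
  show "finite ?S"
    by (rule finite_subset[OF _ finite_lists_length_eq[OF finite_site_box[of l], of "length K"]]) auto
  obtain xs where xs: "set xs = site_box l" "distinct xs" using finite_distinct_list[OF finite_site_box] by blast
  then have "length xs = card (site_box l)" using distinct_card by fastforce
  then have "take (length K) xs \<in> ?S"
    using xs assms set_take_subset[of "length K" xs] by (auto simp: canonical_states_def)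
  then show "?S \<noteq> {}" by blast
qed

text \<open>A permutation of the box permutes the equally likely placements.\<close>

lemma canonical_measure_relabel:
  assumes K: "K \<in> canonical_states l" and \<pi>: "\<pi> permutes site_box l"
  shows "map_pmf (\<lambda>\<eta> y. \<eta> (\<pi> y)) (canonical_measure l K) = canonical_measure l K"
proof -
  let ?S = "{xs. length xs = length K \<and> distinct xs \<and> set xs \<subseteq> site_box l}"
  have b: "bij \<pi>" "bij (inv \<pi>)" using permutes_bij[OF \<pi>] bij_imp_bij_inv by auto
  have inv: "inv \<pi> permutes site_box l" by (rule permutes_inv[OF \<pi>])
  have sub: "map \<sigma> ` ?S \<subseteq> ?S" if "\<sigma> permutes site_box l" for \<sigma>
  proof (rule image_subsetI)
    fix xs assume xs: "xs \<in> ?S"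
    then have "\<sigma> ` set xs \<subseteq> site_box l"
      using image_mono[of "set xs" "site_box l" \<sigma>] permutes_image[OF that] by simp
    then show "map \<sigma> xs \<in> ?S" using xs permutes_inj_on[OF that] by (simp add: distinct_map)
  qed
  have "?S \<subseteq> map (inv \<pi>) ` ?S"
  proof
    fix xs assume "xs \<in> ?S"
    moreover have "xs = map (inv \<pi>) (map \<pi> xs)" using b by (simp add: comp_def bij_is_inj map_idI)
    ultimately show "xs \<in> map (inv \<pi>) ` ?S" using sub[OF \<pi>] by blast
  qed
  then have S: "map (inv \<pi>) ` ?S = ?S" using sub[OF inv] by blast
  have "map_pmf (\<lambda>\<eta> y. \<eta> (\<pi> y)) (canonical_measure l K) = map_pmf (\<lambda>xs y. place K xs (\<pi> y)) (pmf_of_set ?S)"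
    by (simp add: canonical_measure_def map_pmf_comp)
  also have "\<dots> = map_pmf (place K) (map_pmf (map (inv \<pi>)) (pmf_of_set ?S))"
    by (simp add: place_relabel[OF b(1)] map_pmf_comp)
  also have "map_pmf (map (inv \<pi>)) (pmf_of_set ?S) = pmf_of_set (map (inv \<pi>) ` ?S)"
    by (rule map_pmf_of_set_inj)
       (use canonical_placements[OF K] b in \<open>auto intro: inj_on_subset[OF inj_mapI] bij_is_inj\<close>)
  finally show ?thesis unfolding S by (simp add: canonical_measure_def)
qed

lemma canonical_expectation_relabel:
  fixes f :: "config \<Rightarrow> real"
  assumes "K \<in> canonical_states l" "\<pi> permutes site_box l"
  shows "measure_pmf.expectation (canonical_measure l K) (\<lambda>\<eta>. f (\<lambda>y. \<eta> (\<pi> y)))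
    = measure_pmf.expectation (canonical_measure l K) f"
  using canonical_measure_relabel[OF assms] integral_map_pmf[of "\<lambda>\<eta> y. \<eta> (\<pi> y)" "canonical_measure l K" f]
  by simp

lemma canonical_integrable:
  fixes f :: "config \<Rightarrow> real"
  assumes "K \<in> canonical_states l"
  shows "integrable (measure_pmf (canonical_measure l K)) f"
  by (rule integrable_measure_pmf_finite)
     (use canonical_placements[OF assms] in \<open>simp add: canonical_measure_def set_pmf_of_set\<close>)

text \<open>Subtracting its canonical expectation makes \<open>h\<close> centred under the canonical measures of the
  box. These have to be the canonical measures of the smallest box supporting the function; the last
  term, whose gradient vanishes, makes the function depend on a corner if it does not already.\<close>

lemma centred_in_T_omega_zero:
  assumes w: "C2_circle \<omega>" and h: "h \<in> T_omega \<omega>" "depends_on h (site_box l)" and l: "1 \<le> l"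
  obtains t where "(\<lambda>\<eta>. h \<eta> - box_average l h \<eta> + t * (occ \<eta> (int l, int l) - occ \<eta> (- int l, - int l)))
    \<in> T_omega_zero \<omega>"
proof -
  let ?c = "(int l, int l)" and ?c' = "(- int l, - int l)"
  define g where "g t \<eta> = h \<eta> - box_average l h \<eta> + t * (occ \<eta> ?c - occ \<eta> ?c')" for t \<eta>
  have gT: "g t \<in> T_omega \<omega>" for t unfolding g_def
    by (intro T_omega_add T_omega_diff T_omega_scale h box_average_T_omega occ_T_omega w)
  have corners: "?c \<in> site_box l" "?c' \<in> site_box l" by (auto simp: site_box_def)
  have dep: "depends_on (g t) (site_box l)" for t
    unfolding depends_on_def
  proof (intro ballI impI)
    fix \<eta> \<xi> assume s: "\<eta> \<in> Sigma_inf" "\<xi> \<in> Sigma_inf" and eq: "\<forall>x\<in>site_box l. \<eta> x = \<xi> x"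
    have "h \<eta> = h \<xi>" "box_average l h \<eta> = box_average l h \<xi>"
      using depends_onD[OF h(2) s] depends_onD[OF box_average_depends_on[OF h(2)] s] eq by auto
    moreover have "occ \<eta> ?c = occ \<xi> ?c" "occ \<eta> ?c' = occ \<xi> ?c'" using eq corners by (auto intro: occ_cong)
    ultimately show "g t \<eta> = g t \<xi>" by (simp add: g_def)
  qed
  have "\<exists>t. \<not> depends_on (g t) (site_box (l - 1))"
  proof (rule ccontr)
    assume "\<nexists>t. \<not> depends_on (g t) (site_box (l - 1))"
    then have d: "depends_on (g t) (site_box (l - 1))" for t by blast
    let ?\<eta> = "\<lambda>_. empty_site" and ?p = "((1, 0), 0) :: site_state"
    let ?\<xi> = "?\<eta>(?c := ?p)"
    have p: "?p \<in> site_states" by (simp add: site_states_def circle_def)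
    have s: "?\<eta> \<in> Sigma_inf" "?\<xi> \<in> Sigma_inf" using p by (auto intro!: Sigma_inf_upd Sigma_infI)
    have "?c \<notin> site_box (l - 1)" using l by (auto simp: site_box_def)
    then have eq: "\<And>x. x \<in> site_box (l - 1) \<Longrightarrow> ?\<eta> x = ?\<xi> x" by auto
    have "g t ?\<eta> = g t ?\<xi>" for t by (rule depends_onD[OF d s eq])
    from this[of 0] this[of 1] have "g 0 ?\<eta> = g 0 ?\<xi>" "g 1 ?\<eta> = g 1 ?\<xi>" .
    moreover have "?c \<noteq> ?c'" using l by simp
    ultimately show False by (simp add: g_def occ_alt)
  qed
  then obtain t where t: "\<not> depends_on (g t) (site_box (l - 1))" by blast
  have "supp_radius (g t) = l"
    unfolding supp_radius_def
  proof (rule Least_equality)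
    fix s assume s: "depends_on (g t) (site_box s)"
    show "l \<le> s"
    proof (rule ccontr)
      assume "\<not> l \<le> s"
      then have "site_box s \<subseteq> site_box (l - 1)" by (intro site_box_mono) simp
      with s t show False using depends_on_mono by blast
    qed
  qed (rule dep)
  moreover have "measure_pmf.expectation (canonical_measure l K) (g t) = 0" if K: "K \<in> canonical_states l" for K
  proof -
    let ?E = "measure_pmf.expectation (canonical_measure l K)"
    note int = canonical_integrable[OF K]
    have "?E (box_average l h) = (\<Sum>\<pi> | \<pi> permutes site_box l. ?E (\<lambda>\<eta>. h (\<lambda>y. \<eta> (\<pi> y)))) / fact (card (site_box l))"
      unfolding box_average_def[abs_def] by (simp add: Bochner_Integration.integral_sum int)
    also have "\<dots> = (\<Sum>\<pi> | \<pi> permutes site_box l. ?E h) / fact (card (site_box l))"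
      by (intro arg_cong2[where f = "(/)"] sum.cong refl canonical_expectation_relabel[OF K]) simp
    also have "\<dots> = ?E h" by (simp add: card_permutations)
    finally have 1: "?E (box_average l h) = ?E h" .
    have "Transposition.transpose ?c ?c' permutes site_box l" by (rule permutes_swap_id[OF corners])
    from canonical_expectation_relabel[OF K this, of "\<lambda>\<eta>. occ \<eta> ?c"]
    have 2: "?E (\<lambda>\<eta>. occ \<eta> ?c') = ?E (\<lambda>\<eta>. occ \<eta> ?c)" by (simp add: occ_alt)
    have "?E (g t) = ?E h - ?E (box_average l h) + t * (?E (\<lambda>\<eta>. occ \<eta> ?c) - ?E (\<lambda>\<eta>. occ \<eta> ?c'))"
      unfolding g_def[abs_def] by (simp add: int)
    then show ?thesis using 1 2 by simp
  qed
  ultimately have "g t \<in> T_omega_zero \<omega>"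
    using gT T_omega_cylinder[OF gT] by (simp add: T_omega_zero_def C_zero_def)
  then show ?thesis using that unfolding g_def by blast
qed

section \<open>Exact germs\<close>

text \<open>Gradients are compared on configurations only, where the sums defining them are finite. Without the
  centring of \<open>h\<close> these germs visibly form a vector space.\<close>

definition exact_germs :: "(real \<Rightarrow> real) \<Rightarrow> germ set" where
  "exact_germs \<omega> = {u. \<exists>h\<in>T_omega \<omega>. \<forall>\<eta>\<in>Sigma_inf. \<forall>i\<in>{1, 2}. component i u \<eta> = nabla_Sigma_comp i h \<eta>}"

lemma exact_germs_T_omega:
  assumes w: "C2_circle \<omega>" and u: "u \<in> exact_germs \<omega>"
  shows "fst u \<in> T_omega \<omega>" "snd u \<in> T_omega \<omega>"
proof -
  from u obtain h where h: "h \<in> T_omega \<omega>"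
    and e: "\<And>\<eta> i. \<eta> \<in> Sigma_inf \<Longrightarrow> i \<in> {1, 2} \<Longrightarrow> component i u \<eta> = nabla_Sigma_comp i h \<eta>"
    unfolding exact_germs_def by blast
  have "component i u \<in> T_omega \<omega>" if "i \<in> {1, 2}" for i
    by (rule T_omega_cong[OF w nabla_Sigma_comp_T_omega[OF w h] e[OF _ that]])
  from this[of 1] this[of 2] show "fst u \<in> T_omega \<omega>" "snd u \<in> T_omega \<omega>" by (simp_all add: component_def)
qed

lemma exact_germs_L2:
  "\<alpha> \<in> M1_circle \<Longrightarrow> C2_circle \<omega> \<Longrightarrow> exact_germs \<omega> \<subseteq> L2_germs \<alpha>"
  by (intro subsetI T_omega_germ_L2 exact_germs_T_omega)

lemma nabla_Sigma_exact: "h \<in> T_omega \<omega> \<Longrightarrow> nabla_Sigma h \<in> exact_germs \<omega>"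
  unfolding exact_germs_def using component_nabla_Sigma by auto

lemma subspace_exact_germs:
  assumes w: "C2_circle \<omega>" shows "subspace (exact_germs \<omega>)"
proof -
  have z: "nabla_Sigma_comp i (\<lambda>\<eta>. 0) \<eta> = 0" for i \<eta>
    by (simp add: nabla_Sigma_comp_def nabla_def translate_def)
  have lin: "u + c *\<^sub>R v \<in> exact_germs \<omega>" if "u \<in> exact_germs \<omega>" "v \<in> exact_germs \<omega>" for u v c
  proof -
    from that obtain h g where h: "h \<in> T_omega \<omega>" "g \<in> T_omega \<omega>"
      and e: "\<And>\<eta> i. \<eta> \<in> Sigma_inf \<Longrightarrow> i \<in> {1, 2} \<Longrightarrow> component i u \<eta> = nabla_Sigma_comp i h \<eta>"
        "\<And>\<eta> i. \<eta> \<in> Sigma_inf \<Longrightarrow> i \<in> {1, 2} \<Longrightarrow> component i v \<eta> = nabla_Sigma_comp i g \<eta>"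
      unfolding exact_germs_def by blast
    show ?thesis
      unfolding exact_germs_def mem_Collect_eq
    proof (rule bexI[of _ "\<lambda>\<eta>. h \<eta> + c * g \<eta>"], intro ballI)
      show "(\<lambda>\<eta>. h \<eta> + c * g \<eta>) \<in> T_omega \<omega>" by (intro T_omega_add T_omega_scale h)
      fix \<eta> and i :: nat assume \<eta>: "\<eta> \<in> Sigma_inf" and i: "i \<in> {1, 2}"
      have "component i (u + c *\<^sub>R v) \<eta> = component i u \<eta> + c * component i v \<eta>"
        by (simp add: component_def scaleR_fun_def)
      also have "\<dots> = nabla_Sigma_comp i (\<lambda>\<eta>. h \<eta> + c * g \<eta>) \<eta>"
        using nabla_Sigma_comp_add[OF T_omega_cylinder[OF h(1)] T_omega_cylinder[OF h(2)] \<eta>] e[OF \<eta> i] by simp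
      finally show "component i (u + c *\<^sub>R v) \<eta> = nabla_Sigma_comp i (\<lambda>\<eta>. h \<eta> + c * g \<eta>) \<eta>" .
    qed
  qed
  have 0: "0 \<in> exact_germs \<omega>"
    unfolding exact_germs_def mem_Collect_eq
    by (rule bexI[OF _ T_omega_0]) (auto simp: z component_def)
  show ?thesis
    by (rule subspaceI) (use 0 lin[of _ _ 1] lin[OF 0] in simp_all)
qed

text \<open>Centring \<open>h\<close> in a large box changes its gradient by a term of order \<open>1 / l\<close>.\<close>

lemma exact_germs_subset_closure:
  assumes \<alpha>: "\<alpha> \<in> M1_circle" and w: "C2_circle \<omega>"
  shows "exact_germs \<omega> \<subseteq> L2_closure \<alpha> (germs_E_zero \<omega>)"
proof
  fix u assume u: "u \<in> exact_germs \<omega>"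
  then obtain h where h: "h \<in> T_omega \<omega>"
    and e: "\<And>\<eta> i. \<eta> \<in> Sigma_inf \<Longrightarrow> i \<in> {1, 2} \<Longrightarrow> component i u \<eta> = nabla_Sigma_comp i h \<eta>"
    unfolding exact_germs_def by blast
  have uL: "u \<in> L2_germs \<alpha>" using exact_germs_L2[OF \<alpha> w] u by blast
  from T_omega_cylinder[OF h] obtain A where A: "finite A" "depends_on h A" unfolding cylinder_def by blast
  from T_omega_bounded_observables[OF w h] obtain M where M: "\<And>\<eta>. \<eta> \<in> Sigma_inf \<Longrightarrow> \<bar>h \<eta>\<bar> \<le> M"
    unfolding bounded_observables_def by blast
  obtain l0 where l0: "A \<subseteq> site_box l0" using finite_subset_site_box[OF A(1)] by blast
  show "u \<in> L2_closure \<alpha> (germs_E_zero \<omega>)"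
  proof (rule L2_closureI[OF uL])
    fix \<epsilon> :: real assume \<epsilon>: "0 < \<epsilon>"
    let ?b = "\<lambda>l::nat. 4 * M * real (card A) / (2 * real l + 1)"
    have "(\<lambda>l. 2 * ?b l) \<longlonglongrightarrow> 0" by real_asymp
    then have "\<forall>\<^sub>F l in sequentially. 2 * ?b l < \<epsilon>" using \<epsilon> by (rule order_tendstoD)
    then have "\<forall>\<^sub>F l in sequentially. 2 * ?b l < \<epsilon> \<and> l0 + 1 \<le> l"
      using eventually_ge_at_top[of "l0 + 1"] by eventually_elim simp
    then obtain l where l: "2 * ?b l < \<epsilon>" "l0 + 1 \<le> l" by (auto simp: eventually_sequentially)
    have Al: "A \<subseteq> site_box l" using l0 site_box_mono[of l0 l] l(2) by auto
    let ?o = "\<lambda>\<eta>. occ \<eta> (int l, int l)" and ?o' = "\<lambda>\<eta>. occ \<eta> (- int l, - int l)"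
    from centred_in_T_omega_zero[OF w h depends_on_mono[OF A(2) Al]] l(2) obtain t where
      t: "(\<lambda>\<eta>. h \<eta> - box_average l h \<eta> + t * (?o \<eta> - ?o' \<eta>)) \<in> T_omega_zero \<omega>" (is "?g \<in> _")
      by auto
    have gT: "?g \<in> T_omega \<omega>" using t by (simp add: T_omega_zero_def)
    let ?v = "nabla_Sigma ?g"
    have vE: "?v \<in> germs_E_zero \<omega>" using t unfolding germs_E_zero_def by blast
    have vL: "?v \<in> L2_germs \<alpha>" using exact_germs_L2[OF \<alpha> w] nabla_Sigma_exact[OF gT] by blast
    have cyl: "cylinder h" "cylinder (box_average l h)" "cylinder ?o" "cylinder ?o'"
      by (intro T_omega_cylinder[of _ \<omega>] h box_average_T_omega occ_T_omega w)+
    have T3: "(\<lambda>\<eta>. h \<eta> + (- 1) * box_average l h \<eta>) \<in> T_omega \<omega>"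
      "(\<lambda>\<eta>. (h \<eta> + (- 1) * box_average l h \<eta>) + t * ?o \<eta>) \<in> T_omega \<omega>"
      by (intro T_omega_add T_omega_scale h box_average_T_omega occ_T_omega w)+
    have n: "nabla_Sigma_comp i ?g \<eta> = nabla_Sigma_comp i h \<eta> - nabla_Sigma_comp i (box_average l h) \<eta>"
      if \<eta>: "\<eta> \<in> Sigma_inf" for \<eta> i
    proof -
      have "?g = (\<lambda>\<eta>. ((h \<eta> + (- 1) * box_average l h \<eta>) + t * ?o \<eta>) + (- t) * ?o' \<eta>)"
        by (simp add: algebra_simps)
      then show ?thesis
        using nabla_Sigma_comp_add[OF T_omega_cylinder[OF T3(2)] cyl(4) \<eta>, of i "- t"]
          nabla_Sigma_comp_add[OF T_omega_cylinder[OF T3(1)] cyl(3) \<eta>, of i t]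
          nabla_Sigma_comp_add[OF cyl(1,2) \<eta>, of i "- 1"]
        by (simp add: nabla_Sigma_occ[OF \<eta>])
    qed
    have b: "\<bar>component i (u - ?v) \<eta>\<bar> \<le> ?b l" if "\<eta> \<in> Sigma_inf" "i \<in> {1, 2}" for \<eta> i
      using nabla_Sigma_box_average[OF Al A(2) M that] n[OF that(1), of i] e[OF that]
        component_nabla_Sigma[OF that(2), of ?g] by (simp add: component_minus)
    have "germ_norm \<alpha> (u - ?v) \<le> 2 * ?b l"
      by (rule germ_norm_bound[OF \<alpha> _ _ L2_germs_diff[OF uL vL]])
         (use b[of _ 1] b[of _ 2] in \<open>simp_all add: component_def\<close>)
    also have "\<dots> < \<epsilon>" by (rule l(1))
    finally show "\<exists>v\<in>germs_E_zero \<omega>. v \<in> L2_germs \<alpha> \<and> germ_norm \<alpha> (u - v) < \<epsilon>"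
      by (intro bexI[OF _ vE] conjI vL)
  qed
qed

section \<open>Test functionals separating currents from exact germs\<close>

definition test_functional :: "param \<Rightarrow> (config \<Rightarrow> real) \<Rightarrow> jump_path \<Rightarrow> germ \<Rightarrow> real" where
  "test_functional \<alpha> f p u = (\<integral>\<eta>. f \<eta> * path_integral (form_of_germ u) \<eta> p \<partial>mu \<alpha>)"

lemma exch_relabel: "exch x y (\<lambda>z. \<eta> (\<pi> z)) = (\<lambda>z. \<eta> ((\<pi> \<circ> Transposition.transpose x y) z))"
  by (auto simp: exch_alt Transposition.transpose_def fun_eq_iff)

text \<open>Along a fixed path the configuration is relabelled by fixed exchanges. So each jump contributes an
  entry of the form, evaluated after a relabelling that preserves the measure, and has at most the
  norm of the germ.\<close>

lemma test_functional_bound: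
  assumes \<alpha>: "\<alpha> \<in> M1_circle" and u: "u \<in> L2_germs \<alpha>" and f: "f \<in> borel_measurable (mu \<alpha>)"
    and M: "\<And>\<eta>. \<eta> \<in> Sigma_inf \<Longrightarrow> \<bar>f \<eta>\<bar> \<le> M" and p: "\<forall>(x, z)\<in>set p. unit_step z"
  shows "integrable (mu \<alpha>) (\<lambda>\<eta>. f \<eta> * path_integral (form_of_germ u) \<eta> p)"
    "\<bar>test_functional \<alpha> f p u\<bar> \<le> M * real (length p) * germ_norm \<alpha> u"
proof -
  have M0: "0 \<le> M"
    using M[of "\<lambda>_. empty_site"] Sigma_infI[of "\<lambda>_. empty_site"] by (simp add: order_trans[OF abs_ge_zero])
  have "integrable (mu \<alpha>) (\<lambda>\<eta>. f \<eta> * path_integral (form_of_germ u) (\<lambda>y. \<eta> (\<pi> y)) p) \<and>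
    \<bar>\<integral>\<eta>. f \<eta> * path_integral (form_of_germ u) (\<lambda>y. \<eta> (\<pi> y)) p \<partial>mu \<alpha>\<bar>
      \<le> M * real (length p) * germ_norm \<alpha> u" if "inj \<pi>" for \<pi>
    using p that
  proof (induction p arbitrary: \<pi>)
    case (Cons a p)
    obtain x z where a: "a = (x, z)" by (cases a)
    have z: "unit_step z" and p: "\<forall>(x, z)\<in>set p. unit_step z" using Cons.prems(1) a by auto
    let ?g = "\<lambda>\<eta>. form_of_germ u x (x + z) (\<lambda>y. \<eta> (\<pi> y))"
    let ?\<tau> = "\<pi> \<circ> Transposition.transpose x (x + z)"
    let ?r = "\<lambda>\<eta>. path_integral (form_of_germ u) (\<lambda>y. \<eta> (?\<tau> y)) p"
    have g0: "form_of_germ u x (x + z) \<in> L2 \<alpha>" by (rule form_of_germ_L2(1)[OF \<alpha> u z])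
    have g: "?g \<in> L2 \<alpha>" by (rule L2_relabel[OF \<alpha> Cons.prems(2) g0])
    have "(\<lambda>\<eta>. (form_of_germ u x (x + z) \<eta>)\<^sup>2) \<in> borel_measurable (mu \<alpha>)"
      using g0 by (intro borel_measurable_power) (simp add: L2_def)
    from integral_relabel[OF \<alpha> Cons.prems(2) this]
    have n: "(\<integral>\<eta>. (?g \<eta>)\<^sup>2 \<partial>mu \<alpha>) \<le> (germ_norm \<alpha> u)\<^sup>2" using form_of_germ_L2(2)[OF \<alpha> u z, of x] by simp
    have b: "\<bar>\<integral>\<eta>. f \<eta> * ?g \<eta> \<partial>mu \<alpha>\<bar> \<le> M * germ_norm \<alpha> u"
      by (rule order_trans[OF abs_integral_mult_le(2)[OF \<alpha> g f M]])
         (use M0 n in \<open>auto intro!: mult_left_mono real_le_lsqrt\<close>)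
    have "inj ?\<tau>" using Cons.prems(2) by (intro inj_compose) simp_all
    from Cons.IH[OF p this]
    have r: "integrable (mu \<alpha>) (\<lambda>\<eta>. f \<eta> * ?r \<eta>)"
      "\<bar>\<integral>\<eta>. f \<eta> * ?r \<eta> \<partial>mu \<alpha>\<bar> \<le> M * real (length p) * germ_norm \<alpha> u" by blast+
    have gi: "integrable (mu \<alpha>) (\<lambda>\<eta>. f \<eta> * ?g \<eta>)" by (rule abs_integral_mult_le(1)[OF \<alpha> g f M])
    have eq: "f \<eta> * path_integral (form_of_germ u) (\<lambda>y. \<eta> (\<pi> y)) (a # p) = f \<eta> * ?g \<eta> + f \<eta> * ?r \<eta>" for \<eta>
      by (simp add: a exch_relabel distrib_left)
    have i: "integrable (mu \<alpha>) (\<lambda>\<eta>. f \<eta> * path_integral (form_of_germ u) (\<lambda>y. \<eta> (\<pi> y)) (a # p))"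
      unfolding eq by (rule Bochner_Integration.integrable_add[OF gi r(1)])
    have "\<bar>\<integral>\<eta>. f \<eta> * path_integral (form_of_germ u) (\<lambda>y. \<eta> (\<pi> y)) (a # p) \<partial>mu \<alpha>\<bar>
      = \<bar>(\<integral>\<eta>. f \<eta> * ?g \<eta> \<partial>mu \<alpha>) + (\<integral>\<eta>. f \<eta> * ?r \<eta> \<partial>mu \<alpha>)\<bar>"
      unfolding eq Bochner_Integration.integral_add[OF gi r(1)] ..
    also have "\<dots> \<le> M * germ_norm \<alpha> u + M * real (length p) * germ_norm \<alpha> u" using b r(2) by linarith
    also have "\<dots> = M * real (length (a # p)) * germ_norm \<alpha> u" by (simp add: algebra_simps)
    finally show ?case using i by blast
  qed simp
  from this[of "\<lambda>y. y"] show "integrable (mu \<alpha>) (\<lambda>\<eta>. f \<eta> * path_integral (form_of_germ u) \<eta> p)"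
    "\<bar>test_functional \<alpha> f p u\<bar> \<le> M * real (length p) * germ_norm \<alpha> u"
    by (simp_all add: test_functional_def)
qed

lemma test_functional_zero_on_closure:
  assumes \<alpha>: "\<alpha> \<in> M1_circle" and f: "f \<in> bounded_observables \<alpha>" and p: "\<forall>(x, z)\<in>set p. unit_step z"
    and 0: "\<And>v. v \<in> S \<Longrightarrow> test_functional \<alpha> f p v = 0" and u: "u \<in> L2_closure \<alpha> S"
  shows "test_functional \<alpha> f p u = 0"
proof (rule ccontr)
  let ?l = "test_functional \<alpha> f p"
  assume "?l u \<noteq> 0"
  from f obtain M where M: "\<And>\<eta>. \<eta> \<in> Sigma_inf \<Longrightarrow> \<bar>f \<eta>\<bar> \<le> M" and fm: "f \<in> borel_measurable (mu \<alpha>)"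
    by (auto simp: bounded_observables_def)
  have M0: "0 \<le> M"
    using M[of "\<lambda>_. empty_site"] Sigma_infI[of "\<lambda>_. empty_site"] by (simp add: order_trans[OF abs_ge_zero])
  have uL: "u \<in> L2_germs \<alpha>" using u L2_closure_L2 by blast
  define C where "C = M * real (length p) + 1"
  have C: "0 < C" using M0 by (simp add: C_def add_nonneg_pos)
  then have "0 < \<bar>?l u\<bar> / C" using \<open>?l u \<noteq> 0\<close> by simp
  from L2_closureD[OF u this] obtain v where v: "v \<in> S" "v \<in> L2_germs \<alpha>" "germ_norm \<alpha> (u - v) < \<bar>?l u\<bar> / C"
    by blast
  have uv: "u - v \<in> L2_germs \<alpha>" by (rule L2_germs_diff[OF uL v(2)])
  note b = test_functional_bound[OF \<alpha> _ fm M p]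
  have "?l ((u - v) + v) = ?l (u - v) + ?l v"
    unfolding test_functional_def path_integral_plus distrib_left
    by (rule Bochner_Integration.integral_add[OF b(1)[OF uv] b(1)[OF v(2)]])
  then have "?l u = ?l (u - v)" using 0[OF v(1)] by simp
  then have "\<bar>?l u\<bar> \<le> M * real (length p) * germ_norm \<alpha> (u - v)" using b(2)[OF uv] by simp
  also have "\<dots> \<le> C * germ_norm \<alpha> (u - v)" by (intro mult_right_mono) (simp_all add: C_def)
  also have "\<dots> < \<bar>?l u\<bar>" using v(3) C by (simp add: field_simps)
  finally show False by simp
qed

text \<open>Suppose that a path turns every configuration charged by \<open>f\<close> into one where the pattern observed
  by \<open>f\<close> has moved by \<open>e\<close>. Since the measure is invariant under relabelling of the sites, integrating
  the increment of \<open>\<Sum>\<^sub>x \<tau>\<^sub>x h\<close> against \<open>f\<close> gives the sum over \<open>x\<close> of the correlations of \<open>\<tau>\<^sub>e f - f\<close> and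
  \<open>\<tau>\<^sub>x h\<close>, which telescopes, as correlations at a large distance are constant.\<close>

lemma test_functional_nabla_Sigma:
  assumes \<alpha>: "\<alpha> \<in> M1_circle" and w: "C2_circle \<omega>" and h: "h \<in> T_omega \<omega>"
    and f: "f \<in> bounded_observables \<alpha>" "depends_on f P" "finite P"
    and hole: "\<And>\<eta>. \<eta> \<in> Sigma_inf \<Longrightarrow> f \<eta> \<noteq> 0 \<Longrightarrow> hole_path \<eta> p"
    and \<sigma>: "inj \<sigma>" "\<And>\<eta>. path_end \<eta> p = (\<lambda>y. \<eta> (\<sigma> y))"
    and shift: "\<And>\<eta>. \<eta> \<in> Sigma_inf \<Longrightarrow> f \<eta> = translate e f (path_end \<eta> p)"
  shows "test_functional \<alpha> f p (nabla_Sigma h) = 0"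
proof -
  from T_omega_cylinder[OF h] obtain A where A: "finite A" "depends_on h A" unfolding cylinder_def by blast
  have hB: "translate x h \<in> bounded_observables \<alpha>" for x
    by (intro bounded_observables_translate T_omega_bounded_observables[OF w h])
  have feB: "translate e f \<in> bounded_observables \<alpha>" by (intro bounded_observables_translate f)
  define m where "m x = (\<integral>\<eta>. f \<eta> * translate x h \<eta> \<partial>mu \<alpha>)" for x
  define c where "c = (\<integral>\<eta>. f \<eta> \<partial>mu \<alpha>) * (\<integral>\<eta>. h \<eta> \<partial>mu \<alpha>)"
  define W where "W = meeting A P"
  have W: "finite W" using A(1) f(3) by (simp add: W_def)
  have far: "m x = c" if "x \<notin> W" for x
  proof -
    have d: "depends_on (translate x h) ((\<lambda>a. x + a) ` A)"
      unfolding depends_on_def translate_def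
    proof (intro ballI impI)
      fix \<eta> \<xi> assume s: "\<eta> \<in> Sigma_inf" "\<xi> \<in> Sigma_inf" and eq: "\<forall>y\<in>(\<lambda>a. x + a) ` A. \<eta> y = \<xi> y"
      show "h (\<lambda>y. \<eta> (x + y)) = h (\<lambda>y. \<xi> (x + y))"
        by (rule depends_onD[OF A(2) Sigma_inf_comp[OF s(1)] Sigma_inf_comp[OF s(2)]]) (use eq in blast)
    qed
    have dj: "P \<inter> (\<lambda>a. x + a) ` A = {}" using that by (auto simp: W_def meeting_iff)
    have "(\<integral>\<eta>. translate x h \<eta> \<partial>mu \<alpha>) = (\<integral>\<eta>. h \<eta> \<partial>mu \<alpha>)"
      unfolding translate_def
      by (rule integral_relabel[OF \<alpha>])
         (use T_omega_bounded_observables[OF w h, of \<alpha>] in \<open>auto simp: inj_def bounded_observables_def\<close>)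
    then show ?thesis unfolding m_def c_def
      using integral_mult_disjoint[OF \<alpha> f(1,2) hB d dj] by simp
  qed
  define X where "X = W \<union> (\<lambda>x. x + e) ` W \<union> meeting A (path_sites p)"
  have X: "finite X" using W A(1) by (simp add: X_def)
  let ?S = "trans_sum X h"
  have SB: "?S \<in> bounded_observables \<alpha>"
    unfolding trans_sum_def[abs_def] by (intro bounded_observables_sum X hB)
  have pot: "local_potential (nabla_Sigma h) (path_sites p) ?S"
    by (rule nabla_Sigma_local_potential[OF A(2,1) X]) (auto simp: X_def)
  have "f \<eta> * path_integral (form_of_germ (nabla_Sigma h)) \<eta> p
     = translate e f (\<lambda>y. \<eta> (\<sigma> y)) * ?S (\<lambda>y. \<eta> (\<sigma> y)) - f \<eta> * ?S \<eta>" if \<eta>: "\<eta> \<in> Sigma_inf" for \<eta>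
  proof (cases "f \<eta> = 0")
    case True
    then show ?thesis using shift[OF \<eta>] by (simp add: \<sigma>(2))
  next
    case False
    from local_potential_path_integral[OF pot \<eta> hole[OF \<eta> False] order_refl]
    show ?thesis using shift[OF \<eta>] by (simp add: \<sigma>(2) right_diff_distrib)
  qed
  then have "test_functional \<alpha> f p (nabla_Sigma h)
     = (\<integral>\<eta>. translate e f (\<lambda>y. \<eta> (\<sigma> y)) * ?S (\<lambda>y. \<eta> (\<sigma> y)) - f \<eta> * ?S \<eta> \<partial>mu \<alpha>)"
    unfolding test_functional_def by (intro Bochner_Integration.integral_cong) simp_all
  also have "\<dots> = (\<integral>\<eta>. translate e f (\<lambda>y. \<eta> (\<sigma> y)) * ?S (\<lambda>y. \<eta> (\<sigma> y)) \<partial>mu \<alpha>) - (\<integral>\<eta>. f \<eta> * ?S \<eta> \<partial>mu \<alpha>)"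
    by (rule Bochner_Integration.integral_diff[OF bounded_observables_integrable[OF \<alpha>
          bounded_observables_relabel[OF bounded_observables_mult[OF feB SB]]]
          bounded_observables_integrable[OF \<alpha> bounded_observables_mult[OF f(1) SB]]])
  also have "(\<integral>\<eta>. translate e f (\<lambda>y. \<eta> (\<sigma> y)) * ?S (\<lambda>y. \<eta> (\<sigma> y)) \<partial>mu \<alpha>) = (\<integral>\<eta>. translate e f \<eta> * ?S \<eta> \<partial>mu \<alpha>)"
    by (rule integral_relabel[OF \<alpha> \<sigma>(1), of "\<lambda>\<eta>. translate e f \<eta> * ?S \<eta>"])
       (use bounded_observables_mult[OF feB SB] in \<open>simp add: bounded_observables_def\<close>)
  also have "\<dots> = (\<Sum>x\<in>X. \<integral>\<eta>. translate e f \<eta> * translate x h \<eta> \<partial>mu \<alpha>)"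
    unfolding trans_sum_def sum_distrib_left
    by (intro Bochner_Integration.integral_sum bounded_observables_integrable[OF \<alpha>] bounded_observables_mult feB hB)
  also have "\<dots> = (\<Sum>x\<in>X. m (x - e))"
  proof (rule sum.cong[OF refl])
    fix x
    have "(\<integral>\<eta>. f (\<lambda>y. \<eta> (e + y)) * translate (x - e) h (\<lambda>y. \<eta> (e + y)) \<partial>mu \<alpha>) = m (x - e)"
      unfolding m_def
      by (rule integral_relabel[OF \<alpha>, of "\<lambda>y. e + y" "\<lambda>\<eta>. f \<eta> * translate (x - e) h \<eta>"])
         (use bounded_observables_mult[OF f(1) hB] in \<open>auto simp: bounded_observables_def inj_def\<close>)
    then show "(\<integral>\<eta>. translate e f \<eta> * translate x h \<eta> \<partial>mu \<alpha>) = m (x - e)"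
      by (simp add: translate_def algebra_simps)
  qed
  also have "(\<integral>\<eta>. f \<eta> * ?S \<eta> \<partial>mu \<alpha>) = (\<Sum>x\<in>X. m x)"
    unfolding trans_sum_def sum_distrib_left m_def
    by (intro Bochner_Integration.integral_sum bounded_observables_integrable[OF \<alpha>] bounded_observables_mult f hB)
  also have "(\<Sum>x\<in>X. m (x - e)) - (\<Sum>x\<in>X. m x) = (\<Sum>x\<in>X. m (x - e) - c) - (\<Sum>x\<in>X. m x - c)"
    by (simp add: sum_subtractf)
  also have "(\<Sum>x\<in>X. m x - c) = (\<Sum>x\<in>W. m x - c)"
    by (rule sum.mono_neutral_right) (use X far in \<open>auto simp: X_def\<close>)
  also have "(\<Sum>x\<in>X. m (x - e) - c) = (\<Sum>x\<in>(\<lambda>x. x + e) ` W. m (x - e) - c)"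
  proof (rule sum.mono_neutral_right[OF X])
    show "\<forall>x\<in>X - (\<lambda>x. x + e) ` W. m (x - e) - c = 0"
    proof
      fix x assume "x \<in> X - (\<lambda>x. x + e) ` W"
      then have "x - e \<notin> W" by (auto simp: image_iff)
      then show "m (x - e) - c = 0" using far by simp
    qed
  qed (unfold X_def, blast)
  also have "\<dots> = (\<Sum>x\<in>W. m x - c)" by (subst sum.reindex) (simp_all add: inj_on_def)
  finally show ?thesis by simp
qed

text \<open>The hole at \<open>e\<close> exchanges with the particle at \<open>0\<close>, then walks around it, through \<open>e'\<close>, \<open>e + e'\<close>
  and \<open>2 e + e'\<close>, to \<open>2 e\<close>: the particle and the hole in front of it have moved by \<open>e\<close>.\<close>

definition walk_around :: "site \<Rightarrow> site \<Rightarrow> jump_path" where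
  "walk_around e e' = [(0, e), (e', - e'), (e + e', - e), (e + e + e', - e), (e + e, e')]"

definition walk_sites :: "site \<Rightarrow> site \<Rightarrow> site list" where
  "walk_sites e e' = [0, e, e', e + e', e + e + e', e + e]"

definition walk_relabel :: "site \<Rightarrow> site \<Rightarrow> site \<Rightarrow> site" where
  "walk_relabel e e' y = (if y = e then 0 else if y = 0 then e' else if y = e' then e + e'
     else if y = e + e' then e + e + e' else if y = e + e + e' then e + e
     else if y = e + e then e else y)"

lemma walk_sites_distinct:
  assumes "i \<in> {1, 2}" shows "distinct (walk_sites (evec i) (evec (3 - i)))"
  using assms by (auto simp: walk_sites_def evec_def prod_eq_iff)

lemma walk_around_exch:
  "path_end \<eta> (walk_around e e') = exch (e + e) (e + e + e') (exch (e + e + e') (e + e')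
     (exch (e + e') e' (exch e' 0 (exch 0 e \<eta>))))"
  by (simp add: walk_around_def algebra_simps)

lemma exch_walk:
  assumes "distinct [x0, e, e', a, b, c]"
  shows "exch c b (exch b a (exch a e' (exch e' x0 (exch x0 e \<eta>)))) y
    = \<eta> (if y = e then x0 else if y = x0 then e' else if y = e' then a else if y = a then b
        else if y = b then c else if y = c then e else y)"
proof -
  from assms have ne: "x0 \<noteq> e" "x0 \<noteq> e'" "x0 \<noteq> a" "x0 \<noteq> b" "x0 \<noteq> c" "e \<noteq> e'" "e \<noteq> a" "e \<noteq> b" "e \<noteq> c"
    "e' \<noteq> a" "e' \<noteq> b" "e' \<noteq> c" "a \<noteq> b" "a \<noteq> c" "b \<noteq> c" by simp_all
  show ?thesis
    by (cases "y = x0"; cases "y = e"; cases "y = e'"; cases "y = a"; cases "y = b"; cases "y = c";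
        simp add: exch_alt ne ne[symmetric])
qed

lemma path_end_walk_around:
  assumes d: "distinct (walk_sites e e')"
  shows "path_end \<eta> (walk_around e e') = (\<lambda>y. \<eta> (walk_relabel e e' y))"
proof
  define a b c where "a = e + e'" and "b = e + e + e'" and "c = e + e"
  have "distinct [0, e, e', a, b, c]" using d by (simp add: walk_sites_def a_def b_def c_def)
  from exch_walk[OF this] show "path_end \<eta> (walk_around e e') y = \<eta> (walk_relabel e e' y)" for y
    unfolding walk_around_exch walk_relabel_def unfolding a_def[symmetric] b_def[symmetric] unfolding c_def[symmetric] .
qed

lemma inj_walk_relabel:
  assumes d: "distinct (walk_sites e e')" shows "inj (walk_relabel e e')"
proof (rule injI)
  define a b c where "a = e + e'" and "b = e + e + e'" and "c = e + e"
  have d': "distinct [0, e, e', a, b, c]" using d by (simp add: walk_sites_def a_def b_def c_def)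
  fix x y assume "walk_relabel e e' x = walk_relabel e e' y"
  then show "x = y" using d'
    unfolding walk_relabel_def unfolding a_def[symmetric] b_def[symmetric] unfolding c_def[symmetric]
    by (simp split: if_splits)
qed

lemma hole_path_walk_around:
  assumes d: "distinct (walk_sites e e')" and u: "unit_step e" "unit_step e'" and h: "occ \<eta> e = 0"
  shows "hole_path \<eta> (walk_around e e')"
proof -
  have s: "e' + - e' = 0" "e + e' + - e = e'" "e + e + e' + - e = e + e'" "0 + e = e" by simp_all
  define a b c where "a = e + e'" and "b = e + e + e'" and "c = e + e"
  have "distinct [0, e, e', a, b, c]" using d by (simp add: walk_sites_def a_def b_def c_def)
  then show ?thesis unfolding walk_around_def hole_path.simps s
    unfolding a_def[symmetric] b_def[symmetric] unfolding c_def[symmetric]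
    using u h by (auto simp: occ_exch)
qed

lemma path_sites_walk_around: "path_sites (walk_around e e') = set (walk_sites e e')"
  by (auto simp: path_sites_def walk_around_def walk_sites_def)

text \<open>The particle at \<open>0\<close> moves by \<open>e\<close>, and the hole pushes the bystanders backwards.\<close>

lemma charge_current_walk_around:
  assumes i: "i \<in> {1, 2}" and v: "v \<in> charges \<omega>" "w \<in> charges \<omega>" and \<eta>: "\<eta> \<in> Sigma_inf"
    and h: "\<eta> (evec i) = empty_site"
  defines "e \<equiv> evec i" and "e' \<equiv> evec (3 - i)"
    and "g \<equiv> if i = 1 then v else w" and "g' \<equiv> if i = 1 then w else v"
  shows "path_integral (form_of_germ (charge_current v w)) \<eta> (walk_around e e')
    = g (\<eta> 0) - g' (\<eta> e') - g (\<eta> (e + e')) - g (\<eta> (e + e + e')) + g' (\<eta> (e + e))"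
proof -
  have d: "distinct (walk_sites e e')" unfolding e_def e'_def by (rule walk_sites_distinct[OF i])
  have u: "unit_step e" "unit_step e'" by (simp_all add: e_def e'_def del: evec_simps)
  have o: "occ \<eta> e = 0" using h \<eta> by (simp add: e_def occ_Sigma)
  let ?W = "set (walk_sites e e')"
  let ?t = "\<lambda>\<eta> y. real_of_int (fst y) * v (\<eta> y) + real_of_int (snd y) * w (\<eta> y)"
  have "path_integral (form_of_germ (charge_current v w)) \<eta> (walk_around e e')
     = (\<Sum>y\<in>?W. ?t (path_end \<eta> (walk_around e e')) y) - (\<Sum>y\<in>?W. ?t \<eta> y)"
    by (rule local_potential_path_integral[OF charge_current_local_potential[OF v finite_set] \<eta>
          hole_path_walk_around[OF d u o]]) (simp add: path_sites_walk_around)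
  also have "\<dots> = (\<Sum>y\<leftarrow>walk_sites e e'. ?t (\<lambda>y. \<eta> (walk_relabel e e' y)) y) - (\<Sum>y\<leftarrow>walk_sites e e'. ?t \<eta> y)"
    unfolding path_end_walk_around[OF d] using d by (simp only: sum_list_distinct_conv_sum_set)
  also have "\<dots> = g (\<eta> 0) - g' (\<eta> e') - g (\<eta> (e + e')) - g (\<eta> (e + e + e')) + g' (\<eta> (e + e))"
  proof -
    have r: "walk_relabel e e' 0 = e'" "walk_relabel e e' e = 0" "walk_relabel e e' e' = e + e'"
      "walk_relabel e e' (e + e') = e + e + e'" "walk_relabel e e' (e + e + e') = e + e"
      "walk_relabel e e' (e + e) = e"
      using d by (auto simp: walk_relabel_def walk_sites_def)
    have hv: "v (\<eta> e) = 0" "w (\<eta> e) = 0" using h v by (simp_all add: e_def)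
    show ?thesis
    proof (cases "i = 1")
      case True
      then have "fst e = 1" "snd e = 0" "fst e' = 0" "snd e' = 1" "g = v" "g' = w"
        by (simp_all add: e_def e'_def g_def g'_def evec_def)
      then show ?thesis by (simp add: walk_sites_def r hv)
    next
      case False
      then have "fst e = 0" "snd e = 1" "fst e' = 1" "snd e' = 0" "g = w" "g' = v"
        using i by (simp_all add: e_def e'_def g_def g'_def evec_def)
      then show ?thesis by (simp add: walk_sites_def r hv)
    qed
  qed
  finally show ?thesis .
qed

text \<open>Let \<open>f = g(\<eta>\<^sub>0) (1 - \<eta>\<^sub>e)\<close> be the component of the current. The jump from \<open>0\<close> into a hole at \<open>e\<close> moves
  that hole by \<open>-e\<close>, so the expectation of \<open>f\<close> vanishes. The walk around the particle moves the particle
  and the hole by \<open>e\<close>, so the expectation of \<open>f\<close> times the integral of the current along the walk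
  vanishes too. There the bystanders are independent of \<open>f\<close> and contribute nothing, as \<open>f\<close> is centred;
  what remains is the expectation of \<open>f g(\<eta>\<^sub>0) = f\<^sup>2\<close>.\<close>

lemma current_in_closure_of_exact:
  assumes \<alpha>: "\<alpha> \<in> M1_circle" and w: "C2_circle \<omega>" and v: "v \<in> charges \<omega>" "v' \<in> charges \<omega>"
    and j: "charge_current v v' \<in> germs_E \<omega> \<alpha>" and i: "i \<in> {1, 2}"
  shows "AE \<eta> in mu \<alpha>. component i (charge_current v v') \<eta> = 0"
proof -
  let ?j = "charge_current v v'"
  define e e' where "e = evec i" and "e' = evec (3 - i)"
  define g g' where "g = (if i = 1 then v else v')" and "g' = (if i = 1 then v' else v)"
  have g: "g \<in> charges \<omega>" "g' \<in> charges \<omega>" using v by (auto simp: g_def g'_def)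
  have d: "distinct (walk_sites e e')" unfolding e_def e'_def by (rule walk_sites_distinct[OF i])
  have u: "unit_step e" "unit_step e'" by (simp_all add: e_def e'_def del: evec_simps)
  have gB: "(\<lambda>\<eta>. g (\<eta> x)) \<in> bounded_observables \<alpha>" "(\<lambda>\<eta>. g' (\<eta> x)) \<in> bounded_observables \<alpha>" for x
    by (rule bounded_observables_charge[OF w g(1)], rule bounded_observables_charge[OF w g(2)])
  have oB: "(\<lambda>\<eta>. 1 - occ \<eta> x) \<in> bounded_observables \<alpha>" for x
    by (intro bounded_observables_diff bounded_observables_const bounded_observables_occ)
  have c: "component i ?j \<eta> = g (\<eta> 0) * (1 - occ \<eta> e)" for \<eta>
    using component_charge_current[OF i, of v v' \<eta>] by (simp add: g_def e_def)
  have idem: "(1 - occ \<eta> x) * (1 - occ \<eta> x) = 1 - occ \<eta> x" if "\<eta> \<in> Sigma_inf" for \<eta> x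
    using that by (simp add: occ_Sigma)
  have zero: "test_functional \<alpha> f p ?j = 0"
    if "f \<in> bounded_observables \<alpha>" "depends_on f P" "finite P" "\<forall>(x, z)\<in>set p. unit_step z"
      "\<And>\<eta>. \<eta> \<in> Sigma_inf \<Longrightarrow> f \<eta> \<noteq> 0 \<Longrightarrow> hole_path \<eta> p"
      "inj \<sigma>" "\<And>\<eta>. path_end \<eta> p = (\<lambda>y. \<eta> (\<sigma> y))"
      "\<And>\<eta>. \<eta> \<in> Sigma_inf \<Longrightarrow> f \<eta> = translate a f (path_end \<eta> p)" for f P p \<sigma> a
  proof (rule test_functional_zero_on_closure[OF \<alpha> that(1,4) _ j[unfolded germs_E_def]])
    fix u assume "u \<in> germs_E_zero \<omega>"
    then obtain h where "u = nabla_Sigma h" "h \<in> T_omega \<omega>"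
      by (auto simp: germs_E_zero_def T_omega_zero_def)
    then show "test_functional \<alpha> f p u = 0"
      using test_functional_nabla_Sigma[OF \<alpha> w _ that(1-3,5-8)] by blast
  qed
  let ?f = "\<lambda>\<eta>. g (\<eta> 0) * (1 - occ \<eta> e)"
  have fB: "?f \<in> bounded_observables \<alpha>" by (intro bounded_observables_mult gB oB)
  have fd: "depends_on ?f {0, e}" by (auto simp: depends_on_def occ_alt)
  have "test_functional \<alpha> (\<lambda>\<eta>. 1 - occ \<eta> e) [(0, e)] ?j = 0"
  proof (rule zero[where P = "{e}" and \<sigma> = "Transposition.transpose 0 e" and a = "- e"])
    show "depends_on (\<lambda>\<eta>. 1 - occ \<eta> e) {e}" by (auto simp: depends_on_def occ_alt)
    show "path_end \<eta> [(0, e)] = (\<lambda>y. \<eta> (Transposition.transpose 0 e y))" for \<eta>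
      using exch_relabel[of 0 e \<eta> "\<lambda>y. y"] by simp
    show "1 - occ \<eta> e = translate (- e) (\<lambda>\<eta>. 1 - occ \<eta> e) (path_end \<eta> [(0, e)])" for \<eta>
      by (simp add: translate_def occ_alt exch_alt)
    show "hole_path \<eta> [(0, e)]" if "\<eta> \<in> Sigma_inf" "1 - occ \<eta> e \<noteq> 0" for \<eta>
      using that u by (simp add: occ_Sigma split: if_splits)
  qed (use oB u in simp_all)
  moreover have "test_functional \<alpha> (\<lambda>\<eta>. 1 - occ \<eta> e) [(0, e)] ?j = (\<integral>\<eta>. ?f \<eta> \<partial>mu \<alpha>)"
    unfolding test_functional_def
  proof (rule Bochner_Integration.integral_cong[OF refl])
    fix \<eta> assume "\<eta> \<in> space (mu \<alpha>)"
    then have \<eta>: "\<eta> \<in> Sigma_inf" by simp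
    have "path_integral (form_of_germ ?j) \<eta> [(0, e)] = ?f \<eta>"
      using form_of_germ_pos[of ?j 0 i \<eta>] c by (simp add: e_def translate_def)
    then show "(1 - occ \<eta> e) * path_integral (form_of_germ ?j) \<eta> [(0, e)] = ?f \<eta>"
      using idem[OF \<eta>, of e] by (simp add: mult.left_commute)
  qed
  ultimately have mean: "(\<integral>\<eta>. ?f \<eta> \<partial>mu \<alpha>) = 0" by simp
  have bystander: "(\<integral>\<eta>. ?f \<eta> * k (\<eta> x) \<partial>mu \<alpha>) = 0" "integrable (mu \<alpha>) (\<lambda>\<eta>. ?f \<eta> * k (\<eta> x))"
    if "x \<notin> {0, e}" "(\<lambda>\<eta>. k (\<eta> x)) \<in> bounded_observables \<alpha>" for k x
  proof -
    have "depends_on (\<lambda>\<eta>. k (\<eta> x)) {x}" by (auto simp: depends_on_def)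
    from integral_mult_disjoint[OF \<alpha> fB fd that(2) this] that(1) mean
    show "(\<integral>\<eta>. ?f \<eta> * k (\<eta> x) \<partial>mu \<alpha>) = 0" by simp
    show "integrable (mu \<alpha>) (\<lambda>\<eta>. ?f \<eta> * k (\<eta> x))"
      by (intro bounded_observables_integrable[OF \<alpha>] bounded_observables_mult[OF fB that(2)])
  qed
  have "test_functional \<alpha> ?f (walk_around e e') ?j = 0"
  proof (rule zero[where P = "{0, e}" and \<sigma> = "walk_relabel e e'" and a = e])
    show "\<forall>(x, z)\<in>set (walk_around e e'). unit_step z" using u by (simp add: walk_around_def)
    show "hole_path \<eta> (walk_around e e')" if "\<eta> \<in> Sigma_inf" "?f \<eta> \<noteq> 0" for \<eta>
      by (rule hole_path_walk_around[OF d u]) (use that in \<open>auto simp: occ_Sigma split: if_splits\<close>)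
    have r: "walk_relabel e e' e = 0" "walk_relabel e e' (e + e) = e"
      using d by (auto simp: walk_relabel_def walk_sites_def)
    show "?f \<eta> = translate e ?f (path_end \<eta> (walk_around e e'))" for \<eta>
      unfolding path_end_walk_around[OF d] translate_def by (simp add: r occ_alt)
  qed (use fB fd inj_walk_relabel[OF d] path_end_walk_around[OF d] in simp_all)
  moreover have "test_functional \<alpha> ?f (walk_around e e') ?j
     = (\<integral>\<eta>. ?f \<eta> * g (\<eta> 0) - ?f \<eta> * g' (\<eta> e') - ?f \<eta> * g (\<eta> (e + e')) - ?f \<eta> * g (\<eta> (e + e + e'))
         + ?f \<eta> * g' (\<eta> (e + e)) \<partial>mu \<alpha>)"
    unfolding test_functional_def
  proof (rule Bochner_Integration.integral_cong[OF refl])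
    fix \<eta> assume "\<eta> \<in> space (mu \<alpha>)"
    then have \<eta>: "\<eta> \<in> Sigma_inf" by simp
    show "?f \<eta> * path_integral (form_of_germ ?j) \<eta> (walk_around e e')
      = ?f \<eta> * g (\<eta> 0) - ?f \<eta> * g' (\<eta> e') - ?f \<eta> * g (\<eta> (e + e')) - ?f \<eta> * g (\<eta> (e + e + e'))
         + ?f \<eta> * g' (\<eta> (e + e))"
    proof (cases "\<eta> e = empty_site")
      case True
      then show ?thesis
        using charge_current_walk_around[OF i v \<eta>] unfolding e_def e'_def g_def g'_def
        by (simp only: right_diff_distrib distrib_left)
    next
      case False
      then show ?thesis using \<eta> by (simp add: occ_Sigma)
    qed
  qed
  moreover have "\<dots> = (\<integral>\<eta>. ?f \<eta> * g (\<eta> 0) \<partial>mu \<alpha>)"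
  proof -
    have ne: "e' \<notin> {0, e}" "e + e' \<notin> {0, e}" "e + e + e' \<notin> {0, e}" "e + e \<notin> {0, e}"
      using d by (auto simp: walk_sites_def)
    note b1 = bystander[OF ne(1) gB(2)] and b2 = bystander[OF ne(2) gB(1)]
      and b3 = bystander[OF ne(3) gB(1)] and b4 = bystander[OF ne(4) gB(2)]
    have b0: "integrable (mu \<alpha>) (\<lambda>\<eta>. ?f \<eta> * g (\<eta> 0))"
      by (intro bounded_observables_integrable[OF \<alpha>] bounded_observables_mult[OF fB] gB)
    show ?thesis
      by (simp only: Bochner_Integration.integral_add Bochner_Integration.integral_diff
          Bochner_Integration.integrable_add Bochner_Integration.integrable_diff b0 b1 b2 b3 b4 diff_0_right add_0_right)
  qed
  ultimately have "(\<integral>\<eta>. ?f \<eta> * g (\<eta> 0) \<partial>mu \<alpha>) = 0" by simp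
  moreover have "(\<integral>\<eta>. ?f \<eta> * g (\<eta> 0) \<partial>mu \<alpha>) = (\<integral>\<eta>. (component i ?j \<eta>)\<^sup>2 \<partial>mu \<alpha>)"
  proof (rule Bochner_Integration.integral_cong[OF refl])
    fix \<eta> assume "\<eta> \<in> space (mu \<alpha>)"
    then have \<eta>: "\<eta> \<in> Sigma_inf" by simp
    have "(component i ?j \<eta>)\<^sup>2 = g (\<eta> 0) * g (\<eta> 0) * ((1 - occ \<eta> e) * (1 - occ \<eta> e))"
      by (simp add: c power2_eq_square algebra_simps)
    then show "?f \<eta> * g (\<eta> 0) = (component i ?j \<eta>)\<^sup>2" unfolding idem[OF \<eta>] by simp
  qed
  moreover have "integrable (mu \<alpha>) (\<lambda>\<eta>. (component i ?j \<eta>)\<^sup>2)"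
    unfolding c power2_eq_square
    by (intro bounded_observables_integrable[OF \<alpha>] bounded_observables_mult fB)
  ultimately have "AE \<eta> in mu \<alpha>. (component i ?j \<eta>)\<^sup>2 = 0"
    using integral_nonneg_eq_0_iff_AE[of "mu \<alpha>" "\<lambda>\<eta>. (component i ?j \<eta>)\<^sup>2"] by simp
  then show ?thesis by simp
qed

section \<open>The decomposition\<close>

text \<open>On the jumps of an isolated particle a germ of the class is a charge, and the current of that charge
  agrees with it there. The difference is the gradient of its potential on finite configurations,
  hence on all configurations, as both sides are local.\<close>

lemma closed_germ_decomposition:
  assumes \<alpha>: "\<alpha> \<in> M1_circle" and w: "C2_circle \<omega>"
    and u: "closed_germ \<alpha> u" "fst u \<in> T_omega \<omega>" "snd u \<in> T_omega \<omega>"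
  shows "u \<in> exact_germs \<omega> + germs_J \<omega>"
proof -
  let ?s = "\<lambda>s. (\<lambda>_. empty_site)(0 := s) :: config"
  from T_omega_single_particle[OF w u(2)] obtain v where
    v: "v \<in> charges \<omega>" "\<And>s. s \<in> site_states \<Longrightarrow> fst u (?s s) = v s" by blast
  from T_omega_single_particle[OF w u(3)] obtain v' where
    v': "v' \<in> charges \<omega>" "\<And>s. s \<in> site_states \<Longrightarrow> snd u (?s s) = v' s" by blast
  define j where "j = charge_current v v'"
  define u' where "u' = u + (-1) *\<^sub>R j"
  have ccm: "(-1) *\<^sub>R j = charge_current (\<lambda>s. - 1 * v s) (\<lambda>s. - 1 * v' s)"
    by (simp add: j_def charge_current_def scaleR_fun_def)
  have closed': "closed_germ \<alpha> u'"
    unfolding u'_def ccm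
    by (intro closed_germ_add u closed_germ_charge_current[OF \<alpha> w] charges_scale v v')
  have T': "component i u' \<in> T_omega \<omega>" for i
  proof -
    have "(\<lambda>\<eta>. component i u \<eta> - component i j \<eta>) \<in> T_omega \<omega>"
      using u(2,3) charge_current_T_omega[OF w v(1) v'(1)]
      by (intro T_omega_diff) (auto simp: component_def j_def)
    moreover have "component i u' = (\<lambda>\<eta>. component i u \<eta> - component i j \<eta>)"
      by (auto simp: u'_def component_def fun_eq_iff scaleR_fun_def)
    ultimately show ?thesis by simp
  qed
  have iso: "component i u' (?s s) = 0" if i: "i \<in> {1, 2}" and s: "s \<in> site_states" for i s
  proof -
    have e: "occ (?s s) (evec i) = 0" by (simp add: occ_alt)
    have "component i j (?s s) = (if i = 1 then v else v') s"
      unfolding j_def component_charge_current[OF i] e by simp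
    then show ?thesis using v(2)[OF s] v'(2)[OF s] i
      by (auto simp: u'_def component_def scaleR_fun_def)
  qed
  obtain R where R: "\<And>i. i \<in> {1, 2} \<Longrightarrow> depends_on (component i u') (site_box R)"
  proof -
    from T_omega_cylinder[OF T'[of 1]] obtain A where A: "finite A" "depends_on (component 1 u') A"
      unfolding cylinder_def by blast
    from T_omega_cylinder[OF T'[of 2]] obtain B where B: "finite B" "depends_on (component 2 u') B"
      unfolding cylinder_def by blast
    from finite_subset_site_box[of "A \<union> B"] A B obtain R where "A \<union> B \<subseteq> site_box R" by blast
    then show ?thesis using that[of R] A B depends_on_mono by (metis insertE le_sup_iff singletonD)
  qed
  interpret isolated_closed_germ \<alpha> u' R
    by unfold_locales (use closed' R iso in blast)+
  have h: "removal \<in> T_omega \<omega>" by (rule removal_T_omega[OF w T'])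
  have "component i u' \<eta> = nabla_Sigma_comp i removal \<eta>" if \<eta>: "\<eta> \<in> Sigma_inf" and i: "i \<in> {1, 2}" for \<eta> i
  proof -
    from T_omega_cylinder[OF T'[of i]] obtain A where A: "finite A" "depends_on (component i u') A"
      unfolding cylinder_def by blast
    from T_omega_cylinder[OF nabla_Sigma_comp_T_omega[OF w h]] obtain B where
      B: "finite B" "depends_on (nabla_Sigma_comp i removal) B" unfolding cylinder_def by blast
    let ?\<xi> = "trunc (A \<union> B) \<eta>"
    have "finite (particles ?\<xi>)"
      by (rule finite_subset[of _ "A \<union> B"]) (use A B in \<open>auto simp: pull_def\<close>)
    with \<eta> have "component i u' ?\<xi> = nabla_Sigma_comp i removal ?\<xi>"
      by (intro exact_on_finite_configurations i Sigma_inf_pull)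
    then show ?thesis
      using depends_on_trunc[OF A(2) _ \<eta>, of "A \<union> B"] depends_on_trunc[OF B(2) _ \<eta>, of "A \<union> B"] by simp
  qed
  then have "u' \<in> exact_germs \<omega>" unfolding exact_germs_def using h by blast
  moreover have "j \<in> germs_J \<omega>" unfolding germs_J_eq j_def using v(1) v'(1) by blast
  moreover have "u = u' + j" by (simp add: u'_def)
  ultimately show ?thesis by (simp only: set_plus_intro)
qed

lemma germs_T_zero_eq:
  assumes \<alpha>: "\<alpha> \<in> M1_circle" and w: "C2_circle \<omega>"
  shows "germs_T_zero \<omega> \<alpha> = exact_germs \<omega> + germs_J \<omega>"
proof (intro equalityI subsetI)
  fix u assume "u \<in> germs_T_zero \<omega> \<alpha>"
  then show "u \<in> exact_germs \<omega> + germs_J \<omega>"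
    unfolding germs_T_zero_def using closed_germ_decomposition[OF \<alpha> w] by blast
next
  fix u assume "u \<in> exact_germs \<omega> + germs_J \<omega>"
  then obtain u' j where u: "u = u' + j" "u' \<in> exact_germs \<omega>" "j \<in> germs_J \<omega>" by (rule set_plus_elim)
  from u(2) obtain h where h: "h \<in> T_omega \<omega>"
    and e: "\<And>\<eta> i. \<eta> \<in> Sigma_inf \<Longrightarrow> i \<in> {1, 2} \<Longrightarrow> component i u' \<eta> = nabla_Sigma_comp i h \<eta>"
    unfolding exact_germs_def by blast
  from u(3) obtain v v' where j: "j = charge_current v v'" "v \<in> charges \<omega>" "v' \<in> charges \<omega>"
    unfolding germs_J_eq by blast
  from T_omega_cylinder[OF h] obtain A where A: "finite A" "depends_on h A" unfolding cylinder_def by blast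
  have T: "fst u' \<in> T_omega \<omega>" "snd u' \<in> T_omega \<omega>" using exact_germs_T_omega[OF w u(2)] .
  have "closed_germ \<alpha> u'"
  proof (rule closed_germ_if_local_potentials[OF \<alpha> T_omega_germ_L2[OF \<alpha> w T]])
    fix W :: "site set" assume W: "finite W"
    have "local_potential (nabla_Sigma h) W (trans_sum (meeting A W) h)"
      by (rule nabla_Sigma_local_potential[OF A(2,1) finite_meeting[OF A(1) W] order_refl])
    moreover have "translate x (component i u') \<eta> = translate x (component i (nabla_Sigma h)) \<eta>"
      if "\<eta> \<in> Sigma_inf" "i \<in> {1, 2}" for \<eta> x i
      unfolding translate_def component_nabla_Sigma[OF that(2)] by (rule e[OF Sigma_inf_comp[OF that(1)] that(2)])
    ultimately have "local_potential u' W (trans_sum (meeting A W) h)" by (simp add: local_potential_def)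
    then show "\<exists>S. local_potential u' W S" by (rule exI[of _ "trans_sum (meeting A W) h"])
  qed
  then have "closed_germ \<alpha> u" unfolding u(1) j(1)
    by (rule closed_germ_add[OF _ closed_germ_charge_current[OF \<alpha> w j(2,3)]])
  moreover have "fst u \<in> T_omega \<omega>" "snd u \<in> T_omega \<omega>"
    using T_omega_add[OF T(1) charge_current_T_omega(1)[OF w j(2,3)]]
      T_omega_add[OF T(2) charge_current_T_omega(2)[OF w j(2,3)]]
    by (simp_all add: u(1) j(1) plus_fun_def)
  ultimately show "u \<in> germs_T_zero \<omega> \<alpha>" by (simp add: germs_T_zero_def)
qed

lemma germs_E_eq_closure_exact:
  assumes \<alpha>: "\<alpha> \<in> M1_circle" and w: "C2_circle \<omega>"
  shows "germs_E \<omega> \<alpha> = L2_closure \<alpha> (exact_germs \<omega>)"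
proof
  have "germs_E_zero \<omega> \<subseteq> exact_germs \<omega>"
    using nabla_Sigma_exact by (auto simp: germs_E_zero_def T_omega_zero_def)
  then show "germs_E \<omega> \<alpha> \<subseteq> L2_closure \<alpha> (exact_germs \<omega>)"
    unfolding germs_E_def by (rule L2_closure_mono)
  show "L2_closure \<alpha> (exact_germs \<omega>) \<subseteq> germs_E \<omega> \<alpha>"
    unfolding germs_E_def
    using L2_closure_mono[OF exact_germs_subset_closure[OF \<alpha> w], of \<alpha>] L2_closure_idem by (rule order_trans)
qed

lemma germs_J_L2:
  assumes \<alpha>: "\<alpha> \<in> M1_circle" and w: "C2_circle \<omega>" shows "germs_J \<omega> \<subseteq> L2_germs \<alpha>"
proof
  fix j assume "j \<in> germs_J \<omega>"
  then obtain v v' where j: "j = charge_current v v'" "v \<in> charges \<omega>" "v' \<in> charges \<omega>"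
    unfolding germs_J_eq by blast
  show "j \<in> L2_germs \<alpha>"
    unfolding j(1) by (rule T_omega_germ_L2[OF \<alpha> w charge_current_T_omega[OF w j(2,3)]])
qed

text \<open>Before closure the decomposition is an identity; the closure of the exact germs is a closed
  subspace, and adding the finite-dimensional space of currents keeps it closed.\<close>

theorem proposition5p8:
  fixes \<omega> :: "real \<Rightarrow> real" and \<alpha> :: "real measure \<times> real measure"
  assumes "C2_circle \<omega>" and "\<alpha> \<in> M1_circle"
  shows "germs_T \<omega> \<alpha> = germs_E \<omega> \<alpha> + germs_J \<omega> \<and>
    (\<forall>u \<in> germs_E \<omega> \<alpha> \<inter> germs_J \<omega>. AE \<eta> in mu \<alpha>. fst u \<eta> = 0 \<and> snd u \<eta> = 0)"
proof (intro conjI equalityI ballI)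
  note w = assms(1) and \<alpha> = assms(2)
  let ?X = "exact_germs \<omega>" and ?E = "germs_E \<omega> \<alpha>" and ?J = "germs_J \<omega>"
  have XE: "?X \<subseteq> ?E"
    unfolding germs_E_eq_closure_exact[OF \<alpha> w] by (rule L2_closure_superset[OF exact_germs_L2[OF \<alpha> w]])
  have E: "subspace ?E" "?E \<subseteq> L2_germs \<alpha>" "L2_closure \<alpha> ?E \<subseteq> ?E"
    unfolding germs_E_eq_closure_exact[OF \<alpha> w]
    by (rule subspace_L2_closure[OF subspace_exact_germs[OF w]], rule L2_closure_L2, rule L2_closure_idem)
  have JL: "?J \<subseteq> L2_germs \<alpha>" by (rule germs_J_L2[OF \<alpha> w])
  have T: "germs_T \<omega> \<alpha> = L2_closure \<alpha> (?X + ?J)"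
    unfolding germs_T_def germs_T_zero_eq[OF \<alpha> w] ..
  let ?G = "\<Union>i\<in>{1, 2}. {current_germ num_a i, current_germ num_p i,
     current_germ (num_a_ang \<omega>) i, current_germ (num_p_ang \<omega>) i}"
  have J: "?J = span ?G" by (simp add: germs_J_def)
  have "?G \<subseteq> L2_germs \<alpha>" using JL unfolding J by (rule order_trans[OF span_superset])
  then have "L2_closure \<alpha> (?E + ?J) \<subseteq> ?E + ?J"
    unfolding J by (intro L2_closure_add_span E) auto
  moreover have "L2_closure \<alpha> (?X + ?J) \<subseteq> L2_closure \<alpha> (?E + ?J)"
    by (intro L2_closure_mono set_plus_mono2 XE) simp
  ultimately show "germs_T \<omega> \<alpha> \<subseteq> ?E + ?J" unfolding T by blast
  show "?E + ?J \<subseteq> germs_T \<omega> \<alpha>"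
  proof
    fix u assume "u \<in> ?E + ?J"
    then obtain x j where u: "u = x + j" "x \<in> ?E" "j \<in> ?J" by (rule set_plus_elim)
    have L: "x \<in> L2_germs \<alpha>" "j \<in> L2_germs \<alpha>" using u(2,3) E(2) JL by auto
    show "u \<in> germs_T \<omega> \<alpha>"
      unfolding T u(1)
    proof (rule L2_closureI[OF L2_germs_add[OF L]])
      fix \<epsilon> :: real assume "0 < \<epsilon>"
      from L2_closureD[OF u(2)[unfolded germs_E_eq_closure_exact[OF \<alpha> w]] this]
      obtain y where y: "y \<in> ?X" "y \<in> L2_germs \<alpha>" "germ_norm \<alpha> (x - y) < \<epsilon>" by blast
      have "(x + j) - (y + j) = x - y" by simp
      then have "germ_norm \<alpha> ((x + j) - (y + j)) < \<epsilon>" using y(3) by (simp only:)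
      then show "\<exists>v\<in>?X + ?J. v \<in> L2_germs \<alpha> \<and> germ_norm \<alpha> ((x + j) - v) < \<epsilon>"
        by (intro bexI[OF _ set_plus_intro[OF y(1) u(3)]] conjI L2_germs_add[OF y(2) L(2)])
    qed
  qed
  fix u assume u: "u \<in> ?E \<inter> ?J"
  then obtain v v' where j: "u = charge_current v v'" "v \<in> charges \<omega>" "v' \<in> charges \<omega>"
    unfolding germs_J_eq by blast
  have "AE \<eta> in mu \<alpha>. component i u \<eta> = 0" if "i \<in> {1, 2}" for i
    using current_in_closure_of_exact[OF \<alpha> w j(2,3) _ that] u unfolding j(1) by blast
  from this[of 1] this[of 2] show "AE \<eta> in mu \<alpha>. fst u \<eta> = 0 \<and> snd u \<eta> = 0"
    by (simp add: component_def)
qed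

end
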